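(* Let $\lambda,\mu$ be strict partitions and let $T$ be a URT of shifted shape $\mu$. Then $$K_\lambda K_\mu=\sum_{\nu}c^{\nu}_{\lambda,\mu}K_\nu,$$ where $\nu$ ranges over strict partitions containing $\lambda$ and $c^\nu_{\lambda,\mu}$ is the number of increasing shifted skew tableaux $R$ of shape $\nu/\lambda$ such that $P(\mathfrak{row}(R))=T$.
   Context: Order $1'<1<2'<2<\cdots$. Shifted shape of strict $\lambda$: boxes $(i,j)$, $i\le j\le i+\lambda_i-1$; $(i,i)$ main diagonal; skew shape $\nu/\lambda$ = boxes of $\nu$ not in $\lambda$. A (skew) shifted tableau is increasing if its positive integer entries strictly increase along rows and down columns; $\mathfrak{row}(R)$ reads rows left to right from bottom row to top row. A weak set-valued shifted tableau of shape $\lambda$ is a filling with finite nonempty multisets of primed/unprimed positive integers such that: (1) smallest element of each box $\ge$ largest element of the box to its left; (2) smallest element of each box $\ge$ largest element of the box above; (3) no primed entries on the main diagonal; (4) each unprimed integer in at most one box per column; (5) each primed integer in at most one box per row. $x^T=\prod_ix_i^{a_i}$ with $a_i$ the number of occurrences of $i$ and $i'$; $K_\lambda=\sum_Tx^T$ over such tableaux of shape $\lambda$. Shifted Hecke insertion of $x$ into an increasing shifted tableau: first insert $x$ into row 1. When $x$ is inserted into a row (resp. column): (i) if $x$ is weakly larger than all entries and adjoining a box containing $x$ at the end gives an increasing shifted tableau, do so and stop (adjoining to an empty row $i$ means adding box $(i,i)$); (ii) if $x$ is weakly larger than all entries but adjoining fails, leave unchanged and stop; (iii) otherwise let $y$ be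 the smallest entry strictly larger than $x$ there; replace $y$ by $x$ if the result is increasing, otherwise change nothing; $y$ is output: if $x$ was inserted into a column or $y$ is on the main diagonal, $y$ goes into the next column to the right (all subsequent outputs go into successive columns), else into the next row below. $P(w)=(\cdots(\emptyset\leftarrow w_1)\cdots)\leftarrow w_n$. Weak $K$-Knuth equivalence $\hat\equiv$ is generated by ($\mathbf u,\mathbf v$ arbitrary words, $a<b<c$): $\mathbf u aa\mathbf v\hat\equiv\mathbf u a\mathbf v$; $\mathbf u aba\mathbf v\hat\equiv\mathbf u bab\mathbf v$; $\mathbf u bac\mathbf v\hat\equiv\mathbf u bca\mathbf v$; $\mathbf u acb\mathbf v\hat\equiv\mathbf u cab\mathbf v$; $ab\mathbf u\hat\equiv ba\mathbf u$. An increasing shifted tableau $T$ is a URT (unique rectification target) if $P(w)=T$ for every word $w\hat\equiv\mathfrak{row}(T)$. (URTs exist for every shifted shape.) *)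

theory Defs
  imports Main "HOL-Library.Multiset"
begin

text \<open>A strict partition is a strictly decreasing list of positive integers.
 Boxes are 0-indexed: row i, column j; the main diagonal is i = j.\<close>

definition strict_partition :: "nat list \<Rightarrow> bool" where
  "strict_partition lam \<longleftrightarrow> sorted_wrt (>) lam \<and> 0 \<notin> set lam"

definition shifted_shape :: "nat list \<Rightarrow> (nat \<times> nat) set" where
  "shifted_shape lam = {(i, j). i < length lam \<and> i \<le> j \<and> j < i + lam ! i}"

definition skew_shape :: "nat list \<Rightarrow> nat list \<Rightarrow> (nat \<times> nat) set" where
  "skew_shape nu lam = shifted_shape nu - shifted_shape lam"

text \<open>A letter (n, p) stands for n (if p = False) or n' (if p = True).
 The order 1' < 1 < 2' < 2 < ... is given by the key below.\<close>

type_synonym letter = "nat \<times> bool"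

definition lkey :: "letter \<Rightarrow> nat" where
  "lkey a = 2 * fst a - (if snd a then 1 else 0)"

definition wsvt :: "nat list \<Rightarrow> (nat \<times> nat \<Rightarrow> letter multiset) \<Rightarrow> bool" where
  "wsvt lam T \<longleftrightarrow>
     (\<forall>b. b \<notin> shifted_shape lam \<longrightarrow> T b = {#}) \<and>
     (\<forall>b \<in> shifted_shape lam. T b \<noteq> {#} \<and> (\<forall>a \<in># T b. 1 \<le> fst a)) \<and>
     (\<forall>i j. (i, j) \<in> shifted_shape lam \<and> (i, Suc j) \<in> shifted_shape lam \<longrightarrow>
        (\<forall>a \<in># T (i, j). \<forall>c \<in># T (i, Suc j). lkey a \<le> lkey c)) \<and>
     (\<forall>i j. (i, j) \<in> shifted_shape lam \<and> (Suc i, j) \<in> shifted_shape lam \<longrightarrow>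
        (\<forall>a \<in># T (i, j). \<forall>c \<in># T (Suc i, j). lkey a \<le> lkey c)) \<and>
     (\<forall>i. \<forall>a \<in># T (i, i). \<not> snd a) \<and>
     (\<forall>j n. card {i. (n, False) \<in># T (i, j)} \<le> 1) \<and>
     (\<forall>i n. card {j. (n, True) \<in># T (i, j)} \<le> 1)"

definition wt :: "nat list \<Rightarrow> (nat \<times> nat \<Rightarrow> letter multiset) \<Rightarrow> nat \<Rightarrow> nat" where
  "wt lam T i = (\<Sum>b\<in>shifted_shape lam. count (T b) (i, False) + count (T b) (i, True))"

text \<open>Coefficient of the monomial with exponent vector m in K_lambda.\<close>
definition Kcoeff :: "nat list \<Rightarrow> (nat \<Rightarrow> nat) \<Rightarrow> nat" where
  "Kcoeff lam m = card {T. wsvt lam T \<and> wt lam T = m}"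

definition Kprod_coeff :: "nat list \<Rightarrow> nat list \<Rightarrow> (nat \<Rightarrow> nat) \<Rightarrow> nat" where
  "Kprod_coeff lam mu m =
     (\<Sum>(m1, m2) \<in> {(m1, m2). \<forall>i. m1 i + m2 i = m i}. Kcoeff lam m1 * Kcoeff mu m2)"

definition mdeg :: "(nat \<Rightarrow> nat) \<Rightarrow> nat" where
  "mdeg m = (\<Sum>i\<in>{i. m i \<noteq> 0}. m i)"

type_synonym tab = "(nat \<times> nat) \<rightharpoonup> nat"

definition increasing :: "tab \<Rightarrow> bool" where
  "increasing R \<longleftrightarrow>
     (\<forall>a \<in> ran R. 0 < a) \<and>
     (\<forall>i j j' a b. R (i, j) = Some a \<and> R (i, j') = Some b \<and> j < j' \<longrightarrow> a < b) \<and>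
     (\<forall>i i' j a b. R (i, j) = Some a \<and> R (i', j) = Some b \<and> i < i' \<longrightarrow> a < b)"

definition inc_tab :: "tab \<Rightarrow> bool" where
  "inc_tab T \<longleftrightarrow> (\<exists>lam. strict_partition lam \<and> dom T = shifted_shape lam) \<and> increasing T"

definition row_word :: "tab \<Rightarrow> nat list" where
  "row_word R = concat (map (\<lambda>i. map (\<lambda>j. the (R (i, j)))
        (sorted_list_of_set {j. (i, j) \<in> dom R}))
      (rev (sorted_list_of_set (fst ` dom R))))"

definition rowE :: "tab \<Rightarrow> nat \<Rightarrow> nat set" where
  "rowE T i = {a. \<exists>j. T (i, j) = Some a}"
definition colE :: "tab \<Rightarrow> nat \<Rightarrow> nat set" where
  "colE T c = {a. \<exists>i. T (i, c) = Some a}"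
definition rowlen :: "tab \<Rightarrow> nat \<Rightarrow> nat" where
  "rowlen T i = card {j. (i, j) \<in> dom T}"
definition collen :: "tab \<Rightarrow> nat \<Rightarrow> nat" where
  "collen T c = card {i. (i, c) \<in> dom T}"

inductive hk_row :: "nat \<Rightarrow> nat \<Rightarrow> tab \<Rightarrow> tab \<Rightarrow> bool"
  and hk_col :: "nat \<Rightarrow> nat \<Rightarrow> tab \<Rightarrow> tab \<Rightarrow> bool" where
  row_add: "\<lbrakk>\<forall>a\<in>rowE T i. a \<le> x; inc_tab (T((i, i + rowlen T i) \<mapsto> x))\<rbrakk>
     \<Longrightarrow> hk_row i x T (T((i, i + rowlen T i) \<mapsto> x))"
| row_stop: "\<lbrakk>\<forall>a\<in>rowE T i. a \<le> x; \<not> inc_tab (T((i, i + rowlen T i) \<mapsto> x))\<rbrakk>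
     \<Longrightarrow> hk_row i x T T"
| row_bump_diag: "\<lbrakk>a \<in> rowE T i; x < a; y = Min {a \<in> rowE T i. x < a}; T (i, i) = Some y;
     T1 = (if inc_tab (T((i, i) \<mapsto> x)) then T((i, i) \<mapsto> x) else T);
     hk_col (Suc i) y T1 T'\<rbrakk> \<Longrightarrow> hk_row i x T T'"
| row_bump: "\<lbrakk>a \<in> rowE T i; x < a; y = Min {a \<in> rowE T i. x < a}; T (i, j) = Some y; j \<noteq> i;
     T1 = (if inc_tab (T((i, j) \<mapsto> x)) then T((i, j) \<mapsto> x) else T);
     hk_row (Suc i) y T1 T'\<rbrakk> \<Longrightarrow> hk_row i x T T'"
| col_add: "\<lbrakk>\<forall>a\<in>colE T c. a \<le> x; inc_tab (T((collen T c, c) \<mapsto> x))\<rbrakk>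
     \<Longrightarrow> hk_col c x T (T((collen T c, c) \<mapsto> x))"
| col_stop: "\<lbrakk>\<forall>a\<in>colE T c. a \<le> x; \<not> inc_tab (T((collen T c, c) \<mapsto> x))\<rbrakk>
     \<Longrightarrow> hk_col c x T T"
| col_bump: "\<lbrakk>a \<in> colE T c; x < a; y = Min {a \<in> colE T c. x < a}; T (i, c) = Some y;
     T1 = (if inc_tab (T((i, c) \<mapsto> x)) then T((i, c) \<mapsto> x) else T);
     hk_col (Suc c) y T1 T'\<rbrakk> \<Longrightarrow> hk_col c x T T'"

inductive hk_P :: "nat list \<Rightarrow> tab \<Rightarrow> bool" where
  "hk_P [] Map.empty"
| "\<lbrakk>hk_P w T; hk_row 0 x T T'\<rbrakk> \<Longrightarrow> hk_P (w @ [x]) T'"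

definition P_ins :: "nat list \<Rightarrow> tab" where
  "P_ins w = (THE T. hk_P w T)"

inductive kstep :: "nat list \<Rightarrow> nat list \<Rightarrow> bool" where
  "kstep (u @ [a, a] @ v) (u @ [a] @ v)"
| "a < b \<Longrightarrow> kstep (u @ [a, b, a] @ v) (u @ [b, a, b] @ v)"
| "a < b \<Longrightarrow> b < c \<Longrightarrow> kstep (u @ [b, a, c] @ v) (u @ [b, c, a] @ v)"
| "a < b \<Longrightarrow> b < c \<Longrightarrow> kstep (u @ [a, c, b] @ v) (u @ [c, a, b] @ v)"
| "a < b \<Longrightarrow> kstep ([a, b] @ u) ([b, a] @ u)"

definition kequiv :: "nat list \<Rightarrow> nat list \<Rightarrow> bool" where
  "kequiv = (\<lambda>x y. kstep x y \<or> kstep y x)\<^sup>*\<^sup>*"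

definition URT :: "tab \<Rightarrow> bool" where
  "URT T \<longleftrightarrow> inc_tab T \<and> (\<forall>w. kequiv w (row_word T) \<longrightarrow> P_ins w = T)"

definition cnum :: "nat list \<Rightarrow> nat list \<Rightarrow> tab \<Rightarrow> nat" where
  "cnum lam nu T = card {R. dom R = skew_shape nu lam \<and> increasing R \<and> P_ins (row_word R) = T}"

end

theory Submission
  imports Defs "HOL-Library.Extended_Nat" "HOL-Library.Product_Lexorder"
begin

text \<open>
  A shifted tableau is unfolded along the diagonal to a symmetric matrix with entries in
  \<open>\<nat> \<union> {\<infinity>}\<close>, where \<open>\<infinity>\<close> marks the boxes outside the shape. Row \<open>k\<close> of this matrix consists of
  column \<open>k\<close> of the tableau followed by the rest of its row \<open>k\<close>, so that shifted Hecke insertion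
  becomes a plain row insertion: the passage from rows to columns happens when the bumping position
  crosses the diagonal, and appending a box is bumping \<open>\<infinity>\<close>.

  An insertion is recorded by a corner of the symmetric shape (above the diagonal for an unprimed
  letter, below it for a primed one) together with the information whether this box is new. Every
  step can be undone, so \<open>(tableau, letter)\<close> and \<open>(tableau, record)\<close> determine each other, and
  \<open>x \<le> y\<close> holds for successively inserted letters iff the recorded corners move weakly to the right.
  Peeling off the last letter of a weak set-valued tableau gives the same recursion. Hence \<open>K\<^sub>\<nu>\<close> counts
  lexicographically sorted biwords whose letters insert to any fixed increasing tableau of shape \<open>\<nu>\<close>.

  For the product, choose an increasing tableau of shape \<open>\<lambda>\<close> with letters at most \<open>n\<close> and shift the
  letters of the second biword by \<open>n\<close>; merging the two biwords is bijective. Insertion commutes with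
  the restriction to letters at most \<open>n\<close>. As a word is weakly \<open>K\<close>-Knuth equivalent to the row word of
  its insertion tableau, and this relation is compatible with the restriction to letters above \<open>n\<close>,
  the URT property shows that the condition on the large letters depends on the insertion tableau only.
\<close>

subsection \<open>\<open>K\<close>-Knuth equivalence\<close>

text \<open>The recording half depends on shapes only: two tableaux of one shape have the same
  corners, so they admit the same sequences of records. This is why the tableau of shape \<lambda>
  may be chosen freely. The obstacle lies in the other half, at the single step where bumping
  crosses the diagonal. Row steps and column steps rewrite the reading word locally and respect
  K-Knuth equivalence in any context, but at the diagonal the letter has to be read in a different
  place. This needs the exchange of two letters, which is available only at the front of the whole
  word. What stands in the way is the reading word of a full staircase, so the task becomes to
  commute a shifted tableau with a staircase of smaller letters. Hence two relations are used:
  \<open>\<simeq>\<close> without the exchange, a two-sided congruence, and \<open>kequiv\<close>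
  with it, compatible with appending on the right. Only one direction is shown for insertion, that a
  word is equivalent to the row word of its tableau. The converse, that equivalent words insert
  equally, is supplied by the URT hypothesis for the one tableau where it is needed.\<close>

inductive kknuth :: "nat list \<Rightarrow> nat list \<Rightarrow> bool" (infix "\<simeq>" 50) where
  kk_idem: "[a, a] \<simeq> [a]"
| kk_braid: "a < b \<Longrightarrow> [a, b, a] \<simeq> [b, a, b]"
| kk_bac: "a < b \<Longrightarrow> b < c \<Longrightarrow> [b, a, c] \<simeq> [b, c, a]"
| kk_acb: "a < b \<Longrightarrow> b < c \<Longrightarrow> [a, c, b] \<simeq> [c, a, b]"
| kk_refl [simp, intro]: "u \<simeq> u"
| kk_sym: "u \<simeq> v \<Longrightarrow> v \<simeq> u"
| kk_trans [trans]: "u \<simeq> v \<Longrightarrow> v \<simeq> w \<Longrightarrow> u \<simeq> w"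
| kk_ctx: "u \<simeq> v \<Longrightarrow> p @ u @ s \<simeq> p @ v @ s"

lemma kk_append_left: "u \<simeq> v \<Longrightarrow> p @ u \<simeq> p @ v"
  using kk_ctx[of u v p "[]"] by simp

lemma kk_append_right: "u \<simeq> v \<Longrightarrow> u @ s \<simeq> v @ s"
  using kk_ctx[of u v "[]" s] by simp

lemma kk_Cons: "u \<simeq> v \<Longrightarrow> a # u \<simeq> a # v"
  using kk_append_left[of u v "[a]"] by simp

text \<open>Reversal exchanges \<open>kk_bac\<close> and \<open>kk_acb\<close> and respects the
  other rules. It turns statements about rows into statements about columns read upwards.\<close>

lemma kk_rev: "u \<simeq> v \<Longrightarrow> rev u \<simeq> rev v"
proof (induction rule: kknuth.induct)
  case (kk_ctx u v p s)
  then show ?case using kknuth.kk_ctx[of "rev u" "rev v" "rev s" "rev p"] by simp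
qed (auto intro: kknuth.intros)

section \<open>The weak relation, with its exchange at the front of a word\<close>

abbreviation sym_kstep :: "nat list \<Rightarrow> nat list \<Rightarrow> bool" where
  "sym_kstep \<equiv> (\<lambda>x y. kstep x y \<or> kstep y x)"

lemma kequiv_refl [simp, intro]: "kequiv u u"
  by (simp add: kequiv_def)

lemma kequiv_trans [trans]: "kequiv u v \<Longrightarrow> kequiv v w \<Longrightarrow> kequiv u w"
  by (simp add: kequiv_def)

lemma kequiv_sym: "kequiv u v \<Longrightarrow> kequiv v u"
proof -
  have "symp sym_kstep" by (auto simp: symp_def)
  then show "kequiv u v \<Longrightarrow> kequiv v u"
    unfolding kequiv_def by (meson symp_rtranclp sympE)
qed

lemma kstep_kequiv: "kstep u v \<Longrightarrow> kequiv u v"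
  by (auto simp: kequiv_def)

lemma kstep_append: "kstep u v \<Longrightarrow> kstep (u @ w) (v @ w)"
proof (induction rule: kstep.induct)
  case (1 u a v) then show ?case using kstep.intros(1)[of u a "v @ w"] by simp
next
  case (2 a b u v) then show ?case using kstep.intros(2)[of a b u "v @ w"] by simp
next
  case (3 a b c u v) then show ?case using kstep.intros(3)[of a b c u "v @ w"] by simp
next
  case (4 a b c u v) then show ?case using kstep.intros(4)[of a b c u "v @ w"] by simp
next
  case (5 a b u) then show ?case using kstep.intros(5)[of a b "u @ w"] by simp
qed

lemma kequiv_append_right: "kequiv u v \<Longrightarrow> kequiv (u @ w) (v @ w)"
  unfolding kequiv_def
proof (induction rule: rtranclp_induct)
  case (step y z)
  then have "sym_kstep (y @ w) (z @ w)" by (auto intro: kstep_append)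
  with step.IH show ?case by (rule rtranclp.rtrancl_into_rtrancl)
qed simp

lemma kequiv_swap: "a \<noteq> b \<Longrightarrow> kequiv (a # b # u) (b # a # u)"
  using kstep.intros(5)[of a b u] kstep.intros(5)[of b a u]
  by (cases "a < b") (auto intro: kstep_kequiv kequiv_sym)

lemma kk_kequiv_ctx: "u \<simeq> v \<Longrightarrow> kequiv (p @ u @ s) (p @ v @ s)"
proof (induction arbitrary: p s rule: kknuth.induct)
  case (kk_idem a) show ?case by (intro kstep_kequiv kstep.intros)
next
  case (kk_braid a b) then show ?case by (intro kstep_kequiv kstep.intros)
next
  case (kk_bac a b c) then show ?case by (intro kstep_kequiv kstep.intros)
next
  case (kk_acb a b c) then show ?case by (intro kstep_kequiv kstep.intros)
next
  case (kk_refl u) show ?case by simp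
next
  case (kk_sym u v) then show ?case by (blast intro: kequiv_sym)
next
  case (kk_trans u v w) then show ?case by (blast intro: kequiv_trans)
next
  case (kk_ctx u v p' s')
  then show ?case using kk_ctx.IH[of "p @ p'" "s' @ s"] by simp
qed

lemma kk_kequiv: "u \<simeq> v \<Longrightarrow> kequiv u v"
  using kk_kequiv_ctx[of u v "[]" "[]"] by simp

lemma kequiv_kk_trans [trans]: "kequiv u v \<Longrightarrow> v \<simeq> w \<Longrightarrow> kequiv u w"
  and kk_kequiv_trans [trans]: "u \<simeq> v \<Longrightarrow> kequiv v w \<Longrightarrow> kequiv u w"
  using kk_kequiv kequiv_trans by blast+

section \<open>Row insertion as rewriting of words\<close>

text \<open>A letter \<open>d\<close> below \<open>s\<close> moves left past each \<open>t\<close>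
  of \<open>ss\<close> by \<open>kk_bac\<close>, with the letter in front of \<open>t\<close> as
  middle witness. Once it stands behind \<open>s\<close>, it is below all of \<open>ss\<close> and
  takes over the role of \<open>s\<close> for the rest of \<open>ds\<close>.\<close>

lemma kk_decr_past_incr:
  assumes "sorted_wrt (<) (s # ss)" "sorted_wrt (>) (s # ds)"
  shows "s # ss @ ds \<simeq> s # ds @ ss"
  using assms
proof (induction ds arbitrary: s)
  case (Cons d ds)
  have one: "s # ss @ [d] \<simeq> s # d # ss"
    if "sorted_wrt (<) (s # ss)" "d < s" for s ss
    using that
  proof (induction ss arbitrary: s)
    case (Cons t ss)
    have "t # ss @ [d] \<simeq> t # d # ss" using Cons.prems by (intro Cons.IH) auto
    from kk_Cons[OF this, of s] have "s # t # ss @ [d] \<simeq> s # t # d # ss" .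
    also have "\<dots> \<simeq> s # d # t # ss"
      using kk_append_right[OF kk_sym[OF kk_bac[of d s t]], of ss] Cons.prems by simp
    finally show ?case by simp
  qed simp
  have "s # ss @ d # ds \<simeq> s # d # ss @ ds"
    using kk_append_right[OF one[of s ss], of ds] Cons.prems by simp
  also have "\<dots> \<simeq> s # d # ds @ ss"
    using Cons.prems by (intro kk_Cons Cons.IH) auto
  finally show ?case by simp
qed simp

text \<open>Here the witness stands on the right: \<open>kk_acb\<close> carries \<open>y\<close>
  over the last letter \<open>g\<close> of \<open>gs\<close> because \<open>g < x < y\<close>, and
  then \<open>g\<close> is the witness for the shorter word.\<close>

lemma kk_large_left:
  assumes "sorted_wrt (<) (gs @ [x])" "x < y"
  shows "gs @ [y, x] \<simeq> y # gs @ [x]"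
  using assms
proof (induction gs arbitrary: x rule: rev_induct)
  case (snoc g gs)
  have "(gs @ [g]) @ [y, x] = gs @ [g, y, x]" by simp
  also have "\<dots> \<simeq> gs @ [y, g, x]"
    using snoc.prems by (intro kk_append_left kk_acb) (auto simp: sorted_wrt_append)
  also have "\<dots> = (gs @ [y, g]) @ [x]" by simp
  also have "\<dots> \<simeq> (y # gs @ [g]) @ [x]"
    using snoc.prems by (intro kk_append_right snoc.IH) (auto simp: sorted_wrt_append)
  finally show ?case by simp
qed simp

text \<open>A bump with replacement. The letter \<open>y\<close> leaves at the front because the
  next lower row is read immediately before this one.\<close>

lemma kk_row_replace:
  assumes "sorted_wrt (<) (gs @ x # ds)" "sorted_wrt (<) (gs @ y # ds)" "x < y"
  shows "gs @ y # ds @ [x] \<simeq> y # gs @ x # ds"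
proof -
  have "gs @ y # ds @ [x] \<simeq> gs @ y # x # ds"
    using kk_append_left[OF kk_decr_past_incr[of y ds "[x]"], of gs] assms
    by (auto simp: sorted_wrt_append)
  also have "\<dots> \<simeq> y # gs @ x # ds"
    using kk_append_right[OF kk_large_left[of gs x y], of ds] assms
    by (auto simp: sorted_wrt_append)
  finally show ?thesis .
qed

text \<open>A bump without replacement, caused by an equal left neighbour: the braid rule turns
  \<open>x y x\<close> into \<open>y x y\<close>, so the row survives and a copy of \<open>y\<close>
  is free to leave.\<close>

lemma kk_row_keep:
  assumes "sorted_wrt (<) (gs @ x # y # ds)"
  shows "gs @ x # y # ds @ [x] \<simeq> y # gs @ x # y # ds"
proof -
  have "gs @ x # y # ds @ [x] \<simeq> gs @ x # y # x # ds"
    using kk_append_left[OF kk_decr_past_incr[of y ds "[x]"], of "gs @ [x]"] assms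
    by (auto simp: sorted_wrt_append)
  also have "\<dots> \<simeq> gs @ y # x # y # ds"
    using kk_ctx[OF kk_braid[of x y], of gs ds] assms by (auto simp: sorted_wrt_append)
  also have "\<dots> \<simeq> y # gs @ x # y # ds"
    using kk_append_right[OF kk_large_left[of gs x y], of "y # ds"] assms
    by (auto simp: sorted_wrt_append)
  finally show ?thesis .
qed

text \<open>The additional \<open>q\<close> comes from doubling \<open>y\<close>: one copy stays in
  the row, and the other is carried out in front of it, which by \<open>kk_row_keep\<close> amounts
  to having inserted \<open>q\<close>.\<close>

lemma kk_absorb_left:
  assumes "sorted_wrt (<) (q # y # ds)" "q < z" "z < y"
  shows "q # y # ds @ [z] \<simeq> q # y # ds @ [q, z]"
proof -
  have pass: "y # ds @ [z] \<simeq> y # z # ds"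
    using kk_decr_past_incr[of y ds "[z]"] assms by simp
  have "q # y # ds @ [z] \<simeq> q # y # z # ds" using kk_Cons[OF pass] by simp
  also have "\<dots> \<simeq> y # q # z # ds"
    using kk_append_right[OF kk_acb[of q z y], of ds] assms by simp
  also have "\<dots> \<simeq> y # y # q # z # ds"
    using kk_append_right[OF kk_sym[OF kk_idem[of y]], of "q # z # ds"] by simp
  also have "\<dots> \<simeq> y # q # y # z # ds"
    using kk_Cons[OF kk_append_right[OF kk_sym[OF kk_acb[of q z y]], of ds]] assms by simp
  also have "\<dots> \<simeq> y # q # y # ds @ [z]"
    by (intro kk_Cons kk_sym[OF pass])
  also have "\<dots> \<simeq> q # y # ds @ [q, z]"
    using kk_append_right[OF kk_sym[OF kk_row_keep[of "[]" q y ds]], of "[z]"] assms by simp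
  finally show ?thesis .
qed

text \<open>Read backwards, \<open>kk_row_keep\<close> turns the \<open>z\<close> in front of the
  row into a second \<open>p\<close> behind the other \<open>z\<close>. As \<open>q\<close> lies
  between \<open>p\<close> and \<open>z\<close>, it lets the two copies of \<open>p\<close> come
  together and merge.\<close>

lemma kk_exchange_above:
  assumes "sorted_wrt (<) (al @ p # z # be)" "p < q" "q < z"
  shows "q # z # al @ p # z # be \<simeq> q # al @ p # z # be"
proof -
  have qp: "q # al @ [p] \<simeq> al @ [q, p]"
    using kk_sym[OF kk_large_left[of al p q]] assms by (auto simp: sorted_wrt_append)
  have qpz: "[q, p, z] \<simeq> [q, z, p]" using kk_bac[of p q z] assms by simp
  have "q # z # al @ p # z # be \<simeq> q # al @ p # z # p # be"
    using kk_Cons[OF kk_append_right[OF kk_sym[OF kk_row_keep[of al p z "[]"]], of be], of q] assms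
    by (auto simp: sorted_wrt_append)
  also have "\<dots> \<simeq> al @ q # p # z # p # be"
    using kk_append_right[OF qp, of "z # p # be"] by simp
  also have "\<dots> \<simeq> al @ q # z # p # p # be"
    using kk_ctx[OF qpz, of al "p # be"] by simp
  also have "\<dots> \<simeq> al @ q # z # p # be"
    using kk_ctx[OF kk_idem[of p], of "al @ [q, z]" be] by simp
  also have "\<dots> \<simeq> al @ q # p # z # be"
    using kk_ctx[OF kk_sym[OF qpz], of al be] by simp
  also have "\<dots> \<simeq> q # al @ p # z # be"
    using kk_append_right[OF kk_sym[OF qp], of "z # be"] by simp
  finally show ?thesis .
qed

text \<open>Here \<open>z\<close> cannot replace \<open>y\<close> because \<open>z\<close> also stands above \<open>y\<close>. The key is that inserting the left
  neighbour \<open>q\<close> instead of \<open>z\<close> yields an equivalent word.\<close>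

lemma kk_two_rows_keep:
  assumes "sorted_wrt (<) (gs @ q # y # ds)" "sorted_wrt (<) (al @ p # z # be)"
    "p < q" "q < z" "z < y"
  shows "gs @ q # y # ds @ z # al @ p # z # be \<simeq> y # gs @ q # y # ds @ al @ p # z # be"
proof -
  have "gs @ q # y # ds @ z # al @ p # z # be \<simeq> gs @ q # y # ds @ q # z # al @ p # z # be"
    using kk_ctx[OF kk_absorb_left[of q y ds z], of gs "al @ p # z # be"] assms
    by (auto simp: sorted_wrt_append)
  also have "\<dots> \<simeq> gs @ q # y # ds @ q # al @ p # z # be"
    using kk_append_left[OF kk_exchange_above[of al p z be q], of "gs @ q # y # ds"] assms
    by simp
  also have "\<dots> \<simeq> y # gs @ q # y # ds @ al @ p # z # be"
    using kk_append_right[OF kk_row_keep[of gs q y ds], of "al @ p # z # be"] assms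
    by simp
  finally show ?thesis .
qed

text \<open>One exchange at the front suffices: as soon as \<open>s\<close> stands behind the
  smaller letter \<open>d\<close>, that letter is the witness for all further moves.\<close>

lemma kequiv_decr_front:
  assumes "sorted_wrt (>) (s # ds)"
  shows "kequiv (s # ds @ u) (ds @ s # u)"
proof (cases ds)
  case (Cons d es)
  have "s # ds @ u = s # d # es @ u" using Cons by simp
  also have "kequiv (s # d # es @ u) (d # s # es @ u)"
    using assms Cons by (intro kequiv_swap) auto
  also have "d # s # es @ u \<simeq> d # es @ s # u"
    using kk_append_right[OF kk_decr_past_incr[of d "[s]" es], of u] assms Cons by auto
  finally show ?thesis using Cons by simp
qed simp

subsection \<open>Row insertion into symmetric matrices\<close>

declare not_infinity_eq [iff del]

type_synonym mat = "nat \<Rightarrow> nat \<Rightarrow> enat"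

text \<open>Demanding strict increase only towards finite entries makes the finite region an order
  ideal: an infinite entry forces \<infinity> to its right and, by symmetry, below it.\<close>

definition sym_incr :: "mat \<Rightarrow> bool" where
  "sym_incr D \<longleftrightarrow> (\<forall>i j. D i j = D j i) \<and>
     (\<forall>i j. D i (Suc j) \<noteq> \<infinity> \<longrightarrow> D i j < D i (Suc j)) \<and>
     (\<forall>i j. 0 < D i j) \<and> (\<exists>B. \<forall>i j. B \<le> j \<longrightarrow> D i j = \<infinity>)"

definition upd :: "mat \<Rightarrow> nat \<Rightarrow> nat \<Rightarrow> enat \<Rightarrow> mat" where
  "upd D k j x = (\<lambda>r c. if r = k \<and> c = j \<or> r = j \<and> c = k then x else D r c)"

definition pos :: "mat \<Rightarrow> nat \<Rightarrow> enat \<Rightarrow> nat" where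
  "pos D k x = (LEAST j. x < D k j)"

text \<open>Only the left and the upper neighbour are compared. At a bumping position the other two
  are safe, since they dominate an entry exceeding \<open>x\<close>.\<close>

definition fits :: "mat \<Rightarrow> nat \<Rightarrow> nat \<Rightarrow> enat \<Rightarrow> bool" where
  "fits D k j x \<longleftrightarrow> (\<forall>j'. j = Suc j' \<longrightarrow> D k j' < x) \<and> (\<forall>k'. k = Suc k' \<longrightarrow> D k' j < x)"

definition bump_mat :: "mat \<Rightarrow> nat \<Rightarrow> enat \<Rightarrow> mat" where
  "bump_mat D k x = (if fits D k (pos D k x) x then upd D k (pos D k x) x else D)"

definition out :: "mat \<Rightarrow> nat \<Rightarrow> enat \<Rightarrow> enat" where
  "out D k x = D k (pos D k x)"

lemma enat_less_fin: "(a :: enat) < b \<Longrightarrow> a \<noteq> \<infinity>"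
  by (cases a) auto

lemma enat_le_fin: "(a :: enat) \<le> b \<Longrightarrow> b \<noteq> \<infinity> \<Longrightarrow> a \<noteq> \<infinity>"
  by (cases a) auto

lemma sm_sym: "sym_incr D \<Longrightarrow> D i j = D j i"
  unfolding sym_incr_def by blast

lemma sm_Suc: "sym_incr D \<Longrightarrow> D i (Suc j) \<noteq> \<infinity> \<Longrightarrow> D i j < D i (Suc j)"
  unfolding sym_incr_def by blast

lemma sm_pos: "sym_incr D \<Longrightarrow> 0 < D i j"
  unfolding sym_incr_def by blast

lemma sm_le:
  assumes "sym_incr D" "j \<le> j'"
  shows "D i j \<le> D i j'"
  using assms(2)
proof (induction rule: dec_induct)
  case (step n)
  have "D i n \<le> D i (Suc n)"
    using sm_Suc[OF assms(1), of i n] by (cases "D i (Suc n) = \<infinity>") auto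
  with step.IH show ?case by simp
qed simp

lemma sm_less:
  assumes "sym_incr D" "j < j'" "D i j \<noteq> \<infinity>"
  shows "D i j < D i j'"
proof -
  have "D i j < D i (Suc j)"
    using sm_Suc[OF assms(1), of i j] assms(3) by (cases "D i (Suc j) = \<infinity>") auto
  also have "\<dots> \<le> D i j'" using assms by (intro sm_le) auto
  finally show ?thesis .
qed

lemma sm_le': "sym_incr D \<Longrightarrow> i \<le> i' \<Longrightarrow> D i j \<le> D i' j"
  using sm_le[of D i i' j] sm_sym[of D] by metis

lemma sm_less': "sym_incr D \<Longrightarrow> i < i' \<Longrightarrow> D i j \<noteq> \<infinity> \<Longrightarrow> D i j < D i' j"
  using sm_less[of D i i' j] sm_sym[of D] by metis

lemma sm_inf: "sym_incr D \<Longrightarrow> D i j = \<infinity> \<Longrightarrow> i \<le> i' \<Longrightarrow> j \<le> j' \<Longrightarrow> D i' j' = \<infinity>"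
  using sm_le[of D j j' i] sm_le'[of D i i' j'] by simp

lemma sm_bound: "sym_incr D \<Longrightarrow> \<exists>B. \<forall>i j. B \<le> i \<or> B \<le> j \<longrightarrow> D i j = \<infinity>"
  unfolding sym_incr_def by metis

lemma sm_less_iff: "sym_incr D \<Longrightarrow> D i j \<noteq> \<infinity> \<Longrightarrow> D i j < D i j' \<longleftrightarrow> j < j'"
  using sm_less[of D j j' i] sm_le[of D j' j i] by (meson not_less)

lemma pos_gt:
  assumes "sym_incr D" "x \<noteq> \<infinity>"
  shows "x < D k (pos D k x)"
proof -
  obtain B where "D k B = \<infinity>" using sm_bound[OF assms(1)] by blast
  then have "x < D k B" using assms(2) by simp
  then show ?thesis unfolding pos_def by (rule LeastI)
qed

lemma pos_le: "x < D k j \<Longrightarrow> pos D k x \<le> j"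
  unfolding pos_def by (rule Least_le)

lemma before_pos: "j < pos D k x \<Longrightarrow> D k j \<le> x"
  using pos_le[of x D k j] by (meson not_le)

lemma pos_eqI:
  assumes "sym_incr D" "x < D k j" "\<And>j'. j = Suc j' \<Longrightarrow> D k j' \<le> x"
  shows "pos D k x = j"
  unfolding pos_def
proof (rule Least_equality)
  fix i assume "x < D k i"
  show "j \<le> i"
  proof (rule ccontr)
    assume "\<not> j \<le> i"
    then obtain j' where "j = Suc j'" "i \<le> j'" by (cases j) auto
    then have "D k i \<le> x" using assms(3) sm_le[OF assms(1), of i j' k] by force
    then show False using \<open>x < D k i\<close> by simp
  qed
qed (use assms in auto)

lemma out_gt: "sym_incr D \<Longrightarrow> x \<noteq> \<infinity> \<Longrightarrow> x < out D k x"
  unfolding out_def by (rule pos_gt)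

lemma out_le: "sym_incr D \<Longrightarrow> x < D k j \<Longrightarrow> out D k x \<le> D k j"
  unfolding out_def by (intro sm_le pos_le)

lemma sm_upd:
  assumes D: "sym_incr D" and y: "0 < y"
    and l: "\<And>j'. j = Suc j' \<Longrightarrow> D k j' < y" and a: "\<And>k'. k = Suc k' \<Longrightarrow> D k' j < y"
    and r: "D k (Suc j) \<noteq> \<infinity> \<Longrightarrow> y < D k (Suc j)"
    and b: "D (Suc k) j \<noteq> \<infinity> \<Longrightarrow> y < D (Suc k) j"
  shows "sym_incr (upd D k j y)"
proof -
  obtain B where B: "\<And>i j. B \<le> j \<Longrightarrow> D i j = \<infinity>" using D unfolding sym_incr_def by blast
  have "upd D k j y i i' = upd D k j y i' i" for i i'
    using sm_sym[OF D, of i i'] by (auto simp: upd_def)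
  moreover have "upd D k j y i c < upd D k j y i (Suc c)"
    if "upd D k j y i (Suc c) \<noteq> \<infinity>" for i c
  proof -
    consider "i = k" "Suc c = j" | "i = j" "Suc c = k" | "i = k" "c = j" | "i = j" "c = k"
      | "\<not> (i = k \<and> Suc c = j)" "\<not> (i = j \<and> Suc c = k)" "\<not> (i = k \<and> c = j)" "\<not> (i = j \<and> c = k)"
      by blast
    then show ?thesis
    proof cases
      case 1 then show ?thesis using l[of c] by (auto simp: upd_def)
    next
      case 2 then show ?thesis using a[of c] sm_sym[OF D, of c j] by (auto simp: upd_def)
    next
      case 3 then show ?thesis using r that by (auto simp: upd_def split: if_splits)
    next
      case 4 then show ?thesis using b that sm_sym[OF D, of j "Suc k"]
        by (auto simp: upd_def split: if_splits)
    next
      case 5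
      then have "upd D k j y i c = D i c" "upd D k j y i (Suc c) = D i (Suc c)"
        by (auto simp: upd_def)
      then show ?thesis using that sm_Suc[OF D, of i c] by simp
    qed
  qed
  moreover have "0 < upd D k j y i c" for i c
    using y sm_pos[OF D, of i c] by (simp add: upd_def)
  moreover have "\<forall>i c. max B (Suc (max k j)) \<le> c \<longrightarrow> upd D k j y i c = \<infinity>"
    using B by (auto simp: upd_def)
  ultimately show ?thesis unfolding sym_incr_def by blast
qed

lemma upd_upd [simp]: "upd (upd D k j y) k j x = upd D k j x"
  by (auto simp: upd_def fun_eq_iff)

lemma upd_same: "sym_incr D \<Longrightarrow> upd D k j (D k j) = D"
  using sm_sym[of D k j] by (auto simp: upd_def fun_eq_iff)

lemma upd_at [simp]: "upd D k j y k j = y" "upd D k j y j k = y"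
  by (auto simp: upd_def)

lemma upd_right [simp]: "upd D k j y k (Suc j) = D k (Suc j)"
  unfolding upd_def by (rule if_not_P) arith

lemma upd_below [simp]: "upd D k j y (Suc k) j = D (Suc k) j"
  unfolding upd_def by (rule if_not_P) arith

lemma upd_left [simp]: "upd D k (Suc j) y k j = D k j"
  unfolding upd_def by (rule if_not_P) arith

lemma upd_above [simp]: "upd D (Suc k) j y k j = D k j"
  unfolding upd_def by (rule if_not_P) arith

section \<open>One bumping step and its inverse\<close>

text \<open>The letter \<open>x\<close> may have been bumped from position \<open>j\<close> of row \<open>k\<close>. The last conjunct reflects that a
  replacement in column \<open>0\<close> never fails.\<close>

definition vpos :: "mat \<Rightarrow> nat \<Rightarrow> enat \<Rightarrow> nat \<Rightarrow> bool" where
  "vpos D k x j \<longleftrightarrow> D k j \<le> x \<and> x < D k (Suc j) \<and> x < D (Suc k) j \<and> (j = 0 \<longrightarrow> D k 0 < x)"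

text \<open>These are exactly the states met on arrival at row \<open>k\<close>: they persist along
  an insertion (\<open>run_valid\<close>), and each of them can be traced back to row 0
  (\<open>reach_ex\<close>).\<close>

definition valid :: "mat \<Rightarrow> nat \<Rightarrow> enat \<Rightarrow> bool" where
  "valid D k x \<longleftrightarrow> sym_incr D \<and> 0 < x \<and> x \<noteq> \<infinity> \<and> (\<forall>k'. k = Suc k' \<longrightarrow> (\<exists>j. vpos D k' x j))"

lemma validD: "valid D k x \<Longrightarrow> sym_incr D" "valid D k x \<Longrightarrow> 0 < x" "valid D k x \<Longrightarrow> x \<noteq> \<infinity>"
  by (auto simp: valid_def)

lemma vpos_unique:
  assumes "sym_incr D" "vpos D k x j" "vpos D k x j'"
  shows "j = j'"
proof -
  have "\<not> j < j'" if "vpos D k x j" "vpos D k x j'" for j j'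
  proof
    assume "j < j'"
    then have "D k (Suc j) \<le> D k j'" using assms(1) by (intro sm_le) auto
    then show False using that by (auto simp: vpos_def)
  qed
  from this[OF assms(2,3)] this[OF assms(3,2)] show ?thesis by simp
qed

lemma vpos_pos_le: "vpos D k x j \<Longrightarrow> pos D (Suc k) x \<le> j"
  unfolding vpos_def by (intro pos_le) simp

lemma valid_above_le:
  assumes "valid D (Suc k) x"
  shows "D k (pos D (Suc k) x) \<le> x"
proof -
  obtain j where j: "vpos D k x j" using assms by (auto simp: valid_def)
  have "D k (pos D (Suc k) x) \<le> D k j"
    using vpos_pos_le[OF j] validD(1)[OF assms] by (intro sm_le)
  with j show ?thesis by (auto simp: vpos_def)
qed

lemma valid_fits_0:
  assumes "valid D k x" "pos D k x = 0"
  shows "fits D k 0 x"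
proof (cases k)
  case (Suc k')
  then obtain j where j: "vpos D k' x j" using assms(1) by (auto simp: valid_def)
  have "D k' 0 < x"
  proof (cases j)
    case (Suc i)
    have "D k' j \<noteq> \<infinity>" using j validD(3)[OF assms(1)] enat_le_fin unfolding vpos_def by blast
    then have "D k' 0 \<noteq> \<infinity>" using sm_inf[OF validD(1)[OF assms(1)], of k' 0 k' j] by auto
    then have "D k' 0 < D k' j" using Suc by (intro sm_less validD(1)[OF assms(1)]) auto
    then show ?thesis using j by (auto simp: vpos_def)
  qed (use j in \<open>auto simp: vpos_def\<close>)
  then show ?thesis using Suc by (auto simp: fits_def)
qed (simp add: fits_def)

text \<open>Both neighbours are weakly below \<open>x\<close>, the left one by the choice of
  \<open>pos\<close> and the upper one by \<open>valid_above_le\<close>. A failed replacement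
  therefore means equality with one of them.\<close>

lemma not_fits_cases:
  assumes "valid D k x" "\<not> fits D k (pos D k x) x"
  obtains j where "pos D k x = Suc j" "D k j = x"
    | j k' where "pos D k x = Suc j" "k = Suc k'" "D k' (Suc j) = x" "D k j \<le> x"
proof -
  have "pos D k x \<noteq> 0" using valid_fits_0[OF assms(1)] assms(2) by metis
  then obtain j where j: "pos D k x = Suc j" by (cases "pos D k x") auto
  have p: "D k j \<le> x" using before_pos[of j D k x] j by simp
  show thesis
  proof (cases "D k j = x")
    case False
    then obtain k' where k: "k = Suc k'" "\<not> D k' (Suc j) < x"
      using assms(2) p j by (auto simp: fits_def)
    then have "D k' (Suc j) = x" using valid_above_le[of D k' x] assms(1) j by force
    then show thesis using that(2)[OF j k(1)] p by blast
  qed (use that j in blast)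
qed

lemma sm_stepm:
  assumes "valid D k x"
  shows "sym_incr (bump_mat D k x)"
proof -
  note D = validD[OF assms]
  let ?j = "pos D k x"
  have gt: "x < D k ?j" using pos_gt D by blast
  have "x < D k (Suc ?j)" "x < D (Suc k) ?j"
    using gt sm_le[OF D(1), of ?j "Suc ?j" k] sm_le'[OF D(1), of k "Suc k" ?j] by auto
  then have "sym_incr (upd D k ?j x)" if "fits D k ?j x"
    using that D by (intro sm_upd) (auto simp: fits_def)
  then show ?thesis using D(1) by (simp add: bump_mat_def)
qed

lemma stepm_row_le:
  assumes "valid D k x"
  shows "bump_mat D k x r c \<le> D r c"
  using pos_gt[OF validD(1)[OF assms] validD(3)[OF assms], of k] sm_sym[OF validD(1)[OF assms], of k "pos D k x"]
  by (auto simp: bump_mat_def upd_def)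

lemma stepm_at_le:
  assumes "valid D k x"
  shows "bump_mat D k x k (pos D k x) \<le> out D k x"
  unfolding out_def by (rule stepm_row_le[OF assms])

lemma valid_step:
  assumes "valid D k x" "out D k x \<noteq> \<infinity>"
  shows "vpos (bump_mat D k x) k (out D k x) (pos D k x)"
    and "valid (bump_mat D k x) (Suc k) (out D k x)"
proof -
  note D = validD[OF assms(1)]
  let ?j = "pos D k x" and ?E = "bump_mat D k x" and ?y = "out D k x"
  have r: "?E k (Suc ?j) = D k (Suc ?j)" "?E (Suc k) ?j = D (Suc k) ?j"
    by (auto simp: bump_mat_def)
  have "?y < D k (Suc ?j)" "?y < D (Suc k) ?j"
    using sm_less[OF D(1), of ?j "Suc ?j" k] sm_less'[OF D(1), of k "Suc k" ?j] assms(2)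
    by (auto simp: out_def)
  moreover have "?E k 0 < ?y" if "?j = 0"
    using valid_fits_0[OF assms(1) that] that out_gt[OF D(1,3), of k] by (simp add: bump_mat_def)
  ultimately show v: "vpos ?E k ?y ?j"
    using stepm_at_le[OF assms(1)] r by (auto simp: vpos_def)
  have "0 < ?y" using out_gt[OF D(1,3), of k] D(2) by (meson order.strict_trans)
  then show "valid ?E (Suc k) ?y"
    using v sm_stepm[OF assms(1)] assms(2) by (auto simp: valid_def)
qed

text \<open>A practical criterion: one column in which row \<open>k\<close> exceeds \<open>x\<close>
  and the entry above does not is enough, because the last entry weakly below \<open>x\<close> in
  the row above then gives the position demanded by \<open>vpos\<close>.\<close>

lemma valid_SucI:
  assumes "sym_incr D" "0 < x" "x \<noteq> \<infinity>"
    and "\<And>k'. k = Suc k' \<Longrightarrow> D k' j \<le> x \<and> (j = 0 \<longrightarrow> D k' 0 < x)" "x < D k j"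
  shows "valid D k x"
proof -
  have "\<exists>j. vpos D k' x j" if k: "k = Suc k'" for k'
  proof -
    let ?i = "pos D k' x"
    have gt: "x < D k' ?i" by (rule pos_gt[OF assms(1,3)])
    have "j < ?i"
      using assms(4)[OF k] gt sm_le[OF assms(1), of ?i j k'] by (meson not_le order.strict_trans1 order.strict_iff_not)
    then obtain i where i: "?i = Suc i" "j \<le> i" by (cases ?i) auto
    have "D k' i \<le> x" using before_pos[of i D k' x] i by simp
    moreover have "x < D k i" using assms(5) sm_le[OF assms(1) i(2), of k] by simp
    moreover have "D k' 0 < x" if "i = 0" using assms(4)[OF k] i that by auto
    ultimately have "vpos D k' x i" using gt i k by (auto simp: vpos_def)
    then show ?thesis ..
  qed
  then show ?thesis using assms by (auto simp: valid_def)
qed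

text \<open>If the bumped letter was not replaced, the inserted letter equals its left or its upper neighbour, and
  it is at least as large as both.\<close>

lemma predecessor_unique_aux:
  assumes E: "sym_incr E" and v: "vpos E k y j" and y: "y \<noteq> \<infinity>"
    and D: "valid D k x" and s: "bump_mat D k x = E" "out D k x = y"
  shows "pos D k x = j"
    and "E k j < y \<Longrightarrow> D = upd E k j y \<and> x = E k j"
    and "E k j = y \<Longrightarrow> D = E \<and> j \<noteq> 0 \<and>
           x = (case k of 0 \<Rightarrow> E k (j - 1) | Suc k' \<Rightarrow> max (E k (j - 1)) (E k' j))"
proof -
  have "vpos E k y (pos D k x)" using valid_step(1)[OF D] s y by simp
  then show j: "pos D k x = j" using vpos_unique[OF E _ v] by blast
  have gt: "x < y" using out_gt[OF validD(1)[OF D] validD(3)[OF D], of k] s by simp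
  have Dy: "D k j = y" using s(2) j by (simp add: out_def)
  have rep: "E k j = x \<and> D = upd E k j y" if "fits D k j x"
  proof -
    have "E = upd D k j x" using s(1) that j by (simp add: bump_mat_def)
    then show ?thesis using upd_same[OF validD(1)[OF D], of k j] Dy by simp
  qed
  have keep: "E = D" if "\<not> fits D k j x"
    using s(1) that j by (simp add: bump_mat_def)
  show "D = upd E k j y \<and> x = E k j" if "E k j < y"
    using rep keep Dy that by auto
  show "D = E \<and> j \<noteq> 0 \<and> x = (case k of 0 \<Rightarrow> E k (j - 1) | Suc k' \<Rightarrow> max (E k (j - 1)) (E k' j))"
    if "E k j = y"
  proof -
    have nf: "\<not> fits D k j x" using rep gt that by auto
    have nf': "\<not> fits D k (pos D k x) x" using nf j by simp
    have a: "D k' j \<le> x" if "k = Suc k'" for k' using valid_above_le[of D k' x] D j that by simp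
    show ?thesis
      using D nf'
    proof (cases rule: not_fits_cases)
      case (1 i) then show ?thesis using keep[OF nf] j a by (auto split: nat.splits simp: max_def)
    next
      case (2 i k')
      then have "j = Suc i" using j by simp
      then show ?thesis using 2 keep[OF nf] by (auto simp: max_def)
    qed
  qed
qed

text \<open>Comparing the entry at \<open>j\<close> with \<open>y\<close> tells which kind of step
  to undo. If it is smaller, it is the inserted letter, and \<open>y\<close> is put back in its
  place. If it equals \<open>y\<close>, nothing was replaced; the inserted letter then equals one of
  the left and upper neighbours and is at least the other, so it is their maximum.\<close>

lemma predecessor_ex:
  assumes E: "sym_incr E" and v: "vpos E k y j" and y: "y \<noteq> \<infinity>"
  shows "\<exists>D x. valid D k x \<and> bump_mat D k x = E \<and> out D k x = y"
proof (cases "E k j < y")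
  case True
  let ?D = "upd E k j y" and ?x = "E k j"
  have fin: "?x \<noteq> \<infinity>" by (rule enat_less_fin[OF True])
  have l: "E k j' < ?x" if "j = Suc j'" for j' using sm_Suc[OF E, of k j'] that fin by auto
  have a: "E k' j < ?x" if "k = Suc k'" for k'
    using sm_less'[OF E, of k' k j] that fin sm_inf[OF E, of k' j k j] by auto
  have smD: "sym_incr ?D"
    using True l a v sm_pos[OF E] by (intro sm_upd[OF E]) (auto simp: vpos_def intro: order.strict_trans)
  have "fits ?D k j ?x" using l a by (auto simp: fits_def)
  moreover have "valid ?D k ?x"
    using smD sm_pos[OF E] fin True a by (intro valid_SucI[where j = j]) (auto intro: less_imp_le)
  moreover have "pos ?D k ?x = j"
    using smD True l by (intro pos_eqI) (auto intro: less_imp_le)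
  ultimately show ?thesis
    using upd_same[OF E, of k j] by (intro exI[of _ ?D] exI[of _ ?x]) (auto simp: bump_mat_def out_def)
next
  case False
  then have yE: "E k j = y" using v by (auto simp: vpos_def)
  \<comment> \<open>In column 0 the last clause of \<open>vpos\<close> excludes equality.\<close>
  then obtain i where j: "j = Suc i" using v by (cases j) (auto simp: vpos_def)
  define x where "x = (case k of 0 \<Rightarrow> E k i | Suc k' \<Rightarrow> max (E k i) (E k' j))"
  have l: "E k i < y" using sm_Suc[OF E, of k i] j yE y by auto
  have a: "E k' j < y" if "k = Suc k'" for k'
  proof -
    have "E k' j \<noteq> \<infinity>" using sm_inf[OF E, of k' j k j] that y yE by auto
    then show ?thesis using sm_less'[OF E, of k' k j] that yE by simp
  qed
  have xy: "x < y" using l a by (auto simp: x_def split: nat.splits)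
  have px: "E k i \<le> x" by (auto simp: x_def split: nat.splits)
  have ax: "E k' j \<le> x" if "k = Suc k'" for k' using that by (auto simp: x_def)
  have "valid E k x"
  proof (rule valid_SucI[where j = j])
    show "x \<noteq> \<infinity>" by (rule enat_less_fin[OF xy])
    show "0 < x" using sm_pos[OF E, of k i] px by (rule order.strict_trans2)
  qed (use E xy ax yE j in auto)
  moreover have p: "pos E k x = j" using E xy yE px j by (intro pos_eqI) auto
  moreover have "\<not> fits E k j x" using j by (auto simp: fits_def x_def max_def split: nat.splits)
  ultimately show ?thesis
    using yE by (intro exI[of _ E] exI[of _ x]) (auto simp: bump_mat_def out_def)
qed

lemma predecessor_unique:
  assumes "sym_incr E" "vpos E k y j" "y \<noteq> \<infinity>"
    and "valid D k x" "bump_mat D k x = E" "out D k x = y"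
    and "valid D' k x'" "bump_mat D' k x' = E" "out D' k x' = y"
  shows "D = D' \<and> x = x'"
  using predecessor_unique_aux[OF assms(1-6)] predecessor_unique_aux[OF assms(1-3) assms(7-9)] assms(2)
  by (cases "E k j < y") (auto simp: vpos_def)

section \<open>Complete insertions and their records\<close>

text \<open>\<open>run k\<close> is the state on arrival at row \<open>k\<close>; the letter
  \<infinity> means that the insertion is over.\<close>

primrec run :: "nat \<Rightarrow> mat \<Rightarrow> enat \<Rightarrow> mat \<times> enat" where
  "run 0 D x = (D, x)"
| "run (Suc n) D x = (let (E, z) = run n D x in if z = \<infinity> then (E, \<infinity>) else (bump_mat E n z, out E n z))"

abbreviation run_mat :: "nat \<Rightarrow> mat \<Rightarrow> enat \<Rightarrow> mat" where "run_mat n D x \<equiv> fst (run n D x)"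
abbreviation run_letter :: "nat \<Rightarrow> mat \<Rightarrow> enat \<Rightarrow> enat" where "run_letter n D x \<equiv> snd (run n D x)"

lemma rm_Suc: "run_letter n D x \<noteq> \<infinity> \<Longrightarrow> run_mat (Suc n) D x = bump_mat (run_mat n D x) n (run_letter n D x)"
  and rx_Suc: "run_letter n D x \<noteq> \<infinity> \<Longrightarrow> run_letter (Suc n) D x = out (run_mat n D x) n (run_letter n D x)"
  and rm_Suc_inf: "run_letter n D x = \<infinity> \<Longrightarrow> run_mat (Suc n) D x = run_mat n D x"
  and rx_Suc_inf: "run_letter n D x = \<infinity> \<Longrightarrow> run_letter (Suc n) D x = \<infinity>"
  by (auto split: prod.splits)

declare run.simps(2) [simp del]

lemma run_valid: "valid D 0 x \<Longrightarrow> run_letter n D x \<noteq> \<infinity> \<Longrightarrow> valid (run_mat n D x) n (run_letter n D x)"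
proof (induction n)
  case (Suc n)
  then have fin: "run_letter n D x \<noteq> \<infinity>" using rx_Suc_inf[of n D x] by metis
  with Suc have "valid (run_mat n D x) n (run_letter n D x)" by blast
  from valid_step(2)[OF this] show ?case
    using Suc.prems(2) by (simp add: rm_Suc[OF fin] rx_Suc[OF fin])
qed simp

lemma run_sm: "valid D 0 x \<Longrightarrow> sym_incr (run_mat n D x)"
proof (induction n)
  case (Suc n)
  then show ?case
    by (cases "run_letter n D x = \<infinity>") (auto simp: rm_Suc_inf rm_Suc intro: sm_stepm run_valid)
qed (simp add: validD)

lemma rx_less:
  assumes "valid D 0 x" "run_letter n D x \<noteq> \<infinity>"
  shows "run_letter n D x < run_letter (Suc n) D x"
  using out_gt[OF run_sm[OF assms(1)] assms(2)] by (simp add: rx_Suc[OF assms(2)])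

lemma rx_le_add: "valid D 0 x \<Longrightarrow> run_letter n D x \<le> run_letter (n + d) D x"
proof (induction d)
  case (Suc d)
  then have "run_letter (n + d) D x \<le> run_letter (Suc (n + d)) D x"
    using rx_less[of D x "n + d"] rx_Suc_inf[of "n + d" D x]
    by (cases "run_letter (n + d) D x = \<infinity>") auto
  with Suc show ?case by simp
qed simp

lemma rx_mono: "valid D 0 x \<Longrightarrow> m \<le> n \<Longrightarrow> run_letter m D x \<le> run_letter n D x"
  using rx_le_add[of D x m "n - m"] by simp

lemma stepm_supp:
  assumes "valid D k x" "out D k x \<noteq> \<infinity>"
  shows "bump_mat D k x r c = \<infinity> \<longleftrightarrow> D r c = \<infinity>"
  using assms validD(1,3)[of D k x] sm_sym[of D k "pos D k x"]
  by (auto simp: bump_mat_def upd_def out_def)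

lemma run_supp:
  "valid D 0 x \<Longrightarrow> run_letter n D x \<noteq> \<infinity> \<Longrightarrow> run_mat n D x r c = \<infinity> \<longleftrightarrow> D r c = \<infinity>"
proof (induction n)
  case (Suc n)
  then have fin: "run_letter n D x \<noteq> \<infinity>" using rx_Suc_inf[of n D x] by metis
  then show ?case
    using Suc stepm_supp[OF run_valid[OF Suc.prems(1) fin]] by (simp add: rm_Suc rx_Suc)
qed simp

text \<open>A finite letter arriving at row \<open>n + 1\<close> is at least some entry of row
  \<open>n\<close>, so an insertion cannot get beyond an empty row.\<close>

lemma run_bound:
  assumes "valid D 0 x" "\<And>j. D n j = \<infinity>"
  shows "run_letter (Suc n) D x = \<infinity>"
proof (rule ccontr)
  assume fin: "run_letter (Suc n) D x \<noteq> \<infinity>"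
  then obtain j where "vpos (run_mat (Suc n) D x) n (run_letter (Suc n) D x) j"
    using run_valid[OF assms(1) fin] by (auto simp: valid_def)
  then have "run_mat (Suc n) D x n j \<noteq> \<infinity>" using fin by (auto simp: vpos_def)
  then show False using run_supp[OF assms(1) fin, of n j] assms(2) by simp
qed

lemma run_terminates:
  assumes "valid D 0 x"
  shows "\<exists>n. run_letter (Suc n) D x = \<infinity>"
  using sm_bound[OF validD(1)[OF assms]] run_bound[OF assms] by blast

definition end_row :: "mat \<Rightarrow> enat \<Rightarrow> nat" where
  "end_row D x = (LEAST n. run_letter (Suc n) D x = \<infinity>)"
definition ins :: "mat \<Rightarrow> enat \<Rightarrow> mat" where
  "ins D x = run_mat (Suc (end_row D x)) D x"
definition end_pos :: "mat \<Rightarrow> enat \<Rightarrow> nat" where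
  "end_pos D x = pos (run_mat (end_row D x) D x) (end_row D x) (run_letter (end_row D x) D x)"
definition grew :: "mat \<Rightarrow> enat \<Rightarrow> bool" where
  "grew D x \<longleftrightarrow> fits (run_mat (end_row D x) D x) (end_row D x) (end_pos D x) (run_letter (end_row D x) D x)"
definition height :: "mat \<Rightarrow> nat \<Rightarrow> nat" where
  "height D c = (LEAST r. D r c = \<infinity>)"
text \<open>If the shape does not grow, the insertion stops in front of an addable box \<open>(k, j)\<close> with \<open>j > 0\<close>, and
  it is recorded at the bottom of column \<open>j - 1\<close>.\<close>

definition box_of :: "mat \<Rightarrow> bool \<Rightarrow> nat \<Rightarrow> nat \<Rightarrow> nat \<times> nat" where
  "box_of E g k j = (if g then (k, j) else (height E (j - 1) - 1, j - 1))"
definition box :: "mat \<Rightarrow> enat \<Rightarrow> nat \<times> nat" where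
  "box D x = box_of (ins D x) (grew D x) (end_row D x) (end_pos D x)"
definition corner :: "mat \<Rightarrow> nat \<times> nat \<Rightarrow> bool" where
  "corner E b \<longleftrightarrow> (case b of (r, c) \<Rightarrow> E r c \<noteq> \<infinity> \<and> E (Suc r) c = \<infinity> \<and> E r (Suc c) = \<infinity>)"

lemma tn_inf: "valid D 0 x \<Longrightarrow> run_letter (Suc (end_row D x)) D x = \<infinity>"
  unfolding end_row_def by (rule LeastI_ex) (rule run_terminates)

lemma tn_fin:
  assumes "valid D 0 x"
  shows "run_letter (end_row D x) D x \<noteq> \<infinity>"
proof (cases "end_row D x")
  case (Suc n)
  then have "n < end_row D x" by simp
  then show ?thesis using not_less_Least[of n "\<lambda>n. run_letter (Suc n) D x = \<infinity>"] Suc by (simp add: end_row_def)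
qed (use validD[OF assms] in simp)

lemma rx_fin_iff:
  assumes "valid D 0 x"
  shows "run_letter n D x \<noteq> \<infinity> \<longleftrightarrow> n \<le> end_row D x"
proof
  show "n \<le> end_row D x" if "run_letter n D x \<noteq> \<infinity>"
  proof (rule ccontr)
    assume "\<not> n \<le> end_row D x"
    then have "run_letter (Suc (end_row D x)) D x \<le> run_letter n D x" by (intro rx_mono assms) auto
    then show False using tn_inf[OF assms] that by simp
  qed
  show "run_letter n D x \<noteq> \<infinity>" if "n \<le> end_row D x"
    using rx_mono[OF assms that] tn_fin[OF assms] enat_le_fin by blast
qed

lemma tn_eqI:
  assumes "valid D 0 x" "run_letter n D x \<noteq> \<infinity>" "run_letter (Suc n) D x = \<infinity>"
  shows "end_row D x = n"
  using rx_fin_iff[OF assms(1), of n] rx_fin_iff[OF assms(1), of "Suc n"] assms by simp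

lemma ins_sm: "valid D 0 x \<Longrightarrow> sym_incr (ins D x)"
  unfolding ins_def by (rule run_sm)

lemma height_iff:
  assumes "sym_incr D"
  shows "D r c = \<infinity> \<longleftrightarrow> height D c \<le> r"
proof
  show "height D c \<le> r" if "D r c = \<infinity>" unfolding height_def using that by (rule Least_le)
  obtain B where "D B c = \<infinity>" using sm_bound[OF assms] by blast
  then have "D (height D c) c = \<infinity>" unfolding height_def by (rule LeastI)
  then show "D r c = \<infinity>" if "height D c \<le> r" using sm_inf[OF assms] that by blast
qed

lemma height_antimono: "sym_incr D \<Longrightarrow> c \<le> c' \<Longrightarrow> height D c' \<le> height D c"
proof -
  assume D: "sym_incr D" and c: "c \<le> c'"
  have "D (height D c) c = \<infinity>" using height_iff[OF D] by simp
  then have "D (height D c) c' = \<infinity>" using sm_inf[OF D _ order_refl c] by blast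
  then show ?thesis using height_iff[OF D] by simp
qed

lemma corner_iff:
  assumes "sym_incr E"
  shows "corner E (r, c) \<longleftrightarrow> height E c = Suc r \<and> height E (Suc c) \<le> r"
  using height_iff[OF assms] by (auto simp: corner_def)

text \<open>The last step is treated apart. It bumps \<infinity>, so \<open>predecessor_ex\<close>
  does not cover it, and its inverse has to be read off the record \<open>(g, b)\<close> instead of
  the bumped letter.\<close>

definition final :: "mat \<Rightarrow> nat \<Rightarrow> enat \<Rightarrow> mat \<Rightarrow> bool \<Rightarrow> nat \<times> nat \<Rightarrow> bool" where
  "final D k x E g b \<longleftrightarrow> valid D k x \<and> out D k x = \<infinity> \<and> bump_mat D k x = E \<and>
     g = fits D k (pos D k x) x \<and> b = box_of E g k (pos D k x)"

lemma final_grew: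
  assumes "final D k x E True b"
  shows "b = (k, pos D k x)" "D = upd E (fst b) (snd b) \<infinity>" "x = E (fst b) (snd b)" "corner E b"
    "D (fst b) (snd b) = \<infinity>"
proof -
  let ?j = "pos D k x"
  have v: "valid D k x" and o: "D k ?j = \<infinity>" and E: "E = upd D k ?j x" and b: "b = (k, ?j)"
    using assms by (auto simp: final_def out_def bump_mat_def box_of_def)
  note D = validD[OF v]
  show "b = (k, pos D k x)" by (rule b)
  show "D = upd E (fst b) (snd b) \<infinity>" using upd_same[OF D(1), of k ?j] o by (simp add: E b)
  show "x = E (fst b) (snd b)" by (simp add: E b)
  show "corner E b"
    using sm_inf[OF D(1) o, of "Suc k" ?j] sm_inf[OF D(1) o, of k "Suc ?j"] D(3)
    by (simp add: corner_def E b)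
  show "D (fst b) (snd b) = \<infinity>" using o b by simp
qed

text \<open>Without growth, the row of the last step is not part of the record. It is recovered as
  the height of the column following the recorded one, because the insertion stops in front of the
  addable box at the foot of that column.\<close>

lemma final_kept:
  assumes "final D k x E False b"
  shows "D = E" "pos D k x = Suc (snd b)" "k = height E (Suc (snd b))" "corner E b"
    "x = (case k of 0 \<Rightarrow> E k (snd b) | Suc k' \<Rightarrow> max (E k (snd b)) (E k' (Suc (snd b))))"
proof -
  let ?j = "pos D k x"
  have v: "valid D k x" and o: "D k ?j = \<infinity>" and nf: "\<not> fits D k ?j x"
    and b: "b = (height E (?j - 1) - 1, ?j - 1)"
    using assms by (auto simp: final_def out_def box_of_def)
  note D = validD[OF v]
  show DE: "D = E" using assms by (auto simp: final_def bump_mat_def)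
  have a: "D k' ?j \<le> x" if "k = Suc k'" for k' using valid_above_le[of D k' x] v that by simp
  obtain i where i: "?j = Suc i" using v nf by (cases rule: not_fits_cases) auto
  then show j: "?j = Suc (snd b)" using b by simp
  have p: "D k i \<le> x" using before_pos[of i D k x] i by simp
  show k: "k = height E (Suc (snd b))"
  proof (rule antisym)
    show "height E (Suc (snd b)) \<le> k"
      using height_iff[OF D(1), of k "Suc i"] o i b DE by simp
    show "k \<le> height E (Suc (snd b))"
    proof (cases k)
      case (Suc k')
      then have "D k' (Suc i) \<noteq> \<infinity>" using a[OF Suc] i D(3) enat_le_fin by simp
      then show ?thesis using height_iff[OF D(1), of k' "Suc i"] Suc b i DE by simp
    qed simp
  qed
  have "k < height E i" using height_iff[OF D(1), of k i] enat_le_fin[OF p D(3)] DE by simp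
  moreover have bi: "b = (height E i - 1, i)" using b i by simp
  moreover have "k = height E (Suc i)" unfolding bi k by (simp add: bi)
  ultimately show "corner E b"
    using corner_iff[OF D(1)[unfolded DE], of "height E i - 1" i] by simp
  from v nf show "x = (case k of 0 \<Rightarrow> E k (snd b) | Suc k' \<Rightarrow> max (E k (snd b)) (E k' (Suc (snd b))))"
  proof (cases rule: not_fits_cases)
    case (1 i)
    then show ?thesis using a b DE by (auto simp: max_def split: nat.splits)
  next
    case (2 i k')
    then show ?thesis using b DE by (auto simp: max_def)
  qed
qed

lemma final_corner: "final D k x E g b \<Longrightarrow> corner E b"
  by (cases g) (auto dest: final_grew(4) final_kept(4))

lemma final_unique:
  assumes "final D k x E g b" "final D' k' x' E g b"
  shows "D = D' \<and> k = k' \<and> x = x'"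
proof (cases g)
  case True
  have f1: "final D k x E True b" and f2: "final D' k' x' E True b" using assms True by simp_all
  have "k = k'" using final_grew(1)[OF f1] final_grew(1)[OF f2] by simp
  then show ?thesis
    using final_grew(2,3)[OF f1] final_grew(2,3)[OF f2] by simp
next
  case False
  then have f1: "final D k x E False b" and f2: "final D' k' x' E False b" using assms by simp_all
  have "k = k'" using final_kept(3)[OF f1] final_kept(3)[OF f2] by simp
  then show ?thesis
    using final_kept(1,5)[OF f1] final_kept(1,5)[OF f2] by metis
qed

text \<open>With growth, the entry of the corner is the inserted letter and is taken out. Without
  growth, the step is placed in front of the addable box of the next column; the letter must equal
  one neighbour of that box and be at least the other, hence the maximum.\<close>

lemma final_ex:
  assumes E: "sym_incr E" and c: "corner E b"
  shows "\<exists>D k x. final D k x E g b"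
proof -
  obtain r c where b: "b = (r, c)" by force
  have fin: "E r c \<noteq> \<infinity>" and inf: "E (Suc r) c = \<infinity>" "E r (Suc c) = \<infinity>"
    using c b by (auto simp: corner_def)
  show ?thesis
  proof (cases g)
    case True
    let ?D = "upd E r c \<infinity>" and ?x = "E r c"
    have l: "E r c' < ?x" if "c = Suc c'" for c' using sm_Suc[OF E, of r c'] that fin by auto
    have a: "E r' c < ?x" if "r = Suc r'" for r'
      using sm_less'[OF E, of r' r c] sm_inf[OF E, of r' c r c] that fin by auto
    have smD: "sym_incr ?D"
      using l a fin inf
      by (intro sm_upd[OF E]) (auto intro: order.strict_trans)
    have v: "valid ?D r ?x"
      using smD sm_pos[OF E] fin a by (intro valid_SucI[where j = c]) (auto intro: less_imp_le)
    have p: "pos ?D r ?x = c"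
      using smD fin l by (intro pos_eqI) (auto intro: less_imp_le)
    have f: "fits ?D r c ?x" using l a by (auto simp: fits_def)
    have "final ?D r ?x E True b"
      using v p f b upd_same[OF E, of r c] by (auto simp: final_def out_def bump_mat_def box_of_def)
    then show ?thesis using True by (intro exI) simp
  next
    case False
    define k where "k = height E (Suc c)"
    define x where "x = (case k of 0 \<Rightarrow> E k c | Suc k' \<Rightarrow> max (E k c) (E k' (Suc c)))"
    have h: "height E c = Suc r" "k \<le> r" using corner_iff[OF E] c b by (auto simp: k_def)
    have kinf: "E k (Suc c) = \<infinity>" using height_iff[OF E, of k "Suc c"] by (simp add: k_def)
    have pfin: "E k c \<noteq> \<infinity>" using height_iff[OF E, of k c] h by simp
    have afin: "E k' (Suc c) \<noteq> \<infinity>" if "k = Suc k'" for k'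
      using height_iff[OF E, of k' "Suc c"] that by (simp add: k_def)
    have xfin: "x \<noteq> \<infinity>" using pfin afin by (auto simp: x_def max_def split: nat.splits)
    have px: "E k c \<le> x" by (auto simp: x_def split: nat.splits)
    have ax: "E k' (Suc c) \<le> x" if "k = Suc k'" for k' using that by (auto simp: x_def)
    have v: "valid E k x"
    proof (rule valid_SucI[where j = "Suc c"])
      show "0 < x" using sm_pos[OF E, of k c] px by (rule order.strict_trans2)
    qed (use E xfin ax kinf in auto)
    have p: "pos E k x = Suc c" using E xfin kinf px by (intro pos_eqI) auto
    have "\<not> fits E k (Suc c) x" by (auto simp: fits_def x_def max_def split: nat.splits)
    then have "final E k x E False b"
      using v p kinf h b by (auto simp: final_def out_def bump_mat_def box_of_def)
    then show ?thesis using False by (intro exI) simp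
  qed
qed

lemma final_ins:
  assumes "valid D 0 x"
  shows "final (run_mat (end_row D x) D x) (end_row D x) (run_letter (end_row D x) D x) (ins D x) (grew D x) (box D x)"
  using run_valid[OF assms tn_fin[OF assms]] tn_inf[OF assms] tn_fin[OF assms]
  by (simp add: final_def rx_Suc ins_def rm_Suc grew_def box_def end_pos_def)

lemma reach_ex: "valid D k x \<Longrightarrow> \<exists>D0 x0. valid D0 0 x0 \<and> run k D0 x0 = (D, x)"
proof (induction k arbitrary: D x)
  case (Suc k)
  then obtain j where "vpos D k x j" by (auto simp: valid_def)
  with predecessor_ex[of D k x j] Suc.prems obtain D' x' where
    D': "valid D' k x'" "bump_mat D' k x' = D" "out D' k x' = x"
    by (auto dest: validD)
  with Suc.IH obtain D0 x0 where "valid D0 0 x0" "run k D0 x0 = (D', x')" by blast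
  with D' show ?case using rm_Suc[of k D0 x0] rx_Suc[of k D0 x0] validD(3)[OF D'(1)]
    by (intro exI[of _ D0] exI[of _ x0]) (auto simp: prod_eq_iff)
qed auto

lemma reach_inj:
  "valid D0 0 x0 \<Longrightarrow> valid D1 0 x1 \<Longrightarrow> run k D0 x0 = run k D1 x1 \<Longrightarrow> run_letter k D0 x0 \<noteq> \<infinity> \<Longrightarrow>
   D0 = D1 \<and> x0 = x1"
proof (induction k)
  case (Suc k)
  have f0: "run_letter k D0 x0 \<noteq> \<infinity>" and f1: "run_letter k D1 x1 \<noteq> \<infinity>" using rx_Suc_inf Suc.prems by metis+
  have v: "valid (run_mat (Suc k) D0 x0) (Suc k) (run_letter (Suc k) D0 x0)"
    using Suc.prems run_valid by blast
  then obtain j where j: "vpos (run_mat (Suc k) D0 x0) k (run_letter (Suc k) D0 x0) j" by (auto simp: valid_def)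
  have "run_mat k D0 x0 = run_mat k D1 x1 \<and> run_letter k D0 x0 = run_letter k D1 x1"
    using Suc.prems
    by (intro predecessor_unique[OF validD(1)[OF v] j validD(3)[OF v]] run_valid f0 f1)
       (simp_all add: rm_Suc[OF f0, symmetric] rm_Suc[OF f1, symmetric] rx_Suc[OF f0, symmetric]
         rx_Suc[OF f1, symmetric])
  then show ?case using Suc.IH[OF Suc.prems(1,2) _ f0] by (simp add: prod_eq_iff)
qed auto

text \<open>Together with \<open>ins_record_inj\<close> this makes insertion a bijection from pairs
  of a matrix and a letter to triples of a matrix, one of its corners and a growth flag.\<close>

theorem ins_record_ex:
  assumes "sym_incr E" "corner E b"
  shows "\<exists>D x. valid D 0 x \<and> ins D x = E \<and> grew D x = g \<and> box D x = b"
proof -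
  obtain D k x where f: "final D k x E g b" using final_ex[OF assms] by blast
  then have v: "valid D k x" by (simp add: final_def)
  obtain D0 x0 where D0: "valid D0 0 x0" "run k D0 x0 = (D, x)" using reach_ex[OF v] by blast
  have fin: "run_letter k D0 x0 \<noteq> \<infinity>" using D0 validD(3)[OF v] by simp
  have "end_row D0 x0 = k"
    using f D0 rx_Suc[OF fin] by (intro tn_eqI fin) (simp_all add: final_def)
  then have "ins D0 x0 = E" "grew D0 x0 = g" "box D0 x0 = b"
    using f D0 rm_Suc[OF fin] by (auto simp: final_def ins_def grew_def box_def end_pos_def)
  then show ?thesis using D0 by blast
qed

theorem ins_record_inj:
  assumes "valid D 0 x" "valid D' 0 x'"
    and "ins D x = ins D' x'" "grew D x = grew D' x'" "box D x = box D' x'"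
  shows "D = D' \<and> x = x'"
proof -
  have "run_mat (end_row D x) D x = run_mat (end_row D' x') D' x' \<and> end_row D x = end_row D' x' \<and> run_letter (end_row D x) D x = run_letter (end_row D' x') D' x'"
    using final_unique[OF final_ins[OF assms(1), unfolded assms(3-5)] final_ins[OF assms(2)]] .
  then show ?thesis
    using reach_inj[OF assms(1,2) _ tn_fin[OF assms(1)]] prod_eqI by metis
qed


subsection \<open>Successive insertions\<close>

lemma stepm_entry: "bump_mat D k x r c = D r c \<or> bump_mat D k x r c = x \<and> (r = k \<and> c = pos D k x \<or> r = pos D k x \<and> c = k)"
  by (auto simp: bump_mat_def upd_def)

text \<open>Because of the symmetry, a row may still change after the insertion has passed it, as
  the mirror image of a later step. The point is that any value written later is one of the later
  letters.\<close>

lemma run_entry: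
  assumes "valid D 0 x"
  shows "run_mat (m + d) D x r c \<le> run_mat m D x r c \<and>
    (run_mat (m + d) D x r c = run_mat m D x r c \<or>
     (\<exists>i\<ge>m. i < m + d \<and> run_letter i D x \<noteq> \<infinity> \<and> run_mat (m + d) D x r c = run_letter i D x))"
proof (induction d)
  case (Suc d)
  show ?case
  proof (cases "run_letter (m + d) D x = \<infinity>")
    case True
    then show ?thesis using Suc rm_Suc_inf[of "m + d" D x] by auto
  next
    case False
    then show ?thesis
    proof -
      let ?R = "run_mat (m + d) D x" and ?S = "run_mat (m + Suc d) D x"
      have le: "?S r c \<le> run_mat m D x r c"
        using order.trans[OF stepm_row_le[OF run_valid[OF assms False], of r c]] rm_Suc[OF False] Suc
        by simp
      have "?S r c = ?R r c \<or> ?S r c = run_letter (m + d) D x"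
        using stepm_entry[of ?R "m + d" "run_letter (m + d) D x" r c] rm_Suc[OF False] by auto
      then show ?thesis
      proof
        assume "?S r c = run_letter (m + d) D x"
        then show ?thesis using le False by (intro conjI disjI2 exI[of _ "m + d"]) auto
      next
        assume "?S r c = ?R r c"
        then show ?thesis using le Suc by (metis add_Suc_right less_SucI)
      qed
    qed
  qed
qed simp

lemma run_entry_bumped:
  assumes "valid D 0 x"
  shows "run_mat n D x r c = D r c \<or> (\<exists>m<n. run_letter m D x \<noteq> \<infinity> \<and> run_letter (Suc m) D x = D r c)"
proof (induction n)
  case (Suc n)
  show ?case
  proof (cases "run_letter n D x = \<infinity> \<or> run_mat n D x r c \<noteq> D r c")
    case True
    then show ?thesis using Suc rm_Suc_inf[of n D x] less_Suc_eq by auto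
  next
    case False
    then have fin: "run_letter n D x \<noteq> \<infinity>" and eq: "run_mat n D x r c = D r c" by auto
    have "run_mat n D x n (pos (run_mat n D x) n (run_letter n D x)) = run_letter (Suc n) D x"
      by (simp add: rx_Suc[OF fin] out_def)
    then show ?thesis
      using stepm_entry[of "run_mat n D x" n "run_letter n D x" r c] rm_Suc[OF fin] eq fin
        sm_sym[OF run_sm[OF assms], of n r c] by auto
  qed
qed simp

lemma ins_entry:
  assumes "valid D 0 x" "k \<le> Suc (end_row D x)"
  shows "ins D x r c \<le> run_mat k D x r c \<and>
    (ins D x r c = run_mat k D x r c \<or>
     (\<exists>i\<ge>k. run_letter i D x \<noteq> \<infinity> \<and> ins D x r c = run_letter i D x))"
  using run_entry[OF assms(1), of k "Suc (end_row D x) - k" r c] assms(2)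
  by (auto simp: ins_def)

text \<open>Induction on the row. The letter bumped by the second insertion is an entry of row
  \<open>k\<close> left behind by the first. Either it was present when the first insertion reached
  row \<open>k\<close>, and then it was a candidate for being bumped; or it was written in a later
  row, and then it is a later letter of the first insertion.\<close>

lemma weakly_larger_stays_larger:
  assumes D: "valid D 0 x" and E: "valid E 0 x'" "E = ins D x" and le: "x \<le> x'"
  shows "run_letter k D x \<le> run_letter k E x'"
proof (induction k)
  case (Suc k)
  show ?case
  proof (cases "run_letter k E x' = \<infinity>")
    case True
    then show ?thesis using rx_Suc_inf by simp
  next
    case fin': False
    then have fin: "run_letter k D x \<noteq> \<infinity>" using Suc enat_le_fin by blast
    then have k: "k \<le> Suc (end_row D x)" using rx_fin_iff[OF D] by auto
    let ?y = "run_letter (Suc k) D x" and ?y' = "run_letter (Suc k) E x'"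
    define j' where "j' = pos (run_mat k E x') k (run_letter k E x')"
    have y': "?y' = run_mat k E x' k j'" using fin' by (simp add: rx_Suc out_def j'_def)
    have gt: "run_letter k E x' < ?y'" by (rule rx_less[OF E(1) fin'])
    \<comment> \<open>All letters written so far by the second insertion are at most its current
      letter, which is below \<open>?y'\<close>.\<close>
    have "run_mat k E x' k j' = E k j'"
    proof (rule ccontr)
      assume "run_mat k E x' k j' \<noteq> E k j'"
      then obtain i where "i < k" "run_mat k E x' k j' = run_letter i E x'"
        using run_entry[OF E(1), of 0 k k j'] by auto
      then show False using gt rx_mono[OF E(1), of i k] y' by simp
    qed
    then have y'E: "?y' = ins D x k j'" using y' E(2) by simp
    show ?thesis
    proof (cases "ins D x k j' = run_mat k D x k j'")
      case True
      then have "run_letter k D x < run_mat k D x k j'" using Suc gt y'E by simp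
      then show ?thesis using out_le[OF run_sm[OF D]] True y'E by (simp add: rx_Suc[OF fin])
    next
      case False
      then obtain i where i: "i \<ge> k" "?y' = run_letter i D x" using ins_entry[OF D k, of k j'] y'E by auto
      have "i \<noteq> k" using i gt Suc by auto
      then show ?thesis using i rx_mono[OF D, of "Suc k" i] by simp
    qed
  qed
qed (use le in simp)

text \<open>It suffices to find in row \<open>k\<close> of \<open>E\<close> an entry above the
  current letter of the second insertion and below the letter bumped by the first. The trace of the
  first insertion provides one.\<close>

lemma smaller_stays_smaller:
  assumes D: "valid D 0 x" and E: "valid E 0 x'" "E = ins D x" and lt: "x' < x"
  shows "k \<le> Suc (end_row D x) \<Longrightarrow> run_letter k E x' < run_letter k D x"
proof (induction k)
  case (Suc k)
  then have IH: "run_letter k E x' < run_letter k D x" and k: "k \<le> end_row D x" "k \<le> Suc (end_row D x)" by auto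
  have fin: "run_letter k D x \<noteq> \<infinity>" using rx_fin_iff[OF D] k(1) by blast
  have fin': "run_letter k E x' \<noteq> \<infinity>" by (rule enat_less_fin[OF IH])
  let ?X = "run_letter k D x" and ?X' = "run_letter k E x'"
  let ?y = "run_letter (Suc k) D x" and ?y' = "run_letter (Suc k) E x'"
  have gt: "?X < ?y" by (rule rx_less[OF D fin])
  have D': "valid (run_mat k D x) k ?X" by (rule run_valid[OF D fin])
  have old: "run_mat n E x' r c = E r c" if "?X' < E r c" "n \<le> k" for n r c
  proof (rule ccontr)
    assume "run_mat n E x' r c \<noteq> E r c"
    then obtain m where "m < n" "run_letter (Suc m) E x' = E r c" using run_entry_bumped[OF E(1)] by blast
    then show False using rx_mono[OF E(1), of "Suc m" k] that by simp
  qed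
  have key: "?y' < ?y" if "?X' < E k c" "E k c < ?y" for c
  proof -
    have "run_mat k E x' k c = E k c" using old that by blast
    then have "?y' \<le> E k c" using out_le[OF run_sm[OF E(1)], of ?X' k k c] that by (simp add: rx_Suc[OF fin'])
    then show ?thesis using that by simp
  qed
  have E_ge: "?X \<le> E r c" if "?X \<le> run_mat k D x r c" for r c
    using ins_entry[OF D k(2), of r c] that rx_mono[OF D] E(2) by fastforce
  have E_le: "E r c \<le> run_mat k D x r c" for r c
    using ins_entry[OF D k(2), of r c] E(2) by simp
  define j where "j = pos (run_mat k D x) k ?X"
  show ?case
  proof (cases "fits (run_mat k D x) k j ?X")
    case True
    then have "run_mat (Suc k) D x k j = ?X" using fin by (simp add: rm_Suc bump_mat_def j_def)
    then have "E k j \<le> ?X" "?X \<le> E k j"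
      using ins_entry[OF D Suc.prems, of k j] rx_mono[OF D, of k] E(2) by fastforce+
    then show ?thesis using key[of j] IH gt by simp
  next
    case False
    from D' False[unfolded j_def] show ?thesis
    proof (cases rule: not_fits_cases)
      case (1 i)
      then have "E k i = ?X" using E_ge[of k i] E_le[of k i] by simp
      then show ?thesis using key[of i] IH gt by simp
    next
      \<comment> \<open>Row \<open>k\<close> need not contain the first letter here. The second path
        runs through row \<open>k'\<close> weakly left of column \<open>i\<close>, so its letter is
        below the entry at \<open>(k, i)\<close>, which serves as the intermediate one.\<close>
      case (2 i k')
      note k' = 2(2) and a = 2(3) and p = 2(4)
      have Ea: "E k' (Suc i) = ?X" using E_ge[of k' "Suc i"] E_le[of k' "Suc i"] a by simp
      have fink': "run_letter k' E x' \<noteq> \<infinity>" using fin' rx_Suc_inf k' by blast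
      define c where "c = pos (run_mat k' E x') k' (run_letter k' E x')"
      have X': "?X' = run_mat k' E x' k' c" using fink' k' by (simp add: rx_Suc out_def c_def)
      have Xi: "run_mat k' E x' k' (Suc i) = ?X" using old[of k' "Suc i" k'] Ea IH k' by simp
      then have "run_mat k' E x' k' c < run_mat k' E x' k' (Suc i)" using X' IH by simp
      then have "\<not> Suc i \<le> c" using sm_le[OF run_sm[OF E(1)]] by (meson not_le)
      then have "c \<le> i" by simp
      then have "?X' \<le> run_mat k' E x' k' i" using X' sm_le[OF run_sm[OF E(1)]] by simp
      also have "\<dots> < run_mat k' E x' k i"
      proof (rule sm_less'[OF run_sm[OF E(1)]])
        show "run_mat k' E x' k' i \<noteq> \<infinity>"
          using sm_le[OF run_sm[OF E(1)], of i "Suc i" k' k'] Xi fin enat_le_fin by simp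
      qed (use k' in simp)
      also have "\<dots> \<le> E k i" using run_entry[OF E(1), of 0 k' k i] by simp
      finally have "?X' < E k i" .
      moreover have "E k i < ?y" using E_le[of k i] p gt by simp
      ultimately show ?thesis by (rule key)
    qed
  qed
qed (use lt in simp)

text \<open>Both comparisons are applied at the row after the last one of the first insertion, where
  the letter of that insertion is \<infinity>.\<close>

theorem tn_le_iff:
  assumes D: "valid D 0 x" and E: "valid (ins D x) 0 x'"
  shows "end_row (ins D x) x' \<le> end_row D x \<longleftrightarrow> x \<le> x'"
proof
  assume le: "x \<le> x'"
  have "run_letter (Suc (end_row D x)) (ins D x) x' = \<infinity>"
    using weakly_larger_stays_larger[OF D E refl le, of "Suc (end_row D x)"] tn_inf[OF D] by simp
  then show "end_row (ins D x) x' \<le> end_row D x"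
    using rx_fin_iff[OF E, of "Suc (end_row D x)"] by simp
next
  assume le: "end_row (ins D x) x' \<le> end_row D x"
  show "x \<le> x'"
  proof (rule ccontr)
    assume "\<not> x \<le> x'"
    then have "run_letter (Suc (end_row D x)) (ins D x) x' < run_letter (Suc (end_row D x)) D x"
      by (intro smaller_stays_smaller[OF D E refl]) auto
    then have "run_letter (Suc (end_row D x)) (ins D x) x' \<noteq> \<infinity>" by (rule enat_less_fin)
    then show False using rx_fin_iff[OF E] le by auto
  qed
qed


subsection \<open>The record of an insertion\<close>

lemma ins_inf_iff:
  assumes "valid D 0 x"
  shows "ins D x r c = \<infinity> \<longleftrightarrow> D r c = \<infinity> \<and> \<not> (grew D x \<and> ((r, c) = box D x \<or> (c, r) = box D x))"
proof -
  note f = final_ins[OF assms]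
  have supp: "run_mat (end_row D x) D x r c = \<infinity> \<longleftrightarrow> D r c = \<infinity>" for r c
    by (rule run_supp[OF assms tn_fin[OF assms]])
  show ?thesis
  proof (cases "grew D x")
    case True
    obtain i j where b: "box D x = (i, j)" by force
    have "run_mat (end_row D x) D x = upd (ins D x) i j \<infinity>" "ins D x i j \<noteq> \<infinity>"
    proof -
      have g: "grew D x = True" using True by simp
      show "run_mat (end_row D x) D x = upd (ins D x) i j \<infinity>" "ins D x i j \<noteq> \<infinity>"
        using final_grew(2,4)[OF f[unfolded g]] b by (auto simp: corner_def)
    qed
    moreover have "ins D x j i \<noteq> \<infinity>"
      using calculation(2) sm_sym[OF ins_sm[OF assms], of i j] by simp
    ultimately show ?thesis using True b supp[of r c] by (auto simp: upd_def split: if_splits)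
  next
    case False
    then have g: "grew D x = False" by simp
    show ?thesis using final_kept(1)[OF f[unfolded g]] False supp[of r c] by simp
  qed
qed

lemma height_cong: "(\<And>r. D r c = \<infinity> \<longleftrightarrow> E r c = \<infinity>) \<Longrightarrow> height D c = height E c"
  by (simp add: height_def)

lemma tn_kept:
  assumes "valid D 0 x" "\<not> grew D x"
  shows "end_row D x = height (ins D x) (Suc (snd (box D x)))"
    and "box D x = (height (ins D x) (snd (box D x)) - 1, snd (box D x))"
    and "height (ins D x) c = height D c"
proof -
  have g: "grew D x = False" using assms(2) by simp
  note f = final_kept[OF final_ins[OF assms(1), unfolded g]]
  show "end_row D x = height (ins D x) (Suc (snd (box D x)))" by (rule f(3))
  show "box D x = (height (ins D x) (snd (box D x)) - 1, snd (box D x))"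
    using assms(2) by (simp add: box_def box_of_def)
  show "height (ins D x) c = height D c"
    using ins_inf_iff[OF assms(1)] assms(2) by (intro height_cong) simp
qed

text \<open>The end row is expressed by the heights after the insertion and also by those before it,
  since \<open>box_order\<close> looks at the matrix between two insertions.\<close>

lemma tn_grew:
  assumes "valid D 0 x" "grew D x"
  shows "end_row D x = height (ins D x) (snd (box D x)) - 1"
    and "box D x = (end_row D x, snd (box D x))"
    and "end_row D x = height D (snd (box D x))"
proof -
  have g: "grew D x = True" using assms(2) by simp
  note f = final_grew[OF final_ins[OF assms(1), unfolded g]]
  let ?M = "run_mat (end_row D x) D x"
  have v: "valid ?M (end_row D x) (run_letter (end_row D x) D x)" by (rule run_valid[OF assms(1) tn_fin[OF assms(1)]])
  show b: "box D x = (end_row D x, snd (box D x))" using f(1) by simp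
  show "end_row D x = height (ins D x) (snd (box D x)) - 1"
    using corner_iff[OF ins_sm[OF assms(1)], of "end_row D x" "snd (box D x)"] f(4) b by simp
  have "height ?M (snd (box D x)) = end_row D x"
  proof (rule antisym)
    show "height ?M (snd (box D x)) \<le> end_row D x"
      using height_iff[OF validD(1)[OF v], of "end_row D x" "snd (box D x)"] f(5) b by (metis fst_conv)
    show "end_row D x \<le> height ?M (snd (box D x))"
    proof (cases "end_row D x")
      case (Suc k')
      then have "?M k' (snd (box D x)) \<noteq> \<infinity>"
        using valid_above_le[of ?M k' "run_letter (end_row D x) D x"] v f(1) tn_fin[OF assms(1)]
          enat_le_fin by (metis snd_conv)
      then show ?thesis using height_iff[OF validD(1)[OF v], of k'] Suc by simp
    qed simp
  qed
  then show "end_row D x = height D (snd (box D x))"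
    using height_cong[of ?M _ D] run_supp[OF assms(1) tn_fin[OF assms(1)]] by simp
qed

text \<open>Everything is expressed by the column heights \<open>H\<close> of the matrix between the
  two insertions. They decrease weakly, and strictly after the column of a corner. If the two
  recorded columns agree, the second end row is at most the first exactly when the second insertion
  does not grow, and then both boxes are the bottom of that column.\<close>

theorem box_order:
  assumes D: "valid D 0 x" and E: "valid (ins D x) 0 x'"
  shows "x \<le> x' \<longleftrightarrow> box (ins D x) x' = box D x \<or> snd (box D x) < snd (box (ins D x) x')"
proof -
  let ?E = "ins D x"
  define H where "H = height ?E"
  define c1 where "c1 = snd (box D x)"
  define c2 where "c2 = snd (box ?E x')"
  have anti: "H c' \<le> H c" if "c \<le> c'" for c c'
    unfolding H_def using that by (rule height_antimono[OF ins_sm[OF D]])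
  have "corner ?E (box D x)" using final_corner[OF final_ins[OF D]] .
  then have corner: "fst (box D x) = H c1 - 1" "H (Suc c1) < H c1"
    using corner_iff[OF ins_sm[OF D], of "fst (box D x)" "snd (box D x)"]
    by (auto simp: H_def c1_def)
  have b1: "box D x = (H c1 - 1, c1)" using corner(1) by (simp add: prod_eq_iff c1_def)
  have N1: "end_row D x = (if grew D x then H c1 - 1 else H (Suc c1))"
    using tn_kept(1)[OF D] tn_grew(1)[OF D] by (simp add: H_def c1_def)
  have N2: "end_row ?E x' = (if grew ?E x' then H c2 else H (Suc c2))"
    using tn_kept(1,3)[OF E] tn_grew(3)[OF E] by (simp add: H_def c2_def)
  have b2: "box ?E x' = (if grew ?E x' then H c2 else H c2 - 1, c2)"
    using tn_kept(2,3)[OF E] tn_grew(2,3)[OF E] by (auto simp: H_def c2_def)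
  have "end_row ?E x' \<le> end_row D x \<longleftrightarrow> box ?E x' = box D x \<or> c1 < c2"
  proof (cases "c1 < c2")
    case True
    then have "H c2 \<le> H (Suc c1)" "H (Suc c2) \<le> H (Suc c1)" by (auto intro: anti)
    then show ?thesis using N1 N2 corner True by auto
  next
    case False
    then have "H c1 \<le> H c2" by (auto intro: anti)
    moreover have "H c1 \<le> H (Suc c2)" if "c2 < c1" using that by (auto intro: anti)
    ultimately show ?thesis using False N1 N2 corner b1 b2 by (cases "c2 = c1") auto
  qed
  then show ?thesis using tn_le_iff[OF D E] by (simp add: c1_def c2_def)
qed

subsection \<open>Weak set-valued shifted tableaux on the symmetric plane\<close>

definition wsv :: "(nat \<times> nat) set \<Rightarrow> (nat \<times> nat \<Rightarrow> letter multiset) \<Rightarrow> bool" where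
  "wsv S T \<longleftrightarrow>
     (\<forall>b. b \<notin> S \<longrightarrow> T b = {#}) \<and>
     (\<forall>b \<in> S. T b \<noteq> {#} \<and> (\<forall>a \<in># T b. 1 \<le> fst a)) \<and>
     (\<forall>i j. (i, j) \<in> S \<and> (i, Suc j) \<in> S \<longrightarrow>
        (\<forall>a \<in># T (i, j). \<forall>c \<in># T (i, Suc j). lkey a \<le> lkey c)) \<and>
     (\<forall>i j. (i, j) \<in> S \<and> (Suc i, j) \<in> S \<longrightarrow>
        (\<forall>a \<in># T (i, j). \<forall>c \<in># T (Suc i, j). lkey a \<le> lkey c)) \<and>
     (\<forall>i. \<forall>a \<in># T (i, i). \<not> snd a) \<and>
     (\<forall>i i' j n. (n, False) \<in># T (i, j) \<longrightarrow> (n, False) \<in># T (i', j) \<longrightarrow> i = i') \<and>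
     (\<forall>i j j' n. (n, True) \<in># T (i, j) \<longrightarrow> (n, True) \<in># T (i, j') \<longrightarrow> j = j')"

definition wts :: "(nat \<times> nat) set \<Rightarrow> (nat \<times> nat \<Rightarrow> letter multiset) \<Rightarrow> nat \<Rightarrow> nat" where
  "wts S T i = (\<Sum>b\<in>S. count (T b) (i, False) + count (T b) (i, True))"

definition upset :: "mat \<Rightarrow> (nat \<times> nat) set" where
  "upset E = {(i, j). i \<le> j \<and> E i j \<noteq> \<infinity>}"

definition tab_box :: "nat \<times> nat \<Rightarrow> nat \<times> nat" where
  "tab_box b = (min (fst b) (snd b), max (fst b) (snd b))"

text \<open>A primed letter of box \<open>(i, j)\<close> is attributed to the reflected box \<open>(j, i)\<close> below the diagonal.\<close>

definition ltr :: "nat \<Rightarrow> nat \<times> nat \<Rightarrow> letter" where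
  "ltr n b = (n, snd b < fst b)"

definition occ :: "(nat \<times> nat \<Rightarrow> letter multiset) \<Rightarrow> nat \<Rightarrow> nat \<times> nat \<Rightarrow> bool" where
  "occ T n b \<longleftrightarrow> ltr n b \<in># T (tab_box b)"

definition last_box :: "(nat \<times> nat \<Rightarrow> letter multiset) \<Rightarrow> nat \<Rightarrow> nat \<times> nat \<Rightarrow> bool" where
  "last_box T n b \<longleftrightarrow> occ T n b \<and> (\<forall>b'. occ T n b' \<longrightarrow> b' \<noteq> b \<longrightarrow> snd b' < snd b)"

lemma finite_upset: "sym_incr E \<Longrightarrow> finite (upset E)"
proof -
  assume "sym_incr E"
  then obtain B where "\<forall>i j. B \<le> i \<or> B \<le> j \<longrightarrow> E i j = \<infinity>" using sm_bound by blast
  then have "upset E \<subseteq> {..<B} \<times> {..<B}" unfolding upset_def by (auto simp: not_less) (meson not_le)+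
  then show ?thesis by (rule finite_subset) simp
qed

lemma card_le_1_iff: "finite A \<Longrightarrow> card A \<le> 1 \<longleftrightarrow> (\<forall>x y. x \<in> A \<longrightarrow> y \<in> A \<longrightarrow> x = y)"
  using card_le_Suc0_iff_eq[of A] by auto

text \<open>\<open>card\<close> is 0 on infinite sets, so the bounds by 1 express uniqueness only
  because all letters lie in finitely many boxes.\<close>

lemma wsvt_iff_wsv:
  assumes "finite (shifted_shape lam)"
  shows "wsvt lam T \<longleftrightarrow> wsv (shifted_shape lam) T"
proof (cases "\<forall>b. b \<notin> shifted_shape lam \<longrightarrow> T b = {#}")
  case True
  have "{i. a \<in># T (i, j)} \<subseteq> fst ` shifted_shape lam" for j a
  proof
    fix i assume "i \<in> {i. a \<in># T (i, j)}"
    then have "(i, j) \<in> shifted_shape lam" using True by (metis empty_not_add_mset mem_Collect_eq multi_member_split)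
    then show "i \<in> fst ` shifted_shape lam" by force
  qed
  then have 1: "finite {i. a \<in># T (i, j)}" for j a using assms finite_subset by blast
  have "{j. a \<in># T (i, j)} \<subseteq> snd ` shifted_shape lam" for i a
  proof
    fix j assume "j \<in> {j. a \<in># T (i, j)}"
    then have "(i, j) \<in> shifted_shape lam" using True by (metis empty_not_add_mset mem_Collect_eq multi_member_split)
    then show "j \<in> snd ` shifted_shape lam" by force
  qed
  then have 2: "finite {j. a \<in># T (i, j)}" for i a using assms finite_subset by blast
  have "(\<forall>j n. card {i. (n, False) \<in># T (i, j)} \<le> 1) \<longleftrightarrow>
      (\<forall>i i' j n. (n, False) \<in># T (i, j) \<longrightarrow> (n, False) \<in># T (i', j) \<longrightarrow> i = i')"
    unfolding card_le_1_iff[OF 1] mem_Collect_eq by fast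
  moreover have "(\<forall>i n. card {j. (n, True) \<in># T (i, j)} \<le> 1) \<longleftrightarrow>
      (\<forall>i j j' n. (n, True) \<in># T (i, j) \<longrightarrow> (n, True) \<in># T (i, j') \<longrightarrow> j = j')"
    unfolding card_le_1_iff[OF 2] mem_Collect_eq by fast
  ultimately show ?thesis unfolding wsvt_def wsv_def by (simp only:)
next
  case False
  then show ?thesis unfolding wsvt_def wsv_def by (simp only: simp_thms)
qed

context
  fixes E :: mat and T :: "nat \<times> nat \<Rightarrow> letter multiset"
  assumes E: "sym_incr E" and T: "wsv (upset E) T"
begin

lemma wsv_in: "a \<in># T b \<Longrightarrow> b \<in> upset E"
  using T unfolding wsv_def by (metis empty_iff set_mset_empty)

lemma wsv_empty_iff: "T b = {#} \<longleftrightarrow> b \<notin> upset E"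
  using T unfolding wsv_def by metis

lemma wsv_label: "a \<in># T b \<Longrightarrow> 1 \<le> fst a"
  using T wsv_in[of a b] unfolding wsv_def by blast

lemma wsv_diag: "(n, True) \<in># T (i, j) \<Longrightarrow> i < j"
proof -
  assume a: "(n, True) \<in># T (i, j)"
  have "\<forall>i. \<forall>a \<in># T (i, i). \<not> snd a" using T unfolding wsv_def by (elim conjE)
  then have "i \<noteq> j" using a by force
  then show ?thesis using wsv_in[OF a] by (simp add: upset_def)
qed

lemma wsv_row:
  assumes "j < j'" "(i, j') \<in> upset E" "a \<in># T (i, j)" "c \<in># T (i, j')"
  shows "lkey a \<le> lkey c"
  using assms
proof (induction j' arbitrary: c)
  case (Suc n)
  have j: "(i, j) \<in> upset E" using wsv_in Suc.prems by blast
  then have n: "(i, n) \<in> upset E"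
    using Suc.prems sm_inf[OF E, of i n i "Suc n"] by (auto simp: upset_def)
  have step: "lkey a' \<le> lkey c" if "a' \<in># T (i, n)" for a'
    using T n Suc.prems that unfolding wsv_def by blast
  show ?case
  proof (cases "j = n")
    case False
    obtain d where "d \<in># T (i, n)" using T n unfolding wsv_def by (meson multiset_nonemptyE)
    then show ?thesis using Suc.IH[of d] step[of d] Suc.prems False n by simp
  qed (use step Suc.prems in blast)
qed simp

lemma wsv_col:
  assumes "i < i'" "(i', j) \<in> upset E" "a \<in># T (i, j)" "c \<in># T (i', j)"
  shows "lkey a \<le> lkey c"
  using assms
proof (induction i' arbitrary: c)
  case (Suc n)
  then have n: "(n, j) \<in> upset E"
    using sm_inf[OF E, of n j "Suc n" j] by (auto simp: upset_def)
  have step: "lkey a' \<le> lkey c" if "a' \<in># T (n, j)" for a'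
    using T n Suc.prems that unfolding wsv_def by blast
  show ?case
  proof (cases "i = n")
    case False
    obtain d where "d \<in># T (n, j)" using T n unfolding wsv_def by (meson multiset_nonemptyE)
    then show ?thesis using Suc.IH[of d] step[of d] Suc.prems False n by simp
  qed (use step Suc.prems in blast)
qed simp

lemma wsv_mono:
  assumes "i \<le> i'" "j \<le> j'" "(i, j) \<noteq> (i', j')" "a \<in># T (i, j)" "c \<in># T (i', j')"
  shows "lkey a \<le> lkey c"
proof -
  have u: "(i', j') \<in> upset E" "(i, j) \<in> upset E" using assms wsv_in by auto
  then have m: "(i, j') \<in> upset E" using assms sm_inf[OF E, of i j' i' j'] by (auto simp: upset_def)
  consider "j = j'" | "i = i'" | "i < i'" "j < j'" using assms by linarith
  then show ?thesis
  proof cases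
    case 1
    then show ?thesis using wsv_col[of i i' j' a c] assms u by (cases "i = i'") auto
  next
    case 2
    then show ?thesis using wsv_row[of j j' i' a c] assms u by (cases "j = j'") auto
  next
    case 3
    obtain d where d: "d \<in># T (i, j')" using T m unfolding wsv_def by (meson multiset_nonemptyE)
    show ?thesis
      using wsv_row[OF 3(2) m assms(4) d] wsv_col[OF 3(1) u(1) d assms(5)] by simp
  qed
qed

lemma occ_cases:
  assumes "occ T n b"
  obtains i j where "b = (i, j)" "i \<le> j" "(n, False) \<in># T (i, j)"
  | i j where "b = (j, i)" "i < j" "(n, True) \<in># T (i, j)"
  using assms that by (cases b) (auto simp: occ_def ltr_def tab_box_def not_less min_def max_def split: if_splits)

lemma occI: "(n, False) \<in># T (i, j) \<Longrightarrow> occ T n (i, j)" "(n, True) \<in># T (i, j) \<Longrightarrow> occ T n (j, i)"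
  using wsv_in[of "(n, False)" "(i, j)"] wsv_diag[of n i j]
  by (auto simp: occ_def ltr_def tab_box_def upset_def)

text \<open>Attributing primed letters to reflected boxes merges the row condition and the column
  condition into one condition per column. In the mixed case an unprimed \<open>n\<close> in
  \<open>(i, j)\<close> and a primed one in \<open>(j, k)\<close> would force \<open>n\<close> \<le>
  \<open>n'\<close>, the first box lying weakly northwest of the second.\<close>

lemma occ_col_unique:
  assumes "occ T n b" "occ T n b'" "snd b = snd b'"
  shows "b = b'"
proof -
  have clash: False if "(n, False) \<in># T (i, j)" "i \<le> j" "(n, True) \<in># T (j, k)" "j < k" for i j k
  proof -
    have "lkey (n, False) \<le> lkey (n, True)" using that by (intro wsv_mono[of i j j k]) auto
    then show False using wsv_label[OF that(1)] by (simp add: lkey_def)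
  qed
  from assms(1) show ?thesis
  proof (cases rule: occ_cases)
    case (1 i j)
    note b = 1
    from assms(2) show ?thesis
    proof (cases rule: occ_cases)
      case (1 i' j')
      then show ?thesis using b assms(3) T unfolding wsv_def by auto
    next
      case (2 i' j')
      then show ?thesis using b assms(3) clash[of i j j'] by auto
    qed
  next
    case (2 i j)
    note b = 2
    from assms(2) show ?thesis
    proof (cases rule: occ_cases)
      case (1 i' j')
      then show ?thesis using b assms(3) clash[of i' j' j] by auto
    next
      case (2 i' j')
      then show ?thesis using b assms(3) T unfolding wsv_def by auto
    qed
  qed
qed

lemma occ_in: "occ T n b \<Longrightarrow> tab_box b \<in> upset E"
  unfolding occ_def by (rule wsv_in)

lemma last_box_ex:
  assumes "occ T n b"
  shows "\<exists>b'. last_box T n b' \<and> snd b \<le> snd b'"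
proof -
  let ?A = "{b. occ T n b}"
  have "?A \<subseteq> (\<lambda>(i, j). (i, j)) ` upset E \<union> (\<lambda>(i, j). (j, i)) ` upset E"
  proof
    fix b assume "b \<in> ?A"
    then have "tab_box b \<in> upset E" using occ_in by simp
    then show "b \<in> (\<lambda>(i, j). (i, j)) ` upset E \<union> (\<lambda>(i, j). (j, i)) ` upset E"
      by (cases b) (force simp: tab_box_def min_def max_def split: if_splits)
  qed
  then have fin: "finite ?A" using finite_upset[OF E] finite_subset by blast
  then have "Max (snd ` ?A) \<in> snd ` ?A" using assms fin by (intro Max_in finite_imageI) blast+
  then obtain b' where b': "occ T n b'" "snd b' = Max (snd ` ?A)" by auto
  have "snd c < snd b'" if "occ T n c" "c \<noteq> b'" for c
  proof -
    have "snd c \<le> snd b'" using b' that fin by simp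
    moreover have "snd c \<noteq> snd b'" using occ_col_unique that b' by blast
    ultimately show ?thesis by simp
  qed
  then show ?thesis using b' fin assms by (intro exI[of _ b']) (auto simp: last_box_def)
qed

text \<open>A box right of or below the last one could hold only the largest label again, and such
  an occurrence would be attributed to a column that is not smaller.\<close>

lemma last_box_corner:
  assumes last: "last_box T n b" and max: "\<And>a b. a \<in># T b \<Longrightarrow> fst a \<le> n"
  shows "corner E b"
proof -
  have lkey_ge: "a = (n, False)" if "a \<in># T b" "lkey (n, False) \<le> lkey a" for a b
    using max[OF that(1)] wsv_label[OF that(1)] that(2)
    by (cases a) (auto simp: lkey_def split: if_splits)
  have lkey_ge': "a = (n, False) \<or> a = (n, True)" if "a \<in># T b" "lkey (n, True) \<le> lkey a" for a b
    using max[OF that(1)] wsv_label[OF that(1)] that(2)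
    by (cases a) (auto simp: lkey_def split: if_splits)
  have nonempty: "\<exists>a. a \<in># T (i, j)" if "(i, j) \<in> upset E" for i j
    using T that unfolding wsv_def by (meson multiset_nonemptyE)
  have noocc: "\<not> occ T n c" if "snd b \<le> snd c" "c \<noteq> b" for c
    using last that unfolding last_box_def by (meson leD)
  have "occ T n b" using last by (simp add: last_box_def)
  then show ?thesis
  proof (cases rule: occ_cases)
    case (1 i j)
    have "(i, Suc j) \<notin> upset E"
    proof
      assume u: "(i, Suc j) \<in> upset E"
      then obtain a where a: "a \<in># T (i, Suc j)" using nonempty by blast
      then have "a = (n, False)" using wsv_row[OF _ u 1(3) a] by (intro lkey_ge) auto
      then show False using noocc[of "(i, Suc j)"] occI(1) a 1(1) by simp
    qed
    moreover have "(Suc i, j) \<notin> upset E"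
    proof
      assume u: "(Suc i, j) \<in> upset E"
      then obtain a where a: "a \<in># T (Suc i, j)" using nonempty by blast
      then have "a = (n, False)" using wsv_col[OF _ u 1(3) a] by (intro lkey_ge) auto
      then show False using noocc[of "(Suc i, j)"] occI(1) a 1(1) by simp
    qed
    moreover have "(i, j) \<in> upset E" using wsv_in 1 by blast
    ultimately show ?thesis
      using 1 sm_sym[OF E, of "Suc j" j] by (cases "i = j") (auto simp: upset_def corner_def)
  next
    case (2 i j)
    have "(i, Suc j) \<notin> upset E"
    proof
      assume u: "(i, Suc j) \<in> upset E"
      then obtain a where a: "a \<in># T (i, Suc j)" using nonempty by blast
      then have "a = (n, False) \<or> a = (n, True)" using wsv_row[OF _ u 2(3) a] by (intro lkey_ge') auto
      then show False
        using noocc[of "(i, Suc j)"] noocc[of "(Suc j, i)"] occI[of n i "Suc j"] a 2 by auto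
    qed
    moreover have "(Suc i, j) \<notin> upset E"
    proof
      assume u: "(Suc i, j) \<in> upset E"
      then obtain a where a: "a \<in># T (Suc i, j)" using nonempty by blast
      then have "a = (n, False) \<or> a = (n, True)" using wsv_col[OF _ u 2(3) a] by (intro lkey_ge') auto
      then show False
        using noocc[of "(Suc i, j)"] noocc[of "(j, Suc i)"] occI[of n "Suc i" j] a 2 by auto
    qed
    moreover have "(i, j) \<in> upset E" using wsv_in 2 by blast
    ultimately show ?thesis
      using 2 sm_sym[OF E, of j i] sm_sym[OF E, of "Suc j" i] sm_sym[OF E, of j "Suc i"]
      by (auto simp: upset_def corner_def)
  qed
qed

end


section \<open>Adding and removing one letter of the largest label\<close>

definition add_ltr where
  "add_ltr T n b = T(tab_box b := add_mset (ltr n b) (T (tab_box b)))"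
definition rem_ltr where
  "rem_ltr T n b = T(tab_box b := T (tab_box b) - {#ltr n b#})"
text \<open>The relation between consecutive records that \<open>box_order\<close> establishes for
  insertions.\<close>

definition allowed :: "nat \<times> nat \<Rightarrow> nat \<times> nat \<Rightarrow> bool" where
  "allowed b' b \<longleftrightarrow> b' = b \<or> snd b' < snd b"

lemma corner_tb:
  assumes "sym_incr E" "corner E b"
  shows "tab_box b \<in> upset E" "(fst (tab_box b), Suc (snd (tab_box b))) \<notin> upset E"
    "(Suc (fst (tab_box b)), snd (tab_box b)) \<notin> upset E"
  using assms sm_sym[OF assms(1), of "fst b" "snd b"]
    sm_sym[OF assms(1), of "Suc (fst b)" "snd b"] sm_sym[OF assms(1), of "fst b" "Suc (snd b)"]
  by (auto simp: corner_def tab_box_def upset_def min_def max_def split: prod.splits if_splits)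

lemma tb_ltr_inj: "tab_box b = tab_box b' \<Longrightarrow> ltr n b = ltr n b' \<Longrightarrow> b = b'"
  by (cases b; cases b') (auto simp: tab_box_def ltr_def min_def max_def split: if_splits)

text \<open>As \<open>n\<close> is the largest label and \<open>b\<close> a corner, only the order
  relative to the left and upper neighbours can fail. An unprimed \<open>n\<close> dominates
  everything present. A primed one is endangered only by an adjacent unprimed \<open>n\<close>,
  which would lie in a column excluded by \<open>allowed\<close>.\<close>

lemma add_ltr_wsv:
  assumes E: "sym_incr E" "corner E b" and D: "sym_incr D" "upset D = (if g then upset E - {tab_box b} else upset E)"
    and T: "wsv (upset D) T" and n: "1 \<le> n" and max0: "\<forall>b. \<forall>a \<in># T b. fst a \<le> n"
    and last0: "\<forall>b'. last_box T n b' \<longrightarrow> allowed b' b"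
  shows "wsv (upset E) (add_ltr T n b)" "last_box (add_ltr T n b) n b" "T (tab_box b) = {#} \<longleftrightarrow> g"
proof -
  have max: "fst a \<le> n" if "a \<in># T b" for a b using max0 that by blast
  have last: "allowed b' b" if "last_box T n b'" for b' using last0 that by blast
  let ?T = "add_ltr T n b" and ?t = "tab_box b" and ?l = "ltr n b"
  note crn = corner_tb[OF E]
  obtain r c where b: "b = (r, c)" by force
  have other: "?T u = T u" if "u \<noteq> ?t" for u using that by (simp add: add_ltr_def)
  have in_t: "a \<in># ?T ?t \<longleftrightarrow> a = ?l \<or> a \<in># T ?t" for a by (simp add: add_ltr_def)
  have inT: "a \<in># ?T u \<longleftrightarrow> a \<in># T u \<or> u = ?t \<and> a = ?l" for a u
    by (cases "u = ?t") (auto simp: in_t other)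
  have inD: "u \<in> upset D" if "u \<in> upset E" "u \<noteq> ?t" for u using that D(2) by simp
  have DE: "u \<in> upset E" if "u \<in> upset D" for u using that D(2) by (auto split: if_splits)
  have key: "lkey a \<le> lkey ?l" if a: "a \<in># T (i, j)" and adj: "(i, Suc j) = ?t \<or> (Suc i, j) = ?t" for a i j
  proof (cases "c < r")
    case True
    have "a \<noteq> (n, False)"
    proof
      assume "a = (n, False)"
      then have o: "occ T n (i, j)" using occI(1)[OF D(1) T] a by simp
      then obtain b'' where b'': "last_box T n b''" "j \<le> snd b''"
        using last_box_ex[OF D(1) T o] by auto
      have ij: "i \<le> j" using wsv_in[OF D(1) T a] by (simp add: upset_def)
      have "j < c"
      proof (cases "b'' = b")
        case True
        then show ?thesis using b'' o ij b \<open>c < r\<close> unfolding last_box_def by force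
      next
        case False
        then show ?thesis using last[OF b''(1)] b'' b by (simp add: allowed_def)
      qed
      then show False using adj b True by (auto simp: tab_box_def)
    qed
    then show ?thesis
      using max[OF a] True wsv_label[OF D(1) T a] b
      by (cases a) (auto simp: ltr_def lkey_def split: if_splits)
  next
    case False
    then show ?thesis using max[OF a] b by (auto simp: ltr_def lkey_def)
  qed
  have uniq: "b' = b" if h: "occ T n b'" "snd b' = snd b" for b'
  proof -
    obtain b'' where b'': "last_box T n b''" "snd b' \<le> snd b''" using last_box_ex[OF D(1) T h(1)] by blast
    then have "b'' = b" using last[OF b''(1)] h(2) by (auto simp: allowed_def)
    then show ?thesis using occ_col_unique[OF D(1) T h(1), of b] b'' h(2) by (simp add: last_box_def)
  qed
  show "wsv (upset E) ?T"
    unfolding wsv_def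
  proof (intro conjI allI ballI impI)
    show "?T u = {#}" if "u \<notin> upset E" for u
      using that crn(1) other[of u] T DE unfolding wsv_def by metis
  next
    show "?T u \<noteq> {#}" if "u \<in> upset E" for u
      using that inD[of u] T other[of u] unfolding wsv_def by (cases "u = ?t") (auto simp: add_ltr_def)
  next
    show "1 \<le> fst a" if "a \<in># ?T u" for u a
      using that wsv_label[OF D(1) T, of a u] n by (auto simp: inT ltr_def)
  next
    fix i j a d assume u: "(i, j) \<in> upset E \<and> (i, Suc j) \<in> upset E"
      and a: "a \<in># ?T (i, j)" and d: "d \<in># ?T (i, Suc j)"
    have ne: "(i, j) \<noteq> ?t" using u crn(2) by (metis fst_conv snd_conv)
    then have a': "a \<in># T (i, j)" using a by (simp add: inT)
    show "lkey a \<le> lkey d"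
    proof (cases "d \<in># T (i, Suc j)")
      case True
      then show ?thesis
        using wsv_row[OF D(1) T _ wsv_in[OF D(1) T True] a' True] by simp
    next
      case False
      then show ?thesis using d key[OF a'] by (auto simp: inT)
    qed
  next
    fix i j a d assume u: "(i, j) \<in> upset E \<and> (Suc i, j) \<in> upset E"
      and a: "a \<in># ?T (i, j)" and d: "d \<in># ?T (Suc i, j)"
    have ne: "(i, j) \<noteq> ?t" using u crn(3) by (metis fst_conv snd_conv)
    then have a': "a \<in># T (i, j)" using a by (simp add: inT)
    show "lkey a \<le> lkey d"
    proof (cases "d \<in># T (Suc i, j)")
      case True
      then show ?thesis
        using wsv_col[OF D(1) T _ wsv_in[OF D(1) T True] a' True] by simp
    next
      case False
      then show ?thesis using d key[OF a'] by (auto simp: inT)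
    qed
  next
    fix i a assume "a \<in># ?T (i, i)"
    then consider "a \<in># T (i, i)" | "(i, i) = ?t" "a = ?l" by (auto simp: inT)
    then show "\<not> snd a"
    proof cases
      case 1
      then show ?thesis using T unfolding wsv_def by blast
    next
      case 2
      then show ?thesis using b by (auto simp: tab_box_def ltr_def min_def max_def split: if_splits)
    qed
  next
    fix i i' j k assume a: "(k, False) \<in># ?T (i, j)" "(k, False) \<in># ?T (i', j)"
    have one: "i = i'" if "(k, False) \<in># T (i, j)" "(i', j) = ?t" "(k, False) = ?l" for i i'
      using uniq[of "(i, j)"] occI(1)[OF D(1) T that(1)] that(2,3) b
      by (auto simp: tab_box_def ltr_def min_def max_def split: if_splits)
    consider "(k, False) \<in># T (i, j)" "(k, False) \<in># T (i', j)"
      | "(k, False) \<in># T (i, j)" "(i', j) = ?t" "(k, False) = ?l"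
      | "(k, False) \<in># T (i', j)" "(i, j) = ?t" "(k, False) = ?l"
      | "(i, j) = ?t" "(i', j) = ?t" using a by (auto simp: inT)
    then show "i = i'"
    proof cases
      case 1
      then show ?thesis using T unfolding wsv_def by blast
    next
      case 4
      then show ?thesis by (metis fst_conv)
    qed (use one in metis)+
  next
    fix i j j' k assume a: "(k, True) \<in># ?T (i, j)" "(k, True) \<in># ?T (i, j')"
    have one: "j = j'" if "(k, True) \<in># T (i, j)" "(i, j') = ?t" "(k, True) = ?l" for j j'
      using uniq[of "(j, i)"] occI(2)[OF D(1) T that(1)] that(2,3) b
      by (auto simp: tab_box_def ltr_def min_def max_def split: if_splits)
    consider "(k, True) \<in># T (i, j)" "(k, True) \<in># T (i, j')"
      | "(k, True) \<in># T (i, j)" "(i, j') = ?t" "(k, True) = ?l"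
      | "(k, True) \<in># T (i, j')" "(i, j) = ?t" "(k, True) = ?l"
      | "(i, j) = ?t" "(i, j') = ?t" using a by (auto simp: inT)
    then show "j = j'"
    proof cases
      case 1
      then show ?thesis using T unfolding wsv_def by blast
    next
      case 4
      then show ?thesis by (metis snd_conv)
    qed (use one in metis)+
  qed
  have occ': "occ T n b'" if "occ ?T n b'" "b' \<noteq> b" for b'
    using that tb_ltr_inj unfolding occ_def inT by blast
  show "last_box ?T n b"
    unfolding last_box_def
  proof (intro conjI allI impI)
    show "occ ?T n b" by (simp add: occ_def inT)
    fix b' assume "occ ?T n b'" "b' \<noteq> b"
    then have o: "occ T n b'" using occ' by blast
    then obtain b'' where b'': "last_box T n b''" "snd b' \<le> snd b''" using last_box_ex[OF D(1) T o] by blast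
    have "snd b' \<noteq> snd b" using uniq[OF o] \<open>b' \<noteq> b\<close> by blast
    then show "snd b' < snd b" using last[OF b''(1)] b''(2) by (auto simp: allowed_def)
  qed
  show "T ?t = {#} \<longleftrightarrow> g"
    using wsv_empty_iff[OF D(1) T] D(2) crn(1) by simp
qed

lemma rem_ltr_wsv:
  assumes E: "sym_incr E" and T: "wsv (upset E) T" and last: "last_box T n b"
    and D: "sym_incr D" "upset D = (if T (tab_box b) = {#ltr n b#} then upset E - {tab_box b} else upset E)"
  shows "wsv (upset D) (rem_ltr T n b)" "add_ltr (rem_ltr T n b) n b = T"
    "last_box (rem_ltr T n b) n b' \<Longrightarrow> allowed b' b"
proof -
  let ?R = "rem_ltr T n b" and ?t = "tab_box b" and ?l = "ltr n b"
  have l: "?l \<in># T ?t" using last by (simp add: last_box_def occ_def)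
  then show "add_ltr ?R n b = T" by (simp add: add_ltr_def rem_ltr_def)
  have sub: "a \<in># T u" if "a \<in># ?R u" for a u
    using that by (auto simp: rem_ltr_def split: if_splits dest: in_diffD)
  have other: "?R u = T u" if "u \<noteq> ?t" for u using that by (simp add: rem_ltr_def)
  have ut: "?t \<in> upset E" using wsv_in[OF E T l] .
  have R0: "?R u = {#} \<longleftrightarrow> u \<notin> upset D" for u
  proof (cases "u = ?t")
    case True
    have "T ?t - {#?l#} = {#} \<longleftrightarrow> T ?t = {#?l#}"
      using l by (metis add_mset_diff_bothsides diff_empty insert_DiffM)
    then show ?thesis using D(2) ut True by (simp add: rem_ltr_def)
  next
    case False
    have "T u = {#} \<longleftrightarrow> u \<notin> upset E" by (rule wsv_empty_iff[OF E T])
    then show ?thesis using False D(2) other[OF False] by simp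
  qed
  have DE: "u \<in> upset E" if "u \<in> upset D" for u using that D(2) by (auto split: if_splits)
  show "wsv (upset D) ?R"
    unfolding wsv_def
  proof (intro conjI allI ballI impI)
    show "?R u = {#}" if "u \<notin> upset D" for u using R0 that by blast
    show "?R u \<noteq> {#}" if "u \<in> upset D" for u using R0 that by blast
    show "1 \<le> fst a" if "a \<in># ?R u" for u a using wsv_label[OF E T sub[OF that]] .
  next
    fix i j a d assume u: "(i, j) \<in> upset D \<and> (i, Suc j) \<in> upset D"
      and a: "a \<in># ?R (i, j)" and d: "d \<in># ?R (i, Suc j)"
    show "lkey a \<le> lkey d" using wsv_row[OF E T _ _ sub[OF a] sub[OF d]] DE u by simp
  next
    fix i j a d assume u: "(i, j) \<in> upset D \<and> (Suc i, j) \<in> upset D"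
      and a: "a \<in># ?R (i, j)" and d: "d \<in># ?R (Suc i, j)"
    show "lkey a \<le> lkey d" using wsv_col[OF E T _ _ sub[OF a] sub[OF d]] DE u by simp
  next
    fix i a assume a: "a \<in># ?R (i, i)"
    show "\<not> snd a" using T sub[OF a] unfolding wsv_def by blast
  next
    fix i i' j k assume a: "(k, False) \<in># ?R (i, j)" "(k, False) \<in># ?R (i', j)"
    show "i = i'" using T sub[OF a(1)] sub[OF a(2)] unfolding wsv_def by blast
  next
    fix i j j' k assume a: "(k, True) \<in># ?R (i, j)" "(k, True) \<in># ?R (i, j')"
    show "j = j'" using T sub[OF a(1)] sub[OF a(2)] unfolding wsv_def by blast
  qed
  show "allowed b' b" if "last_box ?R n b'"
  proof -
    have "occ T n b'" using that sub by (auto simp: last_box_def occ_def)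
    then show ?thesis using last unfolding last_box_def allowed_def by blast
  qed
qed

lemma wts_add:
  assumes "finite S" "tab_box b \<in> S"
  shows "wts S (add_ltr T n b) = (wts S T)(n := Suc (wts S T n))"
proof
  fix i :: nat
  let ?f = "\<lambda>(T :: nat \<times> nat \<Rightarrow> letter multiset) u. count (T u) (i, False) + count (T u) (i, True)"
  have "wts S (add_ltr T n b) i = ?f (add_ltr T n b) (tab_box b) + (\<Sum>u\<in>S - {tab_box b}. ?f (add_ltr T n b) u)"
    unfolding wts_def using assms by (rule sum.remove)
  also have "(\<Sum>u\<in>S - {tab_box b}. ?f (add_ltr T n b) u) = (\<Sum>u\<in>S - {tab_box b}. ?f T u)"
    by (intro sum.cong) (auto simp: add_ltr_def)
  also have "?f (add_ltr T n b) (tab_box b) = ?f T (tab_box b) + (if i = n then 1 else 0)"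
    by (auto simp: add_ltr_def ltr_def)
  also have "?f T (tab_box b) + (if i = n then 1 else 0) + (\<Sum>u\<in>S - {tab_box b}. ?f T u)
      = wts S T i + (if i = n then 1 else 0)"
    using sum.remove[OF assms, of "?f T"] by (simp add: wts_def)
  finally show "wts S (add_ltr T n b) i = ((wts S T)(n := Suc (wts S T n))) i" by simp
qed

lemma wts_minus:
  assumes "finite S" "T t = {#}"
  shows "wts (S - {t}) T = wts S T"
  unfolding wts_def using assms by (intro ext sum.mono_neutral_left) auto

lemma wts_label:
  assumes "sym_incr E" "wsv (upset E) T" "a \<in># T b"
  shows "0 < wts (upset E) T (fst a)"
proof -
  have "b \<in> upset E" using wsv_in[OF assms] .
  moreover have "0 < count (T b) (fst a, False) + count (T b) (fst a, True)"
    using assms(3) by (cases a; cases "snd a") auto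
  ultimately show ?thesis unfolding wts_def using finite_upset[OF assms(1)]
    by (metis (no_types, lifting) sum_eq_0_iff gr0I)
qed


subsection \<open>Biwords\<close>

definition ins_word :: "nat list \<Rightarrow> mat" where
  "ins_word w = foldl (\<lambda>D x. ins D (enat x)) (\<lambda>_ _. \<infinity>) w"

definition slex :: "nat \<times> nat \<Rightarrow> nat \<times> nat \<Rightarrow> bool" where
  "slex p q \<longleftrightarrow> fst p < fst q \<or> fst p = fst q \<and> snd p \<le> snd q"

definition biwords :: "(nat \<Rightarrow> nat) \<Rightarrow> (nat \<times> nat) list set" where
  "biwords m = {xs. sorted_wrt slex xs \<and> (\<forall>p\<in>set xs. 1 \<le> fst p \<and> 1 \<le> snd p) \<and>
     (\<forall>n. length (filter (\<lambda>p. fst p = n) xs) = m n)}"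

definition BW :: "mat \<Rightarrow> (nat \<Rightarrow> nat) \<Rightarrow> (nat \<times> nat) list set" where
  "BW E m = {xs \<in> biwords m. ins_word (map snd xs) = E}"

definition WT :: "mat \<Rightarrow> (nat \<Rightarrow> nat) \<Rightarrow> (nat \<times> nat \<Rightarrow> letter multiset) set" where
  "WT E m = {T. wsv (upset E) T \<and> wts (upset E) T = m}"

definition last_rec :: "(nat \<times> nat) list \<Rightarrow> nat \<Rightarrow> nat \<times> nat \<Rightarrow> bool" where
  "last_rec xs n b \<longleftrightarrow>
     (\<exists>ys x. xs = ys @ [(n, x)] \<and> box (ins_word (map snd ys)) (enat x) = b)"

definition last_grew :: "(nat \<times> nat) list \<Rightarrow> bool" where
  "last_grew xs \<longleftrightarrow> grew (ins_word (map snd (butlast xs))) (enat (snd (last xs)))"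

lemma insw_Nil [simp]: "ins_word [] = (\<lambda>_ _. \<infinity>)"
  and insw_snoc [simp]: "ins_word (w @ [x]) = ins (ins_word w) (enat x)"
  by (simp_all add: ins_word_def)

lemma sm_insw: "(\<And>x. x \<in> set w \<Longrightarrow> 1 \<le> x) \<Longrightarrow> sym_incr (ins_word w)"
proof (induction w rule: rev_induct)
  case Nil
  then show ?case by (simp add: sym_incr_def)
next
  case (snoc x w)
  then have "sym_incr (ins_word w)" "1 \<le> x" by auto
  then have "valid (ins_word w) 0 (enat x)" by (auto simp: valid_def zero_enat_def)
  then show ?case using ins_sm by simp
qed

lemma valid_insw: "(\<And>x. x \<in> set w \<Longrightarrow> 1 \<le> x) \<Longrightarrow> 1 \<le> x \<Longrightarrow> valid (ins_word w) 0 (enat x)"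
  using sm_insw[of w] by (auto simp: valid_def zero_enat_def)

section \<open>The common recursion of tableaux and biwords\<close>

text \<open>\<open>last_box\<close> and \<open>last_rec\<close> are partial functions of the object.
  Counting the complement takes care of the objects without a value, for which the condition holds
  vacuously.\<close>

lemma card_functional:
  assumes A: "finite A" and Q: "finite Q" "\<And>a b. a \<in> A \<Longrightarrow> L a b \<Longrightarrow> b \<in> Q"
    and fn: "\<And>a b b'. L a b \<Longrightarrow> L a b' \<Longrightarrow> b = b'"
  shows "card {a \<in> A. \<forall>b. L a b \<longrightarrow> P b} = card A - (\<Sum>b\<in>{b\<in>Q. \<not> P b}. card {a \<in> A. L a b})"
proof -
  let ?U = "\<Union>b\<in>{b\<in>Q. \<not> P b}. {a \<in> A. L a b}"
  have "{a \<in> A. \<forall>b. L a b \<longrightarrow> P b} = A - ?U" using Q(2) by auto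
  then have "card {a \<in> A. \<forall>b. L a b \<longrightarrow> P b} = card A - card ?U"
    using A by (simp add: card_Diff_subset finite_subset[of ?U A] subset_iff)
  also have "card ?U = (\<Sum>b\<in>{b\<in>Q. \<not> P b}. card {a \<in> A. L a b})"
    using A Q(1) fn by (intro card_UN_disjoint) auto
  finally show ?thesis .
qed

lemma card_total_functional:
  assumes A: "finite A" and Q: "finite Q" "\<And>a b. a \<in> A \<Longrightarrow> L a b \<Longrightarrow> b \<in> Q"
    and fn: "\<And>a b b'. L a b \<Longrightarrow> L a b' \<Longrightarrow> b = b'" and tot: "\<And>a. a \<in> A \<Longrightarrow> \<exists>b. L a b"
  shows "card A = (\<Sum>b\<in>Q. card {a \<in> A. L a b})"
proof -
  have "A = (\<Union>b\<in>Q. {a \<in> A. L a b})"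
  proof (intro equalityI subsetI)
    fix a assume a: "a \<in> A"
    then obtain b where "L a b" using tot by blast
    with Q(2)[OF a this] a show "a \<in> (\<Union>b\<in>Q. {a \<in> A. L a b})" by blast
  qed blast
  then have "card A = card (\<Union>b\<in>Q. {a \<in> A. L a b})" by simp
  also have "\<dots> = (\<Sum>b\<in>Q. card {a \<in> A. L a b})"
    using A Q(1) fn by (intro card_UN_disjoint) auto
  finally show ?thesis .
qed

lemma last_box_unique: "last_box T n b \<Longrightarrow> last_box T n b' \<Longrightarrow> b = b'"
  unfolding last_box_def by (metis less_asym)

lemma last_rec_unique: "last_rec xs n b \<Longrightarrow> last_rec xs n b' \<Longrightarrow> b = b'"
  unfolding last_rec_def by auto

definition support :: "mat \<Rightarrow> (nat \<times> nat) set" where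
  "support E = {b. E (fst b) (snd b) \<noteq> \<infinity>}"

lemma finite_support: "sym_incr E \<Longrightarrow> finite (support E)"
proof -
  assume "sym_incr E"
  then obtain B where B: "\<And>i j. B \<le> i \<or> B \<le> j \<Longrightarrow> E i j = \<infinity>" using sm_bound by blast
  then have "support E \<subseteq> {..<B} \<times> {..<B}" unfolding support_def by (auto simp: not_less) (meson not_le)+
  then show ?thesis by (rule finite_subset) simp
qed

lemma corner_support: "corner E b \<Longrightarrow> b \<in> support E"
  by (auto simp: corner_def support_def split: prod.splits)

lemma WT_max:
  assumes "sym_incr E" "T \<in> WT E m" "\<forall>k>n. m k = 0" "a \<in># T b"
  shows "fst a \<le> n"
proof (rule ccontr)
  assume "\<not> fst a \<le> n"
  then have "m (fst a) = 0" using assms(3) by simp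
  then show False using wts_label[OF assms(1), of T a b] assms(2,4) by (simp add: WT_def)
qed

lemma WT_last_corner:
  assumes "sym_incr E" "T \<in> WT E m" "\<forall>k>n. m k = 0" "last_box T n b"
  shows "corner E b"
  using last_box_corner[OF assms(1) _ assms(4)] WT_max[OF assms(1-3)] assms(2) by (auto simp: WT_def)

lemma WT_last_ex:
  assumes "sym_incr E" "T \<in> WT E m" "m n \<noteq> 0"
  shows "\<exists>b. last_box T n b"
proof -
  have T: "wsv (upset E) T" and w: "wts (upset E) T n \<noteq> 0" using assms by (auto simp: WT_def)
  have "\<exists>u\<in>upset E. count (T u) (n, False) + count (T u) (n, True) \<noteq> 0"
  proof (rule ccontr)
    assume "\<not> ?thesis"
    then have "wts (upset E) T n = 0" unfolding wts_def by (intro sum.neutral) (auto simp: not_in_iff)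
    with w show False ..
  qed
  then obtain i j where "count (T (i, j)) (n, False) + count (T (i, j)) (n, True) \<noteq> 0" by auto
  then have "(n, False) \<in># T (i, j) \<or> (n, True) \<in># T (i, j)" by (auto simp: not_in_iff)
  then obtain b where "occ T n b" using occI[OF assms(1) T] by blast
  then show ?thesis using last_box_ex[OF assms(1) T] by blast
qed

lemma BW_letters: "xs \<in> BW E m \<Longrightarrow> x \<in> set (map snd xs) \<Longrightarrow> 1 \<le> x"
  by (auto simp: BW_def biwords_def)

lemma BW_last_corner:
  assumes "xs \<in> BW E m" "last_rec xs n b"
  shows "corner E b"
proof -
  obtain ys x where xs: "xs = ys @ [(n, x)]" "box (ins_word (map snd ys)) (enat x) = b"
    using assms(2) by (auto simp: last_rec_def)
  have "valid (ins_word (map snd ys)) 0 (enat x)"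
    using BW_letters[OF assms(1)] xs(1) by (intro valid_insw) auto
  from final_corner[OF final_ins[OF this]] show ?thesis using xs assms(1) by (simp add: BW_def)
qed

lemma slex_trans: "slex p q \<Longrightarrow> slex q r \<Longrightarrow> slex p r"
  by (auto simp: slex_def)

lemma biwords_content: "xs \<in> biwords m \<Longrightarrow> p \<in> set xs \<Longrightarrow> m (fst p) \<noteq> 0"
proof -
  assume "xs \<in> biwords m" and p: "p \<in> set xs"
  then have "length (filter (\<lambda>q. fst q = fst p) xs) = m (fst p)" by (simp add: biwords_def)
  moreover have "filter (\<lambda>q. fst q = fst p) xs \<noteq> []" using p by (auto simp: filter_empty_conv)
  ultimately show ?thesis by (metis length_0_conv)
qed

lemma biwords_last_ex:
  assumes "xs \<in> biwords m" "m n \<noteq> 0" "\<forall>k>n. m k = 0"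
  obtains ys x where "xs = ys @ [(n, x)]"
proof -
  have "length (filter (\<lambda>p. fst p = n) xs) \<noteq> 0" using assms by (simp add: biwords_def)
  then obtain p where p: "p \<in> set xs" "fst p = n" by (auto simp: filter_empty_conv)
  then obtain ys k x where xs: "xs = ys @ [(k, x)]" by (cases xs rule: rev_cases) auto
  have "n \<le> k" using assms(1) p xs by (auto simp: biwords_def sorted_wrt_append slex_def)
  moreover have "m k \<noteq> 0" using biwords_content[OF assms(1), of "(k, x)"] xs by simp
  ultimately have "k = n" using assms(3) by (metis le_neq_implies_less)
  then show thesis using that xs by blast
qed

lemma biwords_snoc_iff:
  assumes "m n \<noteq> 0" "\<forall>k>n. m k = 0"
  shows "ys @ [(n, x)] \<in> biwords m \<longleftrightarrow> ys \<in> biwords (m(n := m n - 1)) \<and> 1 \<le> n \<and> 1 \<le> x \<and>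
     (\<forall>zs z. ys = zs @ [(n, z)] \<longrightarrow> z \<le> x)"
proof
  assume a: "ys @ [(n, x)] \<in> biwords m"
  then have len: "length (filter (\<lambda>p. fst p = k) ys) = (m(n := m n - 1)) k" for k
    using assms(1) by (auto simp: biwords_def dest!: spec[of _ k])
  show "ys \<in> biwords (m(n := m n - 1)) \<and> 1 \<le> n \<and> 1 \<le> x \<and> (\<forall>zs z. ys = zs @ [(n, z)] \<longrightarrow> z \<le> x)"
    using a len by (auto simp: biwords_def sorted_wrt_append slex_def)
next
  assume a: "ys \<in> biwords (m(n := m n - 1)) \<and> 1 \<le> n \<and> 1 \<le> x \<and> (\<forall>zs z. ys = zs @ [(n, z)] \<longrightarrow> z \<le> x)"
  then have ys: "ys \<in> biwords (m(n := m n - 1))" by blast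
  have len: "length (filter (\<lambda>p. fst p = k) (ys @ [(n, x)])) = m k" for k
    using assms(1) ys by (auto simp: biwords_def)
  have "slex p (n, x)" if "p \<in> set ys" for p
  proof -
    obtain zs q where q: "ys = zs @ [q]" using \<open>p \<in> set ys\<close> by (cases ys rule: rev_cases) auto
    have "fst q \<le> n" using biwords_content[OF ys, of q] q assms(2)
      by (cases "fst q = n") (auto simp: not_less[symmetric])
    then have "slex q (n, x)" using a q by (cases q) (auto simp: slex_def)
    moreover have "p = q \<or> slex p q" using ys q that by (auto simp: biwords_def sorted_wrt_append)
    ultimately show ?thesis using slex_trans by blast
  qed
  then show "ys @ [(n, x)] \<in> biwords m"
    using a len unfolding biwords_def by (auto simp: sorted_wrt_append)
qed

lemma ins_record_upset:
  assumes "valid D 0 x"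
  shows "upset D = (if grew D x then upset (ins D x) - {tab_box (box D x)} else upset (ins D x))"
proof -
  obtain i j where b: "box D x = (i, j)" by force
  have "D i j = \<infinity>" if "grew D x"
    using tn_grew(2,3)[OF assms that] height_iff[OF validD(1)[OF assms], of i j] b by simp
  then have "D i j = \<infinity>" "D j i = \<infinity>" if "grew D x"
    using that sm_sym[OF validD(1)[OF assms], of i j] by auto
  then show ?thesis
    using ins_inf_iff[OF assms] b by (auto simp: upset_def tab_box_def min_def max_def)
qed


text \<open>The recursion on the tableau side, for a fixed record. The flag \<open>g\<close> tells
  whether the removed letter was alone in its box, just as for insertions it tells whether the box
  is new.\<close>

lemma WT_step_bij:
  assumes E: "sym_incr E" "corner E b" and D: "sym_incr D" "upset D = (if g then upset E - {tab_box b} else upset E)"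
    and n: "1 \<le> n" "m n \<noteq> 0" "\<forall>k>n. m k = 0"
  shows "bij_betw (\<lambda>T. add_ltr T n b)
    {T \<in> WT D (m(n := m n - 1)). \<forall>b'. last_box T n b' \<longrightarrow> allowed b' b}
    {T \<in> WT E m. last_box T n b \<and> (T (tab_box b) = {#ltr n b#} \<longleftrightarrow> g)}" (is "bij_betw _ ?A ?B")
proof (rule bij_betw_byWitness[where f' = "\<lambda>T. rem_ltr T n b"])
  let ?m = "m(n := m n - 1)"
  have tbE: "tab_box b \<in> upset E" using corner_tb[OF E] by blast
  have wD: "wts (upset D) T = wts (upset E) T" if "T (tab_box b) = {#} \<longleftrightarrow> g" for T
    using wts_minus[OF finite_upset[OF E(1)], of T "tab_box b"] D(2) that by (cases g) auto
  show "\<forall>T\<in>?A. rem_ltr (add_ltr T n b) n b = T"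
    by (auto simp: rem_ltr_def add_ltr_def)
  show "(\<lambda>T. add_ltr T n b) ` ?A \<subseteq> ?B"
  proof safe
    fix T assume T: "T \<in> WT D ?m" and last: "\<forall>b'. last_box T n b' \<longrightarrow> allowed b' b"
    have wsv: "wsv (upset D) T" and w: "wts (upset D) T = ?m" using T by (auto simp: WT_def)
    have max: "\<forall>b. \<forall>a \<in># T b. fst a \<le> n"
      using WT_max[OF D(1) T, of n] n(3) by simp
    note add = add_ltr_wsv[OF E D wsv n(1) max last]
    have "wts (upset E) T = ?m" using wD[of T] add(3) w by simp
    then have "wts (upset E) (add_ltr T n b) = m"
      using wts_add[OF finite_upset[OF E(1)] tbE, of T n] n(2) by auto
    then show "add_ltr T n b \<in> WT E m" using add(1) by (simp add: WT_def)
    show "last_box (add_ltr T n b) n b" by (rule add(2))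
    show "g" if "add_ltr T n b (tab_box b) = {#ltr n b#}" using that add(3) by (simp add: add_ltr_def)
    show "add_ltr T n b (tab_box b) = {#ltr n b#}" if "g" using that add(3) by (simp add: add_ltr_def)
  qed
  have inv: "rem_ltr T n b \<in> ?A \<and> add_ltr (rem_ltr T n b) n b = T" if "T \<in> ?B" for T
  proof -
    have wsv: "wsv (upset E) T" and w: "wts (upset E) T = m" and last: "last_box T n b"
      and g: "T (tab_box b) = {#ltr n b#} \<longleftrightarrow> g" using that by (auto simp: WT_def)
    have D2: "upset D = (if T (tab_box b) = {#ltr n b#} then upset E - {tab_box b} else upset E)"
      using D(2) g by simp
    note rem = rem_ltr_wsv[OF E(1) wsv last D(1) D2]
    have "m = (wts (upset E) (rem_ltr T n b))(n := Suc (wts (upset E) (rem_ltr T n b) n))"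
      using wts_add[OF finite_upset[OF E(1)] tbE, of "rem_ltr T n b" n] rem(2) w by simp
    then have "wts (upset E) (rem_ltr T n b) = ?m"
      by (metis diff_Suc_1 fun_upd_same fun_upd_triv fun_upd_upd)
    moreover have "rem_ltr T n b (tab_box b) = {#} \<longleftrightarrow> g"
      using wsv_empty_iff[OF D(1) rem(1)] D(2) tbE by simp
    ultimately show ?thesis using rem wD by (auto simp: WT_def)
  qed
  then show "\<forall>T\<in>?B. add_ltr (rem_ltr T n b) n b = T" and "(\<lambda>T. rem_ltr T n b) ` ?B \<subseteq> ?A"
    by blast+
qed

text \<open>The record and \<open>E\<close> determine \<open>D\<close> and \<open>x\<close>, so
  appending \<open>(n, x)\<close> can be inverted. The condition that \<open>x\<close> may follow an
  equal label turns into \<open>allowed\<close> by \<open>box_order\<close>.\<close>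

lemma BW_step_bij:
  assumes D: "valid D 0 (enat x)" "ins D (enat x) = E" "grew D (enat x) = g" "box D (enat x) = b"
    and n: "1 \<le> n" "m n \<noteq> 0" "\<forall>k>n. m k = 0"
  shows "bij_betw (\<lambda>ys. ys @ [(n, x)])
    {ys \<in> BW D (m(n := m n - 1)). \<forall>b'. last_rec ys n b' \<longrightarrow> allowed b' b}
    {xs \<in> BW E m. last_rec xs n b \<and> (last_grew xs \<longleftrightarrow> g)}" (is "bij_betw _ ?A ?B")
proof (rule bij_betw_byWitness[where f' = butlast])
  let ?m = "m(n := m n - 1)"
  have x: "1 \<le> x" using D(1) by (auto simp: valid_def zero_enat_def)
  have order: "z \<le> x \<longleftrightarrow> allowed b' b"
    if "ys = zs @ [(n, z)]" "box (ins_word (map snd zs)) (enat z) = b'" "ys \<in> BW D ?m" for ys zs z b'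
  proof -
    have "valid (ins_word (map snd zs)) 0 (enat z)"
      using BW_letters[OF that(3)] that(1) by (intro valid_insw) auto
    moreover have "D = ins (ins_word (map snd zs)) (enat z)" using that by (simp add: BW_def)
    ultimately show ?thesis
      using box_order[of "ins_word (map snd zs)" "enat z" "enat x"] D(1,4) that(2)
      by (auto simp: allowed_def)
  qed
  show "\<forall>ys\<in>?A. butlast (ys @ [(n, x)]) = ys" by simp
  show "(\<lambda>ys. ys @ [(n, x)]) ` ?A \<subseteq> ?B"
  proof safe
    fix ys assume ys: "ys \<in> BW D ?m" and last: "\<forall>b'. last_rec ys n b' \<longrightarrow> allowed b' b"
    then have "\<forall>zs z. ys = zs @ [(n, z)] \<longrightarrow> z \<le> x" using order unfolding last_rec_def by blast
    then have "ys @ [(n, x)] \<in> biwords m"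
      using biwords_snoc_iff[of m n ys x] n x ys by (auto simp: BW_def)
    then show "ys @ [(n, x)] \<in> BW E m" using ys D(2) by (simp add: BW_def)
    show "last_rec (ys @ [(n, x)]) n b" using ys D(4) by (auto simp: last_rec_def BW_def)
    show "g" if "last_grew (ys @ [(n, x)])" using that ys D(3) by (simp add: last_grew_def BW_def)
    show "last_grew (ys @ [(n, x)])" if g using that ys D(3) by (simp add: last_grew_def BW_def)
  qed
  have inv: "butlast xs \<in> ?A \<and> butlast xs @ [(n, x)] = xs" if "xs \<in> ?B" for xs
  proof -
    have "last_rec xs n b" using that by blast
    then obtain ys x' where xs: "xs = ys @ [(n, x')]" and bx: "box (ins_word (map snd ys)) (enat x') = b"
      unfolding last_rec_def by blast
    let ?D = "ins_word (map snd ys)"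
    have B: "xs \<in> BW E m" using that by simp
    have x': "1 \<le> x'" using BW_letters[OF B] xs by auto
    have "valid ?D 0 (enat x')"
      using BW_letters[OF B] xs by (intro valid_insw) auto
    moreover have "ins ?D (enat x') = ins D (enat x)" using B xs D(2) by (simp add: BW_def)
    moreover have "grew ?D (enat x') = grew D (enat x)" using that xs D(3) by (simp add: last_grew_def)
    moreover have "box ?D (enat x') = box D (enat x)" using bx D(4) by simp
    ultimately have eq: "?D = D" "x' = x" using ins_record_inj[OF _ D(1)] by (metis, metis enat.inject)
    have "ys @ [(n, x)] \<in> biwords m" using B xs eq by (simp add: BW_def)
    then have "ys \<in> biwords ?m" and le: "\<And>zs z. ys = zs @ [(n, z)] \<Longrightarrow> z \<le> x"
      using biwords_snoc_iff[of m n ys x] n by blast+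
    then have ys: "ys \<in> BW D ?m" using eq by (simp add: BW_def)
    moreover have "allowed b' b" if "last_rec ys n b'" for b'
      using that order[OF _ _ ys] le unfolding last_rec_def by blast
    ultimately show ?thesis using xs eq by simp
  qed
  then show "\<forall>xs\<in>?B. butlast xs @ [(n, x)] = xs" and "butlast ` ?B \<subseteq> ?A"
    by blast+
qed

text \<open>The refinement by last records is what the induction needs, as it counts the objects
  that a given record may extend. Finiteness is carried along because \<open>card\<close> is 0 on
  infinite sets.\<close>

definition balanced :: "mat \<Rightarrow> (nat \<Rightarrow> nat) \<Rightarrow> bool" where
  "balanced E m \<longleftrightarrow> finite (WT E m) \<and> finite (BW E m) \<and> card (WT E m) = card (BW E m) \<and>
     (\<forall>n b. (\<forall>k>n. m k = 0) \<longrightarrow>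
        card {T \<in> WT E m. last_box T n b} = card {xs \<in> BW E m. last_rec xs n b})"

lemma balanced_allowed:
  assumes D: "sym_incr D" and bal: "balanced D m" and n: "\<forall>k>n. m k = 0"
  shows "card {T \<in> WT D m. \<forall>b'. last_box T n b' \<longrightarrow> P b'} =
    card {ys \<in> BW D m. \<forall>b'. last_rec ys n b' \<longrightarrow> P b'}"
proof -
  have fin: "finite (WT D m)" "finite (BW D m)" using bal by (auto simp: balanced_def)
  have "card {T \<in> WT D m. \<forall>b'. last_box T n b' \<longrightarrow> P b'} =
      card (WT D m) - (\<Sum>b\<in>{b\<in>support D. \<not> P b}. card {T \<in> WT D m. last_box T n b})"
    using WT_last_corner[OF D _ n] corner_support last_box_unique
    by (intro card_functional fin finite_support D) blast+
  also have "\<dots> = card (BW D m) - (\<Sum>b\<in>{b\<in>support D. \<not> P b}. card {ys \<in> BW D m. last_rec ys n b})"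
  proof -
    have "card {T \<in> WT D m. last_box T n b} = card {ys \<in> BW D m. last_rec ys n b}" for b
      using bal n unfolding balanced_def by blast
    then show ?thesis using bal by (simp add: balanced_def)
  qed
  also have "\<dots> = card {ys \<in> BW D m. \<forall>b'. last_rec ys n b' \<longrightarrow> P b'}"
    using BW_last_corner corner_support last_rec_unique
    by (intro card_functional[symmetric] fin finite_support D) blast+
  finally show ?thesis .
qed

text \<open>Each corner and each flag leads to its own matrix \<open>D\<close>, of which the tableau
  side sees only the shape. This is why the induction hypothesis ranges over all matrices.\<close>

lemma balanced_step:
  assumes E: "sym_incr E" and n: "1 \<le> n" "m n \<noteq> 0" "\<forall>k>n. m k = 0"
    and IH: "\<And>D. sym_incr D \<Longrightarrow> balanced D (m(n := m n - 1))"
  shows "balanced E m"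
proof -
  let ?m = "m(n := m n - 1)"
  let ?W = "\<lambda>b g. {T \<in> WT E m. last_box T n b \<and> (T (tab_box b) = {#ltr n b#} \<longleftrightarrow> g)}"
  let ?B = "\<lambda>b g. {xs \<in> BW E m. last_rec xs n b \<and> (last_grew xs \<longleftrightarrow> g)}"
  have n': "\<forall>k>n. ?m k = 0" using n(3) by simp
  have one: "finite (?W b g) \<and> finite (?B b g) \<and> card (?W b g) = card (?B b g)" for b g
  proof (cases "corner E b")
    case True
    obtain D y where y: "valid D 0 y" "ins D y = E" "grew D y = g" "box D y = b"
      using ins_record_ex[OF E True] by blast
    then obtain x where yx: "y = enat x" using validD(3)[OF y(1)] by (cases y) simp_all
    have D: "sym_incr D" by (rule validD(1)[OF y(1)])
    note W = WT_step_bij[OF E True D _ n, of g]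
    note B = BW_step_bij[OF y[unfolded yx] n]
    have up: "upset D = (if g then upset E - {tab_box b} else upset E)"
      using ins_record_upset[OF y(1)] y by simp
    have fin: "finite (WT D ?m)" "finite (BW D ?m)" using IH[OF D] by (auto simp: balanced_def)
    show ?thesis
      using bij_betw_finite[OF W[OF up]] bij_betw_finite[OF B] bij_betw_same_card[OF W[OF up]]
        bij_betw_same_card[OF B] balanced_allowed[where m = ?m, OF D IH[OF D] n', of "\<lambda>b'. allowed b' b"] fin
      by simp
  next
    case False
    have w: "?W b g = {}" using WT_last_corner[OF E _ n(3)] False by blast
    have b: "?B b g = {}" using BW_last_corner False by blast
    show ?thesis unfolding w b by simp
  qed
  have split: "card {T \<in> WT E m. last_box T n b} = card {xs \<in> BW E m. last_rec xs n b}
      \<and> finite {T \<in> WT E m. last_box T n b} \<and> finite {xs \<in> BW E m. last_rec xs n b}" for b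
  proof -
    have "{T \<in> WT E m. last_box T n b} = ?W b True \<union> ?W b False" by blast
    moreover have "{xs \<in> BW E m. last_rec xs n b} = ?B b True \<union> ?B b False" by blast
    moreover have "card (?W b True \<union> ?W b False) = card (?W b True) + card (?W b False)"
      using one by (intro card_Un_disjoint) blast+
    moreover have "card (?B b True \<union> ?B b False) = card (?B b True) + card (?B b False)"
      using one by (intro card_Un_disjoint) blast+
    ultimately show ?thesis using one[of b True] one[of b False] by simp
  qed
  have totW: "\<exists>b. last_box T n b" if "T \<in> WT E m" for T using WT_last_ex[OF E that n(2)] .
  have totB: "\<exists>b. last_rec xs n b" if "xs \<in> BW E m" for xs
    using that biwords_last_ex[OF _ n(2,3)] unfolding last_rec_def BW_def by (metis (mono_tags, lifting) mem_Collect_eq)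
  have "WT E m \<subseteq> (\<Union>b\<in>support E. {T \<in> WT E m. last_box T n b})"
  proof
    fix T assume T: "T \<in> WT E m"
    with totW obtain b where b: "last_box T n b" by blast
    then have "b \<in> support E" using WT_last_corner[OF E T n(3)] corner_support by blast
    then show "T \<in> (\<Union>b\<in>support E. {T \<in> WT E m. last_box T n b})" using T b by blast
  qed
  then have finW: "finite (WT E m)" using split finite_support[OF E] by (meson finite_UN finite_subset)
  have "BW E m \<subseteq> (\<Union>b\<in>support E. {xs \<in> BW E m. last_rec xs n b})"
  proof
    fix xs assume xs: "xs \<in> BW E m"
    with totB obtain b where b: "last_rec xs n b" by blast
    then have "b \<in> support E" using BW_last_corner[OF xs] corner_support by blast
    then show "xs \<in> (\<Union>b\<in>support E. {xs \<in> BW E m. last_rec xs n b})" using xs b by blast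
  qed
  then have finB: "finite (BW E m)" using split finite_support[OF E] by (meson finite_UN finite_subset)
  have "card (WT E m) = (\<Sum>b\<in>support E. card {T \<in> WT E m. last_box T n b})"
    using WT_last_corner[OF E _ n(3)] corner_support last_box_unique totW
    by (intro card_total_functional finW finite_support E) blast+
  also have "\<dots> = (\<Sum>b\<in>support E. card {xs \<in> BW E m. last_rec xs n b})"
    using split by simp
  also have "\<dots> = card (BW E m)"
    using BW_last_corner corner_support last_rec_unique totB
    by (intro card_total_functional[symmetric] finB finite_support E) blast+
  finally have card: "card (WT E m) = card (BW E m)" .
  have "card {T \<in> WT E m. last_box T k b} = card {xs \<in> BW E m. last_rec xs k b}"
    if k: "\<forall>i>k. m i = 0" for k b
  proof (cases "k = n")
    case True
    then show ?thesis using split by simp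
  next
    case False
    then have "n < k" using k n(2) by (metis linorder_neqE_nat)
    then have mk: "m k = 0" using n(3) by blast
    have "\<not> last_box T k b" if T: "T \<in> WT E m" for T
    proof
      assume "last_box T k b"
      then have "ltr k b \<in># T (tab_box b)" by (simp add: last_box_def occ_def)
      then show False using wts_label[OF E, of T "ltr k b" "tab_box b"] T mk by (simp add: WT_def ltr_def)
    qed
    moreover have "\<not> last_rec xs k b" if xs: "xs \<in> BW E m" for xs
      using xs biwords_content[of xs m "(k, _)"] mk by (force simp: last_rec_def BW_def)
    ultimately have e: "{T \<in> WT E m. last_box T k b} = {}" "{xs \<in> BW E m. last_rec xs k b} = {}"
      by blast+
    show ?thesis unfolding e by simp
  qed
  then show ?thesis using finW finB card by (simp add: balanced_def)
qed

lemma sm_empty: "sym_incr (\<lambda>_ _. \<infinity>)"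
  by (simp add: sym_incr_def)

lemma upset_empty_iff: "sym_incr E \<Longrightarrow> upset E = {} \<longleftrightarrow> E = (\<lambda>_ _. \<infinity>)"
proof
  assume E: "sym_incr E" and u: "upset E = {}"
  show "E = (\<lambda>_ _. \<infinity>)"
  proof (intro ext)
    fix i j
    show "E i j = \<infinity>" using u sm_sym[OF E, of i j] by (cases "i \<le> j") (auto simp: upset_def)
  qed
qed (simp add: upset_def)

lemma balanced_zero:
  assumes "sym_incr E"
  shows "balanced E (\<lambda>_. 0)"
proof -
  have bw: "biwords (\<lambda>_. 0) = {[]}"
  proof (intro equalityI subsetI)
    fix xs assume "xs \<in> biwords (\<lambda>_. 0)"
    then show "xs \<in> {[]}" using biwords_content[of xs "\<lambda>_. 0"] by (cases xs) auto
  qed (simp add: biwords_def)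
  have none: "T = (\<lambda>_. {#}) \<and> upset E = {}" if "T \<in> WT E (\<lambda>_. 0)" for T
  proof -
    have "\<not> a \<in># T b" for a b using wts_label[OF assms, of T a b] that by (auto simp: WT_def)
    then have T: "T b = {#}" for b by (meson multiset_nonemptyE)
    then have "upset E = {}" using wsv_empty_iff[OF assms, of T] that by (auto simp: WT_def)
    then show ?thesis using T by blast
  qed
  have zero: "(\<lambda>_. {#}) \<in> WT E (\<lambda>_. 0)" if "upset E = {}"
    using that by (simp add: WT_def wsv_def wts_def fun_eq_iff)
  have W: "WT E (\<lambda>_. 0) = (if upset E = {} then {\<lambda>_. {#}} else {})"
    using none zero by auto
  have B: "BW E (\<lambda>_. 0) = (if upset E = {} then {[]} else {})"
    using upset_empty_iff[OF assms] by (auto simp: BW_def bw)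
  have "\<not> last_box (\<lambda>_. {#}) n b" "\<not> last_rec [] n b" for n b
    by (auto simp: last_box_def occ_def last_rec_def)
  then have e: "{T \<in> WT E (\<lambda>_. 0). last_box T n b} = {}" "{xs \<in> BW E (\<lambda>_. 0). last_rec xs n b} = {}" for n b
    unfolding W B by auto
  show ?thesis unfolding balanced_def e by (simp add: W B)
qed

text \<open>Labels start at 1 on both sides, so both sets are empty.\<close>

lemma balanced_label_zero:
  assumes "sym_incr E" "m 0 \<noteq> 0"
  shows "balanced E m"
proof -
  have "WT E m = {}"
  proof (rule ccontr)
    assume "WT E m \<noteq> {}"
    then obtain T b where T: "T \<in> WT E m" "last_box T 0 b" using WT_last_ex[of E _ m 0] assms by blast
    then have "ltr 0 b \<in># T (tab_box b)" "wsv (upset E) T" by (auto simp: last_box_def occ_def WT_def)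
    then show False using wsv_label[OF assms(1), of T "ltr 0 b" "tab_box b"] by (simp add: ltr_def)
  qed
  moreover have "BW E m = {}"
  proof (rule ccontr)
    assume "BW E m \<noteq> {}"
    then obtain xs where xs: "xs \<in> biwords m" by (auto simp: BW_def)
    then have "length (filter (\<lambda>p. fst p = 0) xs) \<noteq> 0" using assms(2) by (simp add: biwords_def)
    then show False using xs by (force simp: biwords_def filter_empty_conv)
  qed
  ultimately show ?thesis by (simp add: balanced_def)
qed

theorem balanced_all:
  assumes "sym_incr E" "finite {i. m i \<noteq> 0}"
  shows "balanced E m"
  using assms
proof (induction "\<Sum>i\<in>{i. m i \<noteq> 0}. m i" arbitrary: E m rule: less_induct)
  case less
  show ?case
  proof (cases "m = (\<lambda>_. 0) \<or> m 0 \<noteq> 0")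
    case True
    then show ?thesis using balanced_zero balanced_label_zero less.prems by blast
  next
    case False
    let ?A = "{i. m i \<noteq> 0}"
    define n where "n = Max ?A"
    have "?A \<noteq> {}" using False by auto
    then have nA: "n \<in> ?A" unfolding n_def using less.prems(2) by (rule Max_in[rotated])
    then have n: "m n \<noteq> 0" "1 \<le> n" using False by (auto simp: Suc_le_eq intro: gr0I)
    have max: "\<forall>k>n. m k = 0"
      using Max_ge[OF less.prems(2)] by (force simp: n_def)
    let ?m = "m(n := m n - 1)"
    have sub: "{i. ?m i \<noteq> 0} \<subseteq> ?A" by auto
    have "(\<Sum>i\<in>{i. ?m i \<noteq> 0}. ?m i) = (\<Sum>i\<in>?A. ?m i)"
      using sub less.prems(2) by (intro sum.mono_neutral_left) auto
    also have "\<dots> < (\<Sum>i\<in>?A. m i)"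
      using less.prems(2) n(1) nA by (intro sum_strict_mono_ex1) auto
    finally have "balanced D ?m" if "sym_incr D" for D
      using less.hyps[of ?m D] that finite_subset[OF sub less.prems(2)] by blast
    then show ?thesis using balanced_step[of E n m] less.prems(1) n max by blast
  qed
qed

subsection \<open>Reading words of regions\<close>

definition line :: "mat \<Rightarrow> nat \<Rightarrow> nat list \<Rightarrow> nat list" where
  "line M r js = map (\<lambda>j. the_enat (M r j)) (filter (\<lambda>j. M r j \<noteq> \<infinity>) js)"

definition row_reading :: "mat \<Rightarrow> nat \<Rightarrow> nat \<Rightarrow> nat \<Rightarrow> nat \<Rightarrow> nat list" where
  "row_reading M r0 r1 c0 c1 = concat (map (\<lambda>r. line M r [max r c0..<c1]) (rev [r0..<r1]))"

text \<open>Column \<open>c\<close> of the tableau is row \<open>c\<close> of the matrix up to the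
  diagonal, whence \<open>min r1 (Suc c)\<close>. It is read upwards.\<close>

definition col_reading :: "mat \<Rightarrow> nat \<Rightarrow> nat \<Rightarrow> nat \<Rightarrow> nat \<Rightarrow> nat list" where
  "col_reading M r0 r1 c0 c1 = concat (map (\<lambda>c. rev (line M c [r0..<min r1 (Suc c)])) [c0..<c1])"

definition oword :: "enat \<Rightarrow> nat list" where
  "oword x = (if x = \<infinity> then [] else [the_enat x])"

lemma oword_simps [simp]: "oword \<infinity> = []" "oword (enat a) = [a]" "rev (oword x) = oword x"
  by (auto simp: oword_def)

lemma line_append [simp]: "line M r (xs @ ys) = line M r xs @ line M r ys"
  and line_Nil [simp]: "line M r [] = []"
  and line_Cons: "line M r (j # js) = (if M r j = \<infinity> then line M r js else the_enat (M r j) # line M r js)"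
  by (auto simp: line_def)

lemma line_cong: "(\<And>j. j \<in> set js \<Longrightarrow> M r j = M' r' j) \<Longrightarrow> line M r js = line M' r' js"
  unfolding line_def by (induction js) auto

lemma in_line: "v \<in> set (line M r js) \<longleftrightarrow> (\<exists>j\<in>set js. M r j = enat v)"
proof
  show "v \<in> set (line M r js)" if "\<exists>j\<in>set js. M r j = enat v"
    using that unfolding line_def by force
  assume "v \<in> set (line M r js)"
  then obtain j where "j \<in> set js" "M r j \<noteq> \<infinity>" "v = the_enat (M r j)" by (auto simp: line_def)
  then show "\<exists>j\<in>set js. M r j = enat v" by (cases "M r j") auto
qed

lemma upt_append: "a \<le> j \<Longrightarrow> j \<le> b \<Longrightarrow> [a..<j] @ [j..<b] = [a..<b]"
  using upt_add_eq_append[of a j "b - j"] by simp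

lemma upt_split_at: "a \<le> j \<Longrightarrow> j < b \<Longrightarrow> [a..<b] = [a..<j] @ j # [Suc j..<b]"
  by (metis less_imp_le_nat upt_append upt_conv_Cons)

lemma line_inf:
  assumes "sym_incr M" "M r a = \<infinity>"
  shows "line M r [a..<b] = []"
proof -
  have "M r j = \<infinity>" if "a \<le> j" for j using sm_inf[OF assms] that by blast
  then show ?thesis by (simp add: line_def filter_empty_conv)
qed

lemma line_sorted: "sym_incr M \<Longrightarrow> sorted_wrt (<) (line M r [a..<b])"
proof -
  assume M: "sym_incr M"
  have "sorted_wrt (<) (filter (\<lambda>j. M r j \<noteq> \<infinity>) [a..<b])"
    by (intro sorted_wrt_filter) simp
  then have "sorted_wrt (\<lambda>i j. the_enat (M r i) < the_enat (M r j)) (filter (\<lambda>j. M r j \<noteq> \<infinity>) [a..<b])"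
  proof (rule sorted_wrt_mono_rel[rotated])
    fix i j assume "i \<in> set (filter (\<lambda>j. M r j \<noteq> \<infinity>) [a..<b])" "j \<in> set (filter (\<lambda>j. M r j \<noteq> \<infinity>) [a..<b])" "i < j"
    then show "the_enat (M r i) < the_enat (M r j)"
      using sm_less[OF M, of i j r] by (cases "M r i"; cases "M r j") auto
  qed
  then show ?thesis by (simp add: line_def sorted_wrt_map)
qed

lemma line_at:
  assumes "a \<le> j" "j < b" "M r j = enat y"
  shows "line M r [a..<b] = line M r [a..<j] @ y # line M r [Suc j..<b]"
  using assms by (simp add: upt_split_at line_Cons)

lemma line_snoc:
  assumes "a \<le> i" "M r i = enat y"
  shows "line M r [a..<Suc i] = line M r [a..<i] @ [y]"
  using assms by (simp add: line_Cons)

lemma kk_set: "u \<simeq> v \<Longrightarrow> set u = set v"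
  by (induction rule: kknuth.induct) auto

text \<open>The segment \<open>Q\<close> of the row above is consulted only if the replacement fails
  because of the upper neighbour and not already because of the left one; \<open>nf'\<close> then
  makes it contain the two columns used by \<open>kk_two_rows_keep\<close>. The bounds are left free
  so that the lemma serves for rows and, after reversal, for columns.\<close>

lemma line_step:
  assumes v: "valid M k (enat a)" and j: "j = pos M k (enat a)" "lo \<le> j" "j < hi"
    and nf: "\<not> fits M k j (enat a) \<Longrightarrow> lo < j"
    and nf': "\<And>k' i. k = Suc k' \<Longrightarrow> j = Suc i \<Longrightarrow> M k i \<noteq> enat a \<Longrightarrow>
        M k' j = enat a \<Longrightarrow> lo < j \<Longrightarrow> lo' \<le> i \<and> j < hi'"
    and Q: "Q = (case k of 0 \<Rightarrow> [] | Suc k' \<Rightarrow> line M k' [lo'..<hi'])"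
  shows "line M k [lo..<hi] @ a # Q \<simeq>
    oword (out M k (enat a)) @ line (bump_mat M k (enat a)) k [lo..<hi] @ Q"
proof -
  note M = validD[OF v]
  let ?M' = "bump_mat M k (enat a)" and ?y = "out M k (enat a)"
  let ?g = "line M k [lo..<j]" and ?d = "line M k [Suc j..<hi]"
  have yj: "M k j = ?y" by (simp add: out_def j(1))
  have ay: "enat a < ?y" by (rule out_gt[OF M(1,3)])
  have fin: "line M k [lo..<hi] = ?g @ oword ?y @ ?d"
  proof (cases ?y)
    case (enat b)
    then show ?thesis using line_at[OF j(2,3), of M k b] yj by simp
  next
    case infinity
    then have "line M k [j..<hi] = []" "?d = []"
      using line_inf[OF M(1), of k j hi] line_inf[OF M(1), of k "Suc j" hi] yj
        sm_inf[OF M(1), of k j k "Suc j"] by auto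
    then show ?thesis using infinity upt_split_at[OF j(2,3)] upt_conv_Cons[OF j(3)] by simp
  qed
  show ?thesis
  proof (cases "fits M k j (enat a)")
    case True
    then have M': "?M' = upd M k j (enat a)" using j(1) by (simp add: bump_mat_def)
    have same: "?M' k c = M k c" if "c \<noteq> j" for c using that M' by (auto simp: upd_def)
    have line': "line ?M' k [lo..<hi] = ?g @ a # ?d"
    proof -
      have "line ?M' k [lo..<hi] = line ?M' k [lo..<j] @ a # line ?M' k [Suc j..<hi]"
        using M' by (intro line_at j) simp
      moreover have "line ?M' k [lo..<j] = ?g" by (intro line_cong same) auto
      moreover have "line ?M' k [Suc j..<hi] = ?d" by (intro line_cong same) auto
      ultimately show ?thesis by simp
    qed
    have "sym_incr ?M'" by (rule sm_stepm[OF v])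
    then have s': "sorted_wrt (<) (?g @ a # ?d)" using line_sorted line' by metis
    show ?thesis
    proof (cases ?y)
      case (enat b)
      then have s: "sorted_wrt (<) (?g @ b # ?d)" using line_sorted[OF M(1), of k lo hi] fin by simp
      have "a < b" using ay enat by simp
      from kk_append_right[OF kk_row_replace[OF s' s this], of Q] show ?thesis
        using fin line' enat by simp
    next
      case infinity
      then have "?d = []" using line_inf[OF M(1), of k "Suc j" hi] yj sm_inf[OF M(1), of k j k "Suc j"]
        by simp
      then show ?thesis using fin line' infinity by simp
    qed
  next
    case False
    then have M': "?M' = M" using j(1) by (simp add: bump_mat_def)
    have lt: "lo < j" by (rule nf[OF False])
    then obtain i where i: "j = Suc i" "lo \<le> i" by (cases j) auto
    have left: ?thesis if "M k i = enat a"
    proof -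
      have g: "?g = line M k [lo..<i] @ [a]" using line_snoc[of lo i M k a] i that by simp
      show ?thesis
      proof (cases ?y)
        case (enat b)
        then have "sorted_wrt (<) (line M k [lo..<i] @ a # b # ?d)"
          using line_sorted[OF M(1), of k lo hi] fin g by simp
        from kk_append_right[OF kk_row_keep[OF this], of Q] show ?thesis
          using fin M' enat g by simp
      next
        case infinity
        then have "?d = []" using line_inf[OF M(1), of k "Suc j" hi] yj sm_inf[OF M(1), of k j k "Suc j"]
          by simp
        then show ?thesis
          using kk_ctx[OF kk_idem[of a], of "line M k [lo..<i]" Q] fin M' infinity g by simp
      qed
    qed
    show ?thesis
    proof (cases "M k i = enat a")
      case ne: False
      then obtain k' where k': "k = Suc k'" "M k' (Suc i) = enat a" "M k i \<le> enat a"
        using not_fits_cases[OF v False[unfolded j(1)]] i(1) j(1) by (metis Suc_inject)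
      then obtain q where q: "M k i = enat q" "q < a" using ne by (cases "M k i") auto
      have lo': "lo' \<le> i" "Suc i < hi'" using nf'[OF k'(1) i(1) ne _ lt] k'(2) i by auto
      have "M k' i < M k i" using sm_less'[OF M(1), of k' k i] sm_inf[OF M(1), of k' i k i] k'(1) q(1) by auto
      then obtain p where p: "M k' i = enat p" "p < q" using q(1) by (cases "M k' i") auto
      have g: "?g = line M k [lo..<i] @ [q]" using line_snoc[of lo i M k q] i q by simp
      have Q': "Q = line M k' [lo'..<i] @ p # a # line M k' [Suc (Suc i)..<hi']"
        using Q k' lo' line_at[of lo' i hi' M k' p] line_at[of "Suc i" "Suc i" hi' M k' a] p(1) by simp
      have sQ: "sorted_wrt (<) (line M k' [lo'..<i] @ p # a # line M k' [Suc (Suc i)..<hi'])"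
        using line_sorted[OF M(1), of k' lo' hi'] Q Q' k'(1) by simp
      show ?thesis
      proof (cases ?y)
        case (enat b)
        then have "sorted_wrt (<) (line M k [lo..<i] @ q # b # ?d)"
          using line_sorted[OF M(1), of k lo hi] fin g by simp
        moreover have "a < b" using ay enat by simp
        ultimately show ?thesis
          using kk_two_rows_keep[of "line M k [lo..<i]" q b ?d "line M k' [lo'..<i]" p a]
            fin M' enat g Q' sQ p(2) q(2) by simp
      next
        case infinity
        then have "?d = []" using line_inf[OF M(1), of k "Suc j" hi] yj sm_inf[OF M(1), of k j k "Suc j"]
          by simp
        then show ?thesis
          using kk_append_left[OF kk_exchange_above[OF sQ p(2) q(2)], of "line M k [lo..<i]"]
            fin M' infinity g Q' by simp
      qed
    qed (rule left)
  qed
qed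

lemma kk_incr_past_decr:
  assumes "sorted_wrt (<) (ts @ [t])" "sorted_wrt (>) (cs @ [t])"
  shows "ts @ cs @ [t] \<simeq> cs @ ts @ [t]"
proof -
  have "sorted_wrt (>) (rev (ts @ [t]))" "sorted_wrt (<) (rev (cs @ [t]))"
    using assms unfolding sorted_wrt_rev by simp_all
  then have "t # rev cs @ rev ts \<simeq> t # rev ts @ rev cs"
    by (intro kk_decr_past_incr) simp_all
  from kk_rev[OF this] show ?thesis by simp
qed

lemma CWd_empty [simp]: "c1 \<le> c0 \<Longrightarrow> col_reading M r0 r1 c0 c1 = []"
  and RWd_empty [simp]: "r1 \<le> r0 \<Longrightarrow> row_reading M r0 r1 c0 c1 = []"
  by (simp_all add: col_reading_def row_reading_def)

lemma CWd_split: "c0 \<le> c \<Longrightarrow> c \<le> c1 \<Longrightarrow> col_reading M r0 r1 c0 c1 = col_reading M r0 r1 c0 c @ col_reading M r0 r1 c c1"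
  using upt_append[of c0 c c1] by (simp add: col_reading_def flip: map_append concat_append)

lemma RWd_split: "r0 \<le> r \<Longrightarrow> r \<le> r1 \<Longrightarrow> row_reading M r0 r1 c0 c1 = row_reading M r r1 c0 c1 @ row_reading M r0 r c0 c1"
proof -
  assume "r0 \<le> r" "r \<le> r1"
  then have "rev [r0..<r1] = rev [r..<r1] @ rev [r0..<r]" using upt_append[of r0 r r1] rev_append by metis
  then show ?thesis by (simp add: row_reading_def)
qed

lemma CWd_snoc: "c0 \<le> c \<Longrightarrow> col_reading M r0 r1 c0 (Suc c) = col_reading M r0 r1 c0 c @ rev (line M c [r0..<min r1 (Suc c)])"
  by (simp add: col_reading_def)

lemma RWd_bottom: "r0 < r1 \<Longrightarrow> row_reading M r0 r1 c0 c1 = row_reading M (Suc r0) r1 c0 c1 @ line M r0 [max r0 c0..<c1]"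
  using RWd_split[of r0 "Suc r0" r1 M c0 c1] by (simp add: row_reading_def)

text \<open>Columns are added one at a time. A column read upwards ends with its top entry
  \<open>t\<close>, which also ends the top row so far, so \<open>kk_incr_past_decr\<close>
  exchanges the rest of the row with the rest of the column.\<close>

lemma CWd_peel:
  assumes M: "sym_incr M" and r: "r0 < r1"
  shows "col_reading M r0 r1 c0 c1 \<simeq> col_reading M (Suc r0) r1 c0 c1 @ line M r0 [max r0 c0..<c1]"
proof (induction c1)
  case (Suc c)
  show ?case
  proof (cases "c0 \<le> c")
    case c0: True
    let ?W = "col_reading M (Suc r0) r1 c0 c" and ?ts = "line M r0 [max r0 c0..<c]"
    let ?h = "min r1 (Suc c)"
    let ?C = "rev (line M c [Suc r0..<?h])"
    have L: "col_reading M r0 r1 c0 (Suc c) = col_reading M r0 r1 c0 c @ rev (line M c [r0..<?h])"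
      and R: "col_reading M (Suc r0) r1 c0 (Suc c) = ?W @ ?C"
      using c0 by (simp_all add: CWd_snoc)
    have IH: "col_reading M r0 r1 c0 (Suc c) \<simeq> ?W @ ?ts @ rev (line M c [r0..<?h])"
      using kk_append_right[OF Suc.IH] L by simp
    show ?thesis
    proof (cases "r0 \<le> c")
      case True
      then have h: "r0 < ?h" using r by simp
      have ts: "line M r0 [max r0 c0..<Suc c] = ?ts @ oword (M r0 c)"
        using True c0 by (simp add: line_Cons oword_def)
      show ?thesis
      proof (cases "M r0 c")
        case infinity
        then have inf: "M c r0 = \<infinity>" using sm_sym[OF M] by simp
        then have "line M c [r0..<?h] = []" "?C = []"
          using line_inf[OF M inf] line_inf[OF M, of c "Suc r0"] sm_inf[OF M inf, of c "Suc r0"] by simp_all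
        then show ?thesis using IH R ts infinity by simp
      next
        case (enat t)
        then have t: "M c r0 = enat t" using sm_sym[OF M, of c r0] by simp
        have line: "line M c [r0..<?h] = t # line M c [Suc r0..<?h]"
          using line_at[of r0 r0 ?h M c t] h t by simp
        have "sorted_wrt (<) (?ts @ [t])"
          using line_sorted[OF M, of r0 "max r0 c0" "Suc c"] ts enat by simp
        moreover have "sorted_wrt (>) (?C @ [t])"
          using line_sorted[OF M, of c r0 ?h] line sorted_wrt_rev[of "(>)" "line M c [r0..<?h]"] by simp
        ultimately have "?ts @ ?C @ [t] \<simeq> ?C @ ?ts @ [t]" by (rule kk_incr_past_decr)
        then have "?W @ ?ts @ ?C @ [t] \<simeq> ?W @ ?C @ ?ts @ [t]" by (rule kk_append_left)
        moreover have "col_reading M r0 r1 c0 (Suc c) \<simeq> ?W @ ?ts @ ?C @ [t]" using IH by (simp add: line)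
        ultimately have "col_reading M r0 r1 c0 (Suc c) \<simeq> ?W @ ?C @ ?ts @ [t]" by (rule kk_trans[rotated])
        then show ?thesis using R ts enat by simp
      qed
    qed (use IH R in simp)
  qed simp
qed simp

lemma rows_cols:
  assumes M: "sym_incr M"
  shows "row_reading M r0 r1 c0 c1 \<simeq> col_reading M r0 r1 c0 c1"
proof (induction "r1 - r0" arbitrary: r0)
  case 0
  then have e: "rev (line M c [r0..<min r1 (Suc c)]) = []" for c by simp
  have "concat (map (\<lambda>_. []) cs) = []" for cs :: "nat list" by (induction cs) auto
  then have "col_reading M r0 r1 c0 c1 = []" unfolding col_reading_def e by blast
  then show ?case using 0 by simp
next
  case (Suc n)
  then have r: "r0 < r1" and n: "n = r1 - Suc r0" by auto
  have "row_reading M r0 r1 c0 c1 = row_reading M (Suc r0) r1 c0 c1 @ line M r0 [max r0 c0..<c1]"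
    by (rule RWd_bottom[OF r])
  also have "\<dots> \<simeq> col_reading M (Suc r0) r1 c0 c1 @ line M r0 [max r0 c0..<c1]"
    by (intro kk_append_right Suc.hyps(1)[OF n])
  also have "\<dots> \<simeq> col_reading M r0 r1 c0 c1" by (rule kk_sym[OF CWd_peel[OF M r]])
  finally show ?case .
qed

lemma in_RWd: "v \<in> set (row_reading M r0 r1 c0 c1) \<longleftrightarrow>
    (\<exists>r c. r0 \<le> r \<and> r < r1 \<and> r \<le> c \<and> c0 \<le> c \<and> c < c1 \<and> M r c = enat v)"
  by (force simp: row_reading_def in_line)

lemma in_CWd: "sym_incr M \<Longrightarrow> v \<in> set (col_reading M r0 r1 c0 c1) \<longleftrightarrow>
    (\<exists>r c. r0 \<le> r \<and> r < r1 \<and> r \<le> c \<and> c0 \<le> c \<and> c < c1 \<and> M r c = enat v)"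
  using kk_set[OF rows_cols] in_RWd by metis

section \<open>Commuting a shifted tableau with a decreasing word\<close>

text \<open>The first column consists of the diagonal entry alone, so reading by columns puts
  \<open>s\<close> in front, and \<open>rows_cols\<close> carries this back to the rows.\<close>

lemma diag_first:
  assumes M: "sym_incr M" and k: "k < n" "M k k = enat s"
  shows "row_reading M (Suc k) n (Suc k) n @ s # line M k [Suc k..<n] \<simeq>
         s # row_reading M (Suc k) n (Suc k) n @ line M k [Suc k..<n]"
    and "row_reading M k n k n = row_reading M (Suc k) n (Suc k) n @ s # line M k [Suc k..<n]"
proof -
  have lk: "line M k [k..<n] = s # line M k [Suc k..<n]"
    using line_at[of k k n M k s] k by simp
  have tail: "row_reading M (Suc k) n k n = row_reading M (Suc k) n (Suc k) n"
    unfolding row_reading_def by (intro arg_cong[where f = concat] map_cong) (auto simp: max_def)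
  show split: "row_reading M k n k n = row_reading M (Suc k) n (Suc k) n @ s # line M k [Suc k..<n]"
    using RWd_bottom[OF k(1), of M k n] lk tail by simp
  have "row_reading M k n k n \<simeq> col_reading M k n k n" by (rule rows_cols[OF M])
  also have "col_reading M k n k n = s # col_reading M k n (Suc k) n"
    using CWd_split[of k "Suc k" n M k n] k line_at[of k k "Suc k" M k s] by (simp add: col_reading_def)
  also have "\<dots> \<simeq> s # row_reading M k n (Suc k) n" by (intro kk_Cons kk_sym[OF rows_cols[OF M]])
  also have "row_reading M k n (Suc k) n = row_reading M (Suc k) n (Suc k) n @ line M k [Suc k..<n]"
    using RWd_bottom[OF k(1), of M "Suc k" n] by simp
  finally show "row_reading M (Suc k) n (Suc k) n @ s # line M k [Suc k..<n] \<simeq>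
         s # row_reading M (Suc k) n (Suc k) n @ line M k [Suc k..<n]"
    using split by simp
qed

lemma RWd_inf:
  assumes "sym_incr M" "M k k = \<infinity>"
  shows "row_reading M k n c0 n = []"
proof -
  have "M r c = \<infinity>" if "k \<le> r" "r \<le> c" for r c using sm_inf[OF assms, of r c] that by simp
  then have "v \<notin> set (row_reading M k n c0 n)" for v by (auto simp: in_RWd)
  then show ?thesis by (metis last_in_set)
qed

text \<open>A top row of one box leaves nothing below it, so that apart from the empty tableau and a
  single box the top row has a second letter \<open>t\<close> above \<open>s\<close>.\<close>

lemma shifted_cases:
  assumes M: "sym_incr M"
  obtains "row_reading M k n k n = []"
  | s where "k < n" "row_reading M k n k n = [s]" "M k k = enat s"
  | s t ss where "k < n" "row_reading M k n k n = row_reading M (Suc k) n (Suc k) n @ s # t # ss"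
      "row_reading M (Suc k) n (Suc k) n @ s # t # ss \<simeq> s # row_reading M (Suc k) n (Suc k) n @ t # ss"
      "sorted_wrt (<) (s # t # ss)" "M k k = enat s"
proof -
  consider "n \<le> k \<or> M k k = \<infinity>" | s where "k < n" "M k k = enat s"
    by (cases "n \<le> k"; cases "M k k") auto
  then show thesis
  proof cases
    case 1
    then have "row_reading M k n k n = []" using RWd_inf[OF M] by auto
    then show thesis by (rule that(1))
  next
    case (2 s)
    note d = diag_first[OF M 2]
    show thesis
    proof (cases "line M k [Suc k..<n]")
      case Nil
      have "row_reading M (Suc k) n (Suc k) n = []"
      proof (cases "Suc k < n")
        case True
        then have "M k (Suc k) = \<infinity>"
          using Nil line_at[of "Suc k" "Suc k" n M k] by (cases "M k (Suc k)") auto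
        then have "M (Suc k) (Suc k) = \<infinity>" using sm_inf[OF M, of k "Suc k" "Suc k" "Suc k"] by simp
        then show ?thesis using RWd_inf[OF M] by blast
      qed simp
      then show thesis using that(2)[of s] 2 d Nil by simp
    next
      case (Cons t ss)
      have "sorted_wrt (<) (s # t # ss)"
        using line_sorted[OF M, of k k n] line_at[of k k n M k s] 2 Cons by simp
      then show thesis using that(3)[of s t ss] 2 d Cons by simp
    qed
  qed
qed

text \<open>The first letter of the top row joins the decreasing word, which is then ready to pass the lower rows.\<close>

lemma shifted_past_decr:
  assumes M: "sym_incr M"
  shows "sorted_wrt (>) ds \<Longrightarrow> (\<forall>d\<in>set ds. \<forall>v\<in>set (row_reading M k n k n). d < v) \<Longrightarrow>
    kequiv (row_reading M k n k n @ ds @ u) (ds @ row_reading M k n k n @ u)"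
proof (induction "n - k" arbitrary: k ds u rule: less_induct)
  case less
  from M show ?case
  proof (cases rule: shifted_cases[where k = k and n = n])
    case (2 s)
    then show ?thesis using kequiv_decr_front[of s ds u] less.prems by simp
  next
    case (3 s t ss)
    let ?V = "row_reading M (Suc k) n (Suc k) n"
    have ds: "\<forall>d\<in>set ds. d < s" "\<forall>d\<in>set ds. \<forall>v\<in>set ?V. d < v" using less.prems(2) 3(2) by auto
    have sV: "s < v" if "v \<in> set ?V" for v
    proof -
      obtain r c where "Suc k \<le> r" "r \<le> c" "M r c = enat v" using \<open>v \<in> set ?V\<close> by (auto simp: in_RWd)
      moreover then have "M k k < M r c"
        using sm_less'[OF M, of k r k] sm_le[OF M, of k c r] 3(5)
        by (metis Suc_le_lessD enat.distinct(1) le_trans nat_less_le order.strict_trans2)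
      ultimately show ?thesis using 3(5) by simp
    qed
    have "row_reading M k n k n @ ds @ u = ?V @ (s # (t # ss) @ ds) @ u" using 3(2) by simp
    also have "\<dots> \<simeq> ?V @ (s # ds @ (t # ss)) @ u"
      using ds 3(4) less.prems(1) by (intro kk_ctx kk_decr_past_incr) auto
    also have "\<dots> = ?V @ (s # ds) @ (t # ss) @ u" by simp
    also have "kequiv (?V @ (s # ds) @ (t # ss) @ u) ((s # ds) @ ?V @ (t # ss) @ u)"
      using 3(1) ds sV less.prems(1) by (intro less.hyps) auto
    also have "(s # ds) @ ?V @ (t # ss) @ u = s # ds @ ?V @ (t # ss) @ u" by simp
    also have "kequiv (s # ds @ ?V @ (t # ss) @ u) (ds @ s # ?V @ (t # ss) @ u)"
      using ds less.prems(1) by (intro kequiv_decr_front) auto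
    also have "ds @ s # ?V @ (t # ss) @ u = ds @ (s # ?V @ t # ss) @ u" by simp
    also have "\<dots> \<simeq> ds @ row_reading M k n k n @ u"
      unfolding 3(2) by (intro kk_ctx kk_sym[OF 3(3)])
    finally show ?thesis .
  qed simp
qed


subsection \<open>Staircases\<close>

text \<open>The columns \<open>k, \<dots>, n - 1\<close> of the rows \<open>k, \<dots>, n - 1\<close> form a full staircase when the last
  diagonal entry is finite.\<close>

lemma stair_fin: "sym_incr E \<Longrightarrow> 0 < n \<Longrightarrow> E (n - 1) (n - 1) \<noteq> \<infinity> \<Longrightarrow> r < n \<Longrightarrow> c < n \<Longrightarrow> E r c \<noteq> \<infinity>"
proof
  assume a: "sym_incr E" "0 < n" "E (n - 1) (n - 1) \<noteq> \<infinity>" "r < n" "c < n" "E r c = \<infinity>"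
  then have "r \<le> n - 1" "c \<le> n - 1" by linarith+
  then show False using sm_inf[OF a(1,6)] a(3) by blast
qed

text \<open>Each \<open>y\<close> of the upper row is parked directly behind the larger
  \<open>p\<close> below it, which removes it from the way of \<open>s\<close>. After the remaining
  pairs have been treated it returns behind \<open>ps\<close>.\<close>

lemma kk_large_past_pair:
  assumes "sorted_wrt (<) ps" "sorted_wrt (<) ys" "list_all2 (<) ys ps" "\<forall>p\<in>set ps. p < s"
  shows "ps @ s # ys \<simeq> ps @ ys @ [s]"
  using assms(3,1,2,4)
proof (induction rule: list_all2_induct)
  case (Cons y ys p ps)
  have s: "sorted_wrt (<) (p # ps @ [s])" using Cons.prems by (auto simp: sorted_wrt_append)
  have "(p # ps @ [s]) @ [y] \<simeq> p # y # ps @ [s]"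
    using kk_decr_past_incr[of p "ps @ [s]" "[y]"] s Cons.hyps by simp
  from kk_append_right[OF this, of ys] have "p # ps @ s # y # ys \<simeq> p # y # ps @ s # ys" by simp
  also have "\<dots> \<simeq> p # y # ps @ ys @ [s]"
    using Cons.IH Cons.prems by (intro kk_Cons) auto
  also have "\<dots> \<simeq> p # ps @ y # ys @ [s]"
    using kk_append_right[OF kk_sym[OF kk_decr_past_incr[of p ps "[y]"]], of "ys @ [s]"]
      Cons.prems Cons.hyps by simp
  finally show ?case by simp
qed simp

lemma line_full:
  assumes "\<And>j. j \<in> set js \<Longrightarrow> M r j \<noteq> \<infinity>"
  shows "line M r js = map (\<lambda>j. the_enat (M r j)) js"
  unfolding line_def using assms by simp

text \<open>For a single box this is the exchange at the front. In general \<open>s\<close> passes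
  the lower rows by induction, and the diagonal entry \<open>x\<close> of row \<open>k\<close> is
  moved to the front for a while, so that \<open>s\<close> can pass the rest of that row right
  behind the row below, as \<open>kk_large_past_pair\<close> requires. The staircase is full because
  there every such box needs one below it.\<close>

lemma stair_pass:
  assumes E: "sym_incr E" and fin: "0 < n \<Longrightarrow> E (n - 1) (n - 1) \<noteq> \<infinity>"
  shows "\<forall>v\<in>set (row_reading E k n k n). v < s \<Longrightarrow> kequiv (s # row_reading E k n k n @ u) (row_reading E k n k n @ s # u)"
proof (induction "n - k" arbitrary: k u rule: less_induct)
  case less
  show ?case
  proof (cases "k < n")
    case True
    let ?U = "row_reading E (Suc k) n (Suc k) n" and ?Y = "line E k [Suc k..<n]"
    have f: "E r c \<noteq> \<infinity>" if "r < n" "c < n" for r c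
      using stair_fin[OF E _ fin] that True by simp
    obtain x where x: "E k k = enat x" using f[OF True True] by (cases "E k k") auto
    note d = diag_first[OF E True x]
    have sU: "v < s" if "v \<in> set ?U" for v using less.prems that d(2) by auto
    have xs: "x < s" and Ys: "\<forall>v\<in>set ?Y. v < s" using less.prems d(2) by auto
    have xU: "\<forall>d\<in>set [x]. \<forall>v\<in>set ?U. d < v"
    proof clarsimp
      fix v assume "v \<in> set ?U"
      then obtain r c where rc: "Suc k \<le> r" "r \<le> c" "E r c = enat v" by (auto simp: in_RWd)
      have "E k k < E r k" using rc x by (intro sm_less'[OF E]) auto
      also have "\<dots> \<le> E r c" using rc by (intro sm_le[OF E]) auto
      finally show "x < v" using rc x by simp
    qed
    have "s # row_reading E k n k n @ u = s # ?U @ x # ?Y @ u" using d(2) by simp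
    also have "kequiv \<dots> (?U @ s # x # ?Y @ u)"
      using True sU by (intro less.hyps) auto
    also have "kequiv (?U @ s # x # ?Y @ u) (?U @ x # ?Y @ s # u)"
    proof (cases "Suc k < n")
      case False
      then have "?U = []" "?Y = []" by auto
      then show ?thesis using kequiv_swap[of s x u] xs by simp
    next
      case k: True
      let ?P = "line E (Suc k) [Suc k..<n]" and ?U2 = "row_reading E (Suc (Suc k)) n (Suc k) n"
      have U: "?U = ?U2 @ ?P" using RWd_bottom[OF k] by simp
      have P: "?P = map (\<lambda>j. the_enat (E (Suc k) j)) [Suc k..<n]"
        using k f by (intro line_full) auto
      have Y: "?Y = map (\<lambda>j. the_enat (E k j)) [Suc k..<n]"
        using True f by (intro line_full) auto
      have YP: "list_all2 (<) ?Y ?P"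
        unfolding P Y list_all2_map1 list_all2_map2
      proof (rule list.rel_refl_strong)
        fix j assume "j \<in> set [Suc k..<n]"
        then have "E k j < E (Suc k) j" "E (Suc k) j \<noteq> \<infinity>"
          using f[of k j] f[of "Suc k" j] k sm_less'[OF E, of k "Suc k" j] by auto
        then show "the_enat (E k j) < the_enat (E (Suc k) j)"
          by (cases "E k j"; cases "E (Suc k) j") auto
      qed
      have Ps: "\<forall>p\<in>set ?P. p < s" using sU U by auto
      obtain p ps where pP: "?P = p # ps" using P k by (cases ?P) (auto simp: upt_conv_Cons)
      have xp: "x < p" using xU U pP by auto
      have sP: "sorted_wrt (<) (?P @ [s])"
        using line_sorted[OF E, of "Suc k" "Suc k" n] Ps by (auto simp: sorted_wrt_append)
      have sx: "?P @ [s, x] \<simeq> ?P @ [x, s]"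
      proof -
        have "p # ps @ [s] @ [x] \<simeq> p # [x] @ ps @ [s]"
          using kk_decr_past_incr[of p "ps @ [s]" "[x]"] sP pP xp by simp
        also have "\<dots> \<simeq> p # ps @ [x] @ [s]"
          using kk_append_right[OF kk_sym[OF kk_decr_past_incr[of p ps "[x]"]], of "[s]"] sP pP xp
          by (simp add: sorted_wrt_append)
        finally show ?thesis using pP by simp
      qed
      have "?U @ s # x # ?Y @ u \<simeq> ?U @ [x] @ s # ?Y @ u"
        using kk_ctx[OF sx, of ?U2 "?Y @ u"] U by simp
      also have "kequiv (?U @ [x] @ s # ?Y @ u) ([x] @ ?U @ s # ?Y @ u)"
        by (rule shifted_past_decr[OF E _ xU]) simp
      also have "[x] @ ?U @ s # ?Y @ u \<simeq> [x] @ ?U @ ?Y @ s # u"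
        using kk_ctx[OF kk_large_past_pair[OF line_sorted[OF E] line_sorted[OF E] YP Ps], of "[x] @ ?U2" u] U
        by simp
      also have "kequiv ([x] @ ?U @ ?Y @ s # u) (?U @ [x] @ ?Y @ s # u)"
        by (rule kequiv_sym[OF shifted_past_decr[OF E _ xU]]) simp
      finally show ?thesis by simp
    qed
    finally show ?thesis using d(2) by simp
  qed simp
qed

lemma stair_pass_cols:
  assumes E: "sym_incr E" and fin: "0 < n \<Longrightarrow> E (n - 1) (n - 1) \<noteq> \<infinity>"
    and s: "\<forall>v\<in>set (col_reading E 0 n 0 n). v < s"
  shows "kequiv (s # col_reading E 0 n 0 n @ u) (col_reading E 0 n 0 n @ s # u)"
proof -
  have rc: "row_reading E 0 n 0 n \<simeq> col_reading E 0 n 0 n" by (rule rows_cols[OF E])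
  have "s # col_reading E 0 n 0 n @ u \<simeq> s # row_reading E 0 n 0 n @ u"
    by (intro kk_Cons kk_append_right kk_sym[OF rc])
  also have "kequiv (s # row_reading E 0 n 0 n @ u) (row_reading E 0 n 0 n @ s # u)"
    using s kk_set[OF rc] by (intro stair_pass[OF E fin]) auto
  also have "row_reading E 0 n 0 n @ s # u \<simeq> col_reading E 0 n 0 n @ s # u"
    by (intro kk_append_right rc)
  finally show ?thesis .
qed

text \<open>\<open>C\<close> is read upwards: its first \<open>n + 1\<close> letters are the entries
  of column \<open>n\<close> in the rows from \<open>n\<close> up to 0, and the inequality lets them
  enlarge the staircase of size \<open>n\<close>. There may be more letters because \<open>C\<close>
  grows at the front in \<open>shifted_past_col\<close>.\<close>

definition extends :: "mat \<Rightarrow> nat \<Rightarrow> nat list \<Rightarrow> bool" where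
  "extends E n C \<longleftrightarrow> sorted_wrt (>) C \<and> n < length C \<and> (\<forall>r<n. E r (n - 1) < enat (C ! (n - r))) \<and>
     (\<forall>c\<in>set C. 0 < c)"

lemma extends_hd: "extends E n C \<Longrightarrow> C ! 0 \<in> set C"
  by (cases C) (auto simp: extends_def)

lemma extends_Cons:
  assumes "extends E n C" "\<forall>c\<in>set C. c < s"
  shows "extends E n (s # C)"
proof -
  have "E r (n - 1) < enat ((s # C) ! (n - r))" if r: "r < n" for r
  proof -
    have "E r (n - 1) < enat (C ! (n - r))" using assms(1) r by (simp add: extends_def)
    also have "C ! (n - r) < C ! (n - r - 1)"
    proof -
      have "n - r - 1 < n - r" "n - r < length C" using assms(1) r by (auto simp: extends_def)
      then show ?thesis
        using assms(1) sorted_wrt_nth_less[of "(>)" C "n - r - 1" "n - r"] by (simp add: extends_def)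
    qed
    finally show ?thesis using r by (simp add: nth_Cons')
  qed
  moreover have "0 < s"
  proof -
    have "C ! 0 \<in> set C" by (rule extends_hd[OF assms(1)])
    then show ?thesis using assms(2) by force
  qed
  ultimately show ?thesis using assms by (auto simp: extends_def)
qed

definition ext_col :: "mat \<Rightarrow> nat \<Rightarrow> nat list \<Rightarrow> mat" where
  "ext_col E n C = (\<lambda>r c. if r < n \<and> c < n then E r c
     else if r \<le> n \<and> c \<le> n then enat (C ! (n - min r c)) else \<infinity>)"

lemma ext_col_stair:
  assumes E: "sym_incr E" and C: "extends E n C"
  shows "sym_incr (ext_col E n C)" "ext_col E n C n n \<noteq> \<infinity>"
    "col_reading (ext_col E n C) 0 (Suc n) 0 (Suc n) = col_reading E 0 n 0 n @ take (Suc n) C"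
proof -
  let ?F = "ext_col E n C"
  have dec: "C ! j < C ! i" if "i < j" "j \<le> n" for i j
    using C that sorted_wrt_nth_less[of "(>)" C i j] by (simp add: extends_def)
  have up: "E r (n - 1) < enat (C ! (n - r))" if "r < n" for r using C that by (simp add: extends_def)
  have "?F i j < ?F i (Suc j)" if "?F i (Suc j) \<noteq> \<infinity>" for i j
  proof -
    have ij: "i \<le> n" "Suc j \<le> n" using that by (auto simp: ext_col_def split: if_splits)
    consider "i < n" "Suc j < n" | "i < n" "Suc j = n" | "i = n" using ij by linarith
    then show ?thesis
    proof cases
      case 1
      then show ?thesis using that sm_Suc[OF E, of i j] by (simp add: ext_col_def)
    next
      case 2
      then show ?thesis using up[of i] by (auto simp: ext_col_def min_def)
    next
      case 3
      then show ?thesis using dec[of "n - Suc j" "n - j"] ij by (auto simp: ext_col_def min_def)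
    qed
  qed
  moreover have "?F i j = ?F j i" for i j
    using sm_sym[OF E, of i j] by (auto simp: ext_col_def min.commute)
  moreover have "0 < ?F i j" for i j
  proof -
    have "0 < C ! (n - min i j)"
      using C by (auto simp: extends_def intro!: nth_mem)
    then show ?thesis using sm_pos[OF E, of i j] by (simp add: ext_col_def zero_enat_def)
  qed
  moreover have "\<forall>i j. Suc n \<le> j \<longrightarrow> ?F i j = \<infinity>" by (simp add: ext_col_def)
  ultimately show "sym_incr ?F" unfolding sym_incr_def by blast
  show "?F n n \<noteq> \<infinity>" by (simp add: ext_col_def)
  have "col_reading ?F 0 (Suc n) 0 n = col_reading E 0 n 0 n"
    unfolding col_reading_def
  proof (intro arg_cong[where f = concat] map_cong refl)
    fix c assume "c \<in> set [0..<n]"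
    then have "line ?F c [0..<Suc c] = line E c [0..<Suc c]"
      by (intro line_cong) (auto simp: ext_col_def)
    then show "rev (line ?F c [0..<min (Suc n) (Suc c)]) = rev (line E c [0..<min n (Suc c)])"
    proof -
      have "min (Suc n) (Suc c) = Suc c" "min n (Suc c) = Suc c" using \<open>c \<in> set [0..<n]\<close> by auto
      then show ?thesis using \<open>line ?F c [0..<Suc c] = line E c [0..<Suc c]\<close> by (simp only:)
    qed
  qed
  moreover have "rev (line ?F n [0..<Suc n]) = take (Suc n) C"
  proof -
    have "line ?F n [0..<Suc n] = map (\<lambda>j. C ! (n - j)) [0..<Suc n]"
      unfolding line_def by (subst filter_True) (auto simp: ext_col_def min_def)
    then show ?thesis
      using C by (intro nth_equalityI) (auto simp: extends_def rev_nth simp del: upt_Suc)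
  qed
  ultimately show "col_reading ?F 0 (Suc n) 0 (Suc n) = col_reading E 0 n 0 n @ take (Suc n) C"
    using CWd_snoc[of 0 n ?F 0 "Suc n"] by simp
qed

text \<open>The letter \<open>s\<close> goes out to the front through the staircase and comes back
  through the staircase enlarged by the first \<open>n + 1\<close> letters of \<open>C\<close>;
  \<open>stair_pass_cols\<close> covers both. The surplus letters of \<open>C\<close> are passed by
  the ordinary relation.\<close>

lemma stair_col_pass:
  assumes E: "sym_incr E" and fin: "0 < n \<Longrightarrow> E (n - 1) (n - 1) \<noteq> \<infinity>" and C: "extends E n C"
    and s: "\<forall>c\<in>set C. c < s"
  shows "kequiv (col_reading E 0 n 0 n @ s # C @ u) (col_reading E 0 n 0 n @ C @ s # u)"
proof -
  let ?A = "col_reading E 0 n 0 n" and ?C0 = "take (Suc n) C" and ?C1 = "drop (Suc n) C"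
  note F = ext_col_stair[OF E C]
  have A_lt: "v < C ! 0" if "v \<in> set ?A" for v
  proof -
    obtain r c where rc: "r < n" "r \<le> c" "c < n" "E r c = enat v" using \<open>v \<in> set ?A\<close> by (auto simp: in_CWd[OF E])
    have "r \<le> n - 1" "c \<le> n - 1" using rc by linarith+
    then have "E r c \<le> E (n - 1) (n - 1)"
      using rc sm_le[OF E, of c "n - 1" r] sm_le'[OF E, of r "n - 1" "n - 1"] by simp
    also have "n - 1 < n" using rc(1) by linarith
    then have "E (n - 1) (n - 1) < enat (C ! (n - (n - 1)))" using C unfolding extends_def by blast
    also have "C ! (n - (n - 1)) \<le> C ! 0"
      using C rc(1) sorted_wrt_nth_less[of "(>)" C 0 "n - (n - 1)"] by (simp add: extends_def)
    finally show ?thesis using rc(4) by simp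
  qed
  have C0: "C ! 0 < s" using extends_hd[OF C] s by blast
  have As: "\<forall>v\<in>set ?A. v < s" using A_lt C0 by fastforce
  have AC: "\<forall>v\<in>set (col_reading (ext_col E n C) 0 (Suc n) 0 (Suc n)). v < s"
    using As s F(3) by (auto dest: in_set_takeD)
  have "?A @ s # C @ u = ?A @ s # ?C0 @ ?C1 @ u" by simp
  also have "kequiv \<dots> (s # ?A @ ?C0 @ ?C1 @ u)"
    by (rule kequiv_sym[OF stair_pass_cols[OF E fin As]])
  also have "kequiv (s # ?A @ ?C0 @ ?C1 @ u) (?A @ ?C0 @ s # ?C1 @ u)"
    using stair_pass_cols[OF F(1) _ AC, of "?C1 @ u"] F(2,3) by simp
  also have "?A @ ?C0 @ s # ?C1 @ u \<simeq> ?A @ ?C0 @ ?C1 @ s # u"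
  proof -
    obtain d ds where d: "?C0 = ds @ [d]" using C by (cases ?C0 rule: rev_cases) (auto simp: extends_def)
    have "sorted_wrt (>) (ds @ d # ?C1)" using C d append_take_drop_id[of "Suc n" C]
      by (simp add: extends_def)
    moreover have "d < s" using s d by (metis in_set_conv_decomp in_set_takeD)
    ultimately have "d # [s] @ ?C1 \<simeq> d # ?C1 @ [s]"
      by (intro kk_decr_past_incr) (auto simp: sorted_wrt_append)
    from kk_ctx[OF this, of "?A @ ds" u] show ?thesis using d by simp
  qed
  finally have "kequiv (?A @ s # C @ u) (?A @ ?C0 @ ?C1 @ s # u)" .
  moreover have "?C0 @ ?C1 @ w = C @ w" for w by (metis append.assoc append_take_drop_id)
  ultimately show ?thesis by (simp only:)
qed

text \<open>The scheme of \<open>shifted_past_decr\<close>, with a staircase in front. The exchange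
  at the front of the word is out of reach, and \<open>stair_col_pass\<close> replaces it; it stays
  applicable because prepending \<open>s\<close> to \<open>C\<close> preserves
  \<open>extends\<close>.\<close>

lemma shifted_past_col:
  assumes E: "sym_incr E" and fin: "0 < n \<Longrightarrow> E (n - 1) (n - 1) \<noteq> \<infinity>" and F: "sym_incr F"
  shows "extends E n C \<Longrightarrow> (\<forall>c\<in>set C. \<forall>v\<in>set (row_reading F k b k b). c < v) \<Longrightarrow>
    kequiv (col_reading E 0 n 0 n @ row_reading F k b k b @ C @ u) (col_reading E 0 n 0 n @ C @ row_reading F k b k b @ u)"
proof (induction "b - k" arbitrary: k C u rule: less_induct)
  case less
  let ?A = "col_reading E 0 n 0 n"
  from F show ?case
  proof (cases rule: shifted_cases[where k = k and n = b])
    case (2 s)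
    then show ?thesis using stair_col_pass[OF E fin less.prems(1), of s u] less.prems(2) by simp
  next
    case (3 s t ss)
    let ?V = "row_reading F (Suc k) b (Suc k) b"
    have C: "\<forall>c\<in>set C. c < s" "\<forall>c\<in>set C. \<forall>v\<in>set ?V. c < v" using less.prems(2) 3(2) by auto
    have sV: "s < v" if "v \<in> set ?V" for v
    proof -
      obtain r c where rc: "Suc k \<le> r" "r \<le> c" "F r c = enat v" using \<open>v \<in> set ?V\<close> by (auto simp: in_RWd)
      have "F k k < F r k" using rc 3(5) by (intro sm_less'[OF F]) auto
      also have "\<dots> \<le> F r c" using rc by (intro sm_le[OF F]) auto
      finally show ?thesis using rc 3(5) by simp
    qed
    have sC: "extends E n (s # C)" by (rule extends_Cons[OF less.prems(1) C(1)])
    have dec: "sorted_wrt (>) (s # C)" using sC by (simp add: extends_def)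
    have "?A @ row_reading F k b k b @ C @ u = (?A @ ?V) @ (s # (t # ss) @ C) @ u" using 3(2) by simp
    also have "\<dots> \<simeq> (?A @ ?V) @ (s # C @ (t # ss)) @ u"
      using dec 3(4) by (intro kk_ctx kk_decr_past_incr)
    also have "\<dots> = ?A @ ?V @ (s # C) @ (t # ss) @ u" by simp
    also have "kequiv \<dots> (?A @ (s # C) @ ?V @ (t # ss) @ u)"
      using 3(1) C sV sC by (intro less.hyps) auto
    also have "?A @ (s # C) @ ?V @ (t # ss) @ u = ?A @ s # C @ ?V @ (t # ss) @ u" by simp
    also have "kequiv (?A @ s # C @ ?V @ (t # ss) @ u) (?A @ C @ s # ?V @ (t # ss) @ u)"
      by (rule stair_col_pass[OF E fin less.prems(1) C(1)])
    also have "?A @ C @ s # ?V @ (t # ss) @ u = (?A @ C) @ (s # ?V @ t # ss) @ u" by simp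
    also have "\<dots> \<simeq> (?A @ C) @ row_reading F k b k b @ u"
      unfolding 3(2) by (intro kk_ctx kk_sym[OF 3(3)])
    finally show ?thesis by simp
  qed simp
qed

text \<open>Induction on the size: the first \<open>n\<close> columns are passed, and the next one
  extends the staircase they form, so \<open>shifted_past_col\<close> applies.\<close>

lemma shifted_past_stair:
  assumes E: "sym_incr E" and F: "sym_incr F"
  shows "(0 < n \<Longrightarrow> E (n - 1) (n - 1) \<noteq> \<infinity>) \<Longrightarrow>
    (\<forall>c\<in>set (col_reading E 0 n 0 n). \<forall>v\<in>set (row_reading F 0 b 0 b). c < v) \<Longrightarrow>
    kequiv (row_reading F 0 b 0 b @ col_reading E 0 n 0 n @ u) (col_reading E 0 n 0 n @ row_reading F 0 b 0 b @ u)"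
proof (induction n arbitrary: u)
  case (Suc n)
  let ?V = "row_reading F 0 b 0 b" and ?A = "col_reading E 0 n 0 n" and ?C = "rev (line E n [0..<Suc n])"
  have f: "E r c \<noteq> \<infinity>" if "r \<le> n" "c \<le> n" for r c
    using Suc.prems(1) sm_inf[OF E, of r c n n] that by auto
  have A: "col_reading E 0 (Suc n) 0 n = ?A" unfolding col_reading_def
  proof (intro arg_cong[where f = concat] map_cong refl)
    fix c assume "c \<in> set [0..<n]"
    then have "min (Suc n) (Suc c) = min n (Suc c)" by auto
    then show "rev (line E c [0..<min (Suc n) (Suc c)]) = rev (line E c [0..<min n (Suc c)])" by (simp only:)
  qed
  have AC: "col_reading E 0 (Suc n) 0 (Suc n) = ?A @ ?C" using CWd_snoc[of 0 n E 0 "Suc n"] A by simp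
  have line: "line E n [0..<Suc n] = map (\<lambda>j. the_enat (E n j)) [0..<Suc n]"
    using f by (intro line_full) auto
  have "extends E n ?C"
    unfolding extends_def
  proof (intro conjI allI impI ballI)
    show "sorted_wrt (>) ?C" using line_sorted[OF E, of n 0 "Suc n"] by (simp add: sorted_wrt_rev del: upt_Suc)
    show "n < length ?C" by (simp add: line del: upt_Suc)
    fix r assume r: "r < n"
    have "?C ! (n - r) = the_enat (E n r)"
      using r by (simp add: line rev_nth del: upt_Suc)
    then have "enat (?C ! (n - r)) = E r n" using f[of n r] r sm_sym[OF E, of r n] by (cases "E n r") auto
    moreover have "E r (n - 1) < E r n" using r f[of r "n - 1"] by (intro sm_less[OF E]) auto
    ultimately show "E r (n - 1) < enat (?C ! (n - r))" by simp
  next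
    fix c assume "c \<in> set ?C"
    then obtain j where "E n j = enat c" by (auto simp: in_line)
    then show "0 < c" using sm_pos[OF E, of n j] by (simp add: zero_enat_def)
  qed
  note C = this
  have fin: "E (n - 1) (n - 1) \<noteq> \<infinity>" by (rule f) auto
  have lt: "\<forall>c\<in>set ?A. \<forall>v\<in>set ?V. c < v" "\<forall>c\<in>set ?C. \<forall>v\<in>set ?V. c < v"
    using Suc.prems(2) unfolding AC by auto
  have "?V @ col_reading E 0 (Suc n) 0 (Suc n) @ u = ?V @ ?A @ ?C @ u" using AC by simp
  also have "kequiv \<dots> (?A @ ?V @ ?C @ u)" by (rule Suc.IH[OF fin lt(1)])
  also have "kequiv (?A @ ?V @ ?C @ u) (?A @ ?C @ ?V @ u)"
    by (rule shifted_past_col[OF E fin F C lt(2)])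
  finally show ?case using AC by simp
qed simp


subsection \<open>Insertion preserves the weak class\<close>

definition bnd :: "nat \<Rightarrow> mat \<Rightarrow> bool" where
  "bnd B M \<longleftrightarrow> (\<forall>i j. B \<le> i \<or> B \<le> j \<longrightarrow> M i j = \<infinity>)"

text \<open>A state of the insertion as a word. In the row phase the letter is read right behind row
  \<open>k\<close>, which it enters next; in the column phase, in \<open>CWs\<close>, right before
  column \<open>k\<close>.\<close>

definition RWs :: "nat \<Rightarrow> nat \<Rightarrow> mat \<Rightarrow> enat \<Rightarrow> nat list" where
  "RWs b k M X = row_reading M k b 0 b @ oword X @ row_reading M 0 k 0 b"

definition CWs :: "nat \<Rightarrow> nat \<Rightarrow> mat \<Rightarrow> enat \<Rightarrow> nat list" where
  "CWs b k M X = col_reading M 0 b 0 k @ oword X @ col_reading M 0 b k b"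

lemma CWd_cong:
  assumes "\<And>c r. c0 \<le> c \<Longrightarrow> c < c1 \<Longrightarrow> r \<le> c \<Longrightarrow> M c r = M' c r"
  shows "col_reading M r0 r1 c0 c1 = col_reading M' r0 r1 c0 c1"
  unfolding col_reading_def
proof (intro arg_cong[where f = concat] map_cong refl arg_cong[where f = rev] line_cong)
  fix c j assume "c \<in> set [c0..<c1]" "j \<in> set [r0..<min r1 (Suc c)]"
  then show "M c j = M' c j" by (intro assms) auto
qed

lemma RWd_cong:
  assumes "\<And>c r. r0 \<le> r \<Longrightarrow> r < r1 \<Longrightarrow> r \<le> c \<Longrightarrow> M r c = M' r c"
  shows "row_reading M r0 r1 c0 c1 = row_reading M' r0 r1 c0 c1"
  unfolding row_reading_def
proof (intro arg_cong[where f = concat] map_cong refl line_cong)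
  fix r j assume "r \<in> set (rev [r0..<r1])" "j \<in> set [max r c0..<c1]"
  then show "M r j = M' r j" by (intro assms) auto
qed

lemma stepm_other:
  "\<not> (r = k \<and> c = pos M k x) \<Longrightarrow> \<not> (r = pos M k x \<and> c = k) \<Longrightarrow> bump_mat M k x r c = M r c"
  by (auto simp: bump_mat_def upd_def)

lemma row_phase_step:
  assumes v: "valid M k (enat a)" and B: "bnd B M" "k \<le> B" and j: "k < pos M k (enat a)"
  shows "RWs (Suc B) k M (enat a) \<simeq> RWs (Suc B) (Suc k) (bump_mat M k (enat a)) (out M k (enat a))"
proof -
  let ?b = "Suc B" and ?j = "pos M k (enat a)" and ?M' = "bump_mat M k (enat a)"
  \<comment> \<open>\<open>Q\<close> is the whole row above, read from its diagonal entry in column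
    \<open>k - 1\<close>.\<close>
  define Q where "Q = (case k of 0 \<Rightarrow> [] | Suc k' \<Rightarrow> line M k' [k - 1..<?b])"
  define Z where "Z = (case k of 0 \<Rightarrow> [] | Suc k' \<Rightarrow> row_reading M 0 k' 0 ?b)"
  have jB: "?j < ?b" using pos_le[of "enat a" M k B] B by (simp add: bnd_def)
  have Q: "row_reading M 0 k 0 ?b = Q @ Z"
    by (cases k) (simp_all add: Q_def Z_def row_reading_def)
  have kknuth: "line M k [k..<?b] @ a # Q \<simeq> oword (out M k (enat a)) @ line ?M' k [k..<?b] @ Q"
    using j jB by (intro line_step[OF v refl, where lo' = "k - 1" and hi' = ?b]) (auto simp: Q_def split: nat.splits)
  have other: "?M' r c = M r c" if "r \<noteq> k" "r \<le> c" for r c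
    using that j by (intro stepm_other) auto
  have R: "row_reading M k ?b 0 ?b = row_reading M (Suc k) ?b 0 ?b @ line M k [k..<?b]"
    using RWd_bottom[of k ?b M 0 ?b] B(2) by simp
  have "RWs ?b k M (enat a) = row_reading M (Suc k) ?b 0 ?b @ (line M k [k..<?b] @ a # Q) @ Z"
    using R Q by (simp add: RWs_def)
  also have "\<dots> \<simeq> row_reading M (Suc k) ?b 0 ?b @ (oword (out M k (enat a)) @ line ?M' k [k..<?b] @ Q) @ Z"
    by (rule kk_ctx[OF kknuth])
  also have "row_reading M (Suc k) ?b 0 ?b = row_reading ?M' (Suc k) ?b 0 ?b"
    using other by (intro RWd_cong) auto
  also have "(oword (out M k (enat a)) @ line ?M' k [k..<?b] @ Q) @ Z
      = oword (out M k (enat a)) @ row_reading ?M' 0 (Suc k) 0 ?b"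
  proof -
    have "row_reading M 0 k 0 ?b = row_reading ?M' 0 k 0 ?b" using other by (intro RWd_cong) auto
    then show ?thesis using Q by (simp add: row_reading_def)
  qed
  finally show ?thesis by (simp add: RWs_def)
qed

text \<open>\<open>line_step\<close> is applied to row \<open>k\<close> of the matrix up to the
  diagonal, that is, to column \<open>k\<close> of the tableau, and then reversed by
  \<open>kk_rev\<close>.\<close>

lemma col_phase_step:
  assumes v: "valid M k (enat a)" and B: "bnd B M" "k \<le> B" and j: "pos M k (enat a) \<le> k"
  shows "CWs (Suc B) k M (enat a) \<simeq> CWs (Suc B) (Suc k) (bump_mat M k (enat a)) (out M k (enat a))"
proof -
  let ?b = "Suc B" and ?j = "pos M k (enat a)" and ?M' = "bump_mat M k (enat a)"
  note M = validD(1)[OF v]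
  define Q where "Q = (case k of 0 \<Rightarrow> [] | Suc k' \<Rightarrow> line M k' [0..<k])"
  define Z where "Z = (case k of 0 \<Rightarrow> [] | Suc k' \<Rightarrow> col_reading M 0 ?b 0 k')"
  have Q: "col_reading M 0 ?b 0 k = Z @ rev Q"
    using B(2) CWd_snoc[of 0 "k - 1" M 0 ?b] by (cases k) (simp_all add: Q_def Z_def del: upt_Suc)
  have kknuth: "line M k [0..<Suc k] @ a # Q \<simeq> oword (out M k (enat a)) @ line ?M' k [0..<Suc k] @ Q"
  proof (rule line_step[OF v refl, where lo' = 0 and hi' = k])
    show "0 < ?j" if "\<not> fits M k ?j (enat a)" using valid_fits_0[OF v] that by (metis gr0I)
    \<comment> \<open>If the bumping position is on the diagonal, the left and upper neighbours are
      mirror images, so the left one already equals the letter.\<close>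
    show "0 \<le> i \<and> ?j < k" if "k = Suc k'" "?j = Suc i" "M k i \<noteq> enat a" "M k' ?j = enat a" for k' i
      using that j sm_sym[OF M, of k k'] by (cases "?j = k") auto
  qed (use j in \<open>auto simp: Q_def split: nat.splits\<close>)
  have other: "?M' c r = M c r" if "c \<noteq> k" "r \<le> c" for r c
    using that j by (intro stepm_other) auto
  have C: "col_reading N 0 ?b k ?b = rev (line N k [0..<Suc k]) @ col_reading N 0 ?b (Suc k) ?b" for N
    using CWd_split[of k "Suc k" ?b N 0 ?b] CWd_snoc[of k k N 0 ?b] B(2) by (simp del: upt_Suc)
  have C': "col_reading N 0 ?b 0 (Suc k) = col_reading N 0 ?b 0 k @ rev (line N k [0..<Suc k])" for N
    using CWd_snoc[of 0 k N 0 ?b] B(2) by (simp del: upt_Suc)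
  have "CWs ?b k M (enat a) = Z @ (rev Q @ a # rev (line M k [0..<Suc k])) @ col_reading M 0 ?b (Suc k) ?b"
    using C Q by (simp add: CWs_def del: upt_Suc)
  also have "rev Q @ a # rev (line M k [0..<Suc k]) = rev (line M k [0..<Suc k] @ a # Q)"
    by (simp del: upt_Suc)
  also have "Z @ rev (line M k [0..<Suc k] @ a # Q) @ col_reading M 0 ?b (Suc k) ?b
      \<simeq> Z @ rev (oword (out M k (enat a)) @ line ?M' k [0..<Suc k] @ Q) @ col_reading M 0 ?b (Suc k) ?b"
    by (rule kk_ctx[OF kk_rev[OF kknuth]])
  also have "col_reading M 0 ?b (Suc k) ?b = col_reading ?M' 0 ?b (Suc k) ?b"
    using other by (intro CWd_cong) auto
  also have "Z @ rev (oword (out M k (enat a)) @ line ?M' k [0..<Suc k] @ Q) @ col_reading ?M' 0 ?b (Suc k) ?b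
      = CWs ?b (Suc k) ?M' (out M k (enat a))"
  proof -
    have "col_reading M 0 ?b 0 k = col_reading ?M' 0 ?b 0 k" using other by (intro CWd_cong) auto
    then show ?thesis using Q C' by (simp add: CWs_def del: upt_Suc)
  qed
  finally show ?thesis .
qed

section \<open>From the row phase to the column phase\<close>

text \<open>Bumping paths move weakly to the left. Once a path is on or below the diagonal it stays
  there, so the column phase lasts to the end.\<close>

lemma pos_decreasing:
  assumes "valid D 0 x" "run_letter (Suc n) D x \<noteq> \<infinity>"
  shows "pos (run_mat (Suc n) D x) (Suc n) (run_letter (Suc n) D x) \<le> pos (run_mat n D x) n (run_letter n D x)"
proof -
  have fin: "run_letter n D x \<noteq> \<infinity>" using rx_Suc_inf[of n D x] assms(2) by metis
  have "vpos (run_mat (Suc n) D x) n (run_letter (Suc n) D x) (pos (run_mat n D x) n (run_letter n D x))"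
    using valid_step(1)[OF run_valid[OF assms(1) fin]] assms(2) by (simp add: rm_Suc[OF fin] rx_Suc[OF fin])
  then show ?thesis by (rule vpos_pos_le)
qed

lemma run_bnd: "valid D 0 x \<Longrightarrow> bnd B D \<Longrightarrow> n \<le> end_row D x \<Longrightarrow> bnd B (run_mat n D x)"
  using run_supp[of D x n] rx_fin_iff[of D x n] by (simp add: bnd_def)

lemma tn_bnd: "valid D 0 x \<Longrightarrow> bnd B D \<Longrightarrow> end_row D x \<le> B"
  unfolding end_row_def using run_bound[of D x B] by (intro Least_le) (simp add: bnd_def)

lemma col_phase:
  assumes D: "valid D 0 x" and B: "bnd B D" and i: "pos (run_mat i D x) i (run_letter i D x) \<le> i"
  shows "i \<le> n \<Longrightarrow> n \<le> Suc (end_row D x) \<Longrightarrow>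
    CWs (Suc B) i (run_mat i D x) (run_letter i D x) \<simeq> CWs (Suc B) n (run_mat n D x) (run_letter n D x) \<and>
    (n \<le> end_row D x \<longrightarrow> pos (run_mat n D x) n (run_letter n D x) \<le> n)"
proof (induction rule: dec_induct)
  case (step n)
  have fin: "run_letter n D x \<noteq> \<infinity>" using rx_fin_iff[OF D, of n] step.prems by simp
  then obtain a where a: "run_letter n D x = enat a" by (cases "run_letter n D x") auto
  have IH: "CWs (Suc B) i (run_mat i D x) (run_letter i D x) \<simeq> CWs (Suc B) n (run_mat n D x) (run_letter n D x)"
    "pos (run_mat n D x) n (run_letter n D x) \<le> n" using step by auto
  note IH(1)
  also have "CWs (Suc B) n (run_mat n D x) (run_letter n D x) \<simeq> CWs (Suc B) (Suc n) (run_mat (Suc n) D x) (run_letter (Suc n) D x)"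
    using col_phase_step[of "run_mat n D x" n a B] run_valid[OF D fin] run_bnd[OF D B, of n] tn_bnd[OF D B]
      IH(2) step.prems unfolding rm_Suc[OF fin] rx_Suc[OF fin] a by simp
  finally show ?case
    using pos_decreasing[OF D, of n] IH(2) rx_fin_iff[OF D, of "Suc n"] by auto
qed (use i in simp)

lemma CWs_inf [simp]: "k \<le> b \<Longrightarrow> CWs b k M \<infinity> = col_reading M 0 b 0 b"
  and RWs_inf [simp]: "k \<le> b \<Longrightarrow> RWs b k M \<infinity> = row_reading M 0 b 0 b"
  using CWd_split[of 0 k b M 0 b] RWd_split[of 0 k b M 0 b] by (simp_all add: CWs_def RWs_def)

text \<open>A letter below the first diagonal entry bumps it, so the column phase begins at once. In
  \<open>diag_switch\<close> this is applied to the rows and columns from \<open>k\<close>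
  on.\<close>

lemma col_phase_ins:
  assumes D: "valid D 0 (enat a)" and B: "bnd B D" and i: "enat a < D 0 0"
  shows "a # col_reading D 0 (Suc B) 0 (Suc B) \<simeq> col_reading (ins D (enat a)) 0 (Suc B) 0 (Suc B)"
proof -
  have "pos D 0 (enat a) = 0" using pos_le[of "enat a" D 0 0] i by simp
  then have "CWs (Suc B) 0 D (enat a) \<simeq>
      CWs (Suc B) (Suc (end_row D (enat a))) (ins D (enat a)) \<infinity>"
    using col_phase[OF D B, of 0 "Suc (end_row D (enat a))"] tn_inf[OF D] by (simp add: ins_def)
  moreover have "CWs (Suc B) 0 D (enat a) = a # col_reading D 0 (Suc B) 0 (Suc B)" by (simp add: CWs_def)
  ultimately show ?thesis using tn_bnd[OF D B] by simp
qed

definition shiftm :: "nat \<Rightarrow> mat \<Rightarrow> mat" where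
  "shiftm k M = (\<lambda>r c. M (r + k) (c + k))"

lemma sm_shiftm: "sym_incr M \<Longrightarrow> sym_incr (shiftm k M)"
proof -
  assume M: "sym_incr M"
  obtain B where B: "\<And>i j. B \<le> i \<or> B \<le> j \<Longrightarrow> M i j = \<infinity>" using sm_bound[OF M] by blast
  show ?thesis
    unfolding sym_incr_def
  proof (intro conjI allI impI exI[of _ B])
    fix i j
    show "shiftm k M i j = shiftm k M j i" using sm_sym[OF M, of "i + k" "j + k"] by (simp add: shiftm_def)
    show "0 < shiftm k M i j" using sm_pos[OF M] by (simp add: shiftm_def)
    show "shiftm k M i j < shiftm k M i (Suc j)" if "shiftm k M i (Suc j) \<noteq> \<infinity>"
      using that sm_Suc[OF M, of "i + k" "j + k"] by (simp add: shiftm_def)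
    show "shiftm k M i j = \<infinity>" if "B \<le> j" using B that by (simp add: shiftm_def)
  qed
qed

lemma RWd_shiftm:
  assumes "k \<le> b"
  shows "row_reading (shiftm k M) 0 (b - k) 0 (b - k) = row_reading M k b k b"
proof -
  have up: "map (\<lambda>r. r + k) [a..<b - k] = [a + k..<b]" for a
    using assms by (intro nth_equalityI) (auto simp: less_diff_conv)
  have line: "line (shiftm k M) r [max r 0..<b - k] = line M (r + k) [max (r + k) k..<b]" for r
  proof -
    have "line M (r + k) (map (\<lambda>j. j + k) js) = line (shiftm k M) r js" for js
      by (induction js) (simp_all add: line_Cons shiftm_def)
    from this[of "[r..<b - k]"] show ?thesis unfolding up by simp
  qed
  have "rev [k..<b] = map (\<lambda>r. r + k) (rev [0..<b - k])" using arg_cong[OF up[of 0], of rev] by (simp add: rev_map)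
  then show ?thesis unfolding row_reading_def line by (simp add: comp_def)
qed

text \<open>The letter bumped at the diagonal may be read in front of column \<open>k\<close> instead of between the
  rows: it first moves left past the rows below, these then absorb it and form a shifted tableau
  with larger letters than the staircase of the first \<open>k\<close> columns, hence commute with it.\<close>

lemma diag_switch:
  assumes M: "sym_incr M" and B: "bnd B M" "k \<le> B" and a0: "0 < a"
    and lo: "0 < k \<Longrightarrow> M (k - 1) (k - 1) < enat a" and hi: "enat a < M k k"
  shows "kequiv (RWs (Suc B) k M (enat a)) (CWs (Suc B) k M (enat a))"
proof -
  let ?b = "Suc B"
  let ?W = "row_reading M k ?b k ?b" and ?A = "col_reading M 0 k 0 k" and ?B' = "col_reading M 0 k k ?b"
  let ?S = "shiftm k M"
  let ?F = "ins ?S (enat a)"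
  let ?V = "row_reading ?F 0 (?b - k) 0 (?b - k)"
  have S: "sym_incr ?S" by (rule sm_shiftm[OF M])
  have vS: "valid ?S 0 (enat a)" using S a0 by (simp add: valid_def zero_enat_def)
  have bS: "bnd (B - k) ?S" using B by (auto simp: bnd_def shiftm_def)
  have b: "Suc (B - k) = ?b - k" using B(2) by simp
  have F: "sym_incr ?F" by (rule ins_sm[OF vS])
  have "a # ?W = a # row_reading ?S 0 (?b - k) 0 (?b - k)" using RWd_shiftm[of k ?b M] B(2) by simp
  also have "\<dots> \<simeq> a # col_reading ?S 0 (?b - k) 0 (?b - k)" by (intro kk_Cons rows_cols[OF S])
  also have "\<dots> \<simeq> col_reading ?F 0 (?b - k) 0 (?b - k)"
    using col_phase_ins[OF vS bS] hi b by (simp add: shiftm_def)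
  also have "\<dots> \<simeq> ?V" by (rule kk_sym[OF rows_cols[OF F]])
  finally have V: "a # ?W \<simeq> ?V" .
  have V0_gt: "a < v" if "v \<in> set ?W" for v
  proof -
    obtain r c where rc: "k \<le> r" "r \<le> c" "M r c = enat v" using \<open>v \<in> set ?W\<close> by (auto simp: in_RWd)
    have "M k k \<le> M r c"
      using rc sm_le'[OF M, of k r k] sm_le[OF M, of k c r] by simp
    then have "enat a < M r c" by (rule order.strict_trans2[OF hi])
    then show ?thesis using rc(3) by simp
  qed
  have A_lt: "v < a" if "v \<in> set ?A" for v
  proof -
    obtain r c where rc: "r < k" "c < k" "M r c = enat v" using \<open>v \<in> set ?A\<close> by (auto simp: in_CWd[OF M])
    have "r \<le> k - 1" "c \<le> k - 1" using rc by linarith+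
    then have "M r c \<le> M (k - 1) (k - 1)"
      using sm_le'[OF M, of r "k - 1" c] sm_le[OF M, of c "k - 1" "k - 1"] by simp
    also have "\<dots> < enat a" using lo rc(1) by simp
    finally show ?thesis using rc(3) by simp
  qed
  have fin: "M (k - 1) (k - 1) \<noteq> \<infinity>" if "0 < k" using enat_less_fin[OF lo[OF that]] .
  have AV: "\<forall>c\<in>set ?A. \<forall>v\<in>set ?V. c < v"
    using A_lt V0_gt kk_set[OF V] by fastforce
  have R1: "row_reading M k ?b 0 ?b = ?W"
    unfolding row_reading_def by (intro arg_cong[where f = concat] map_cong) (auto simp: max_def)
  have R2: "row_reading M 0 k 0 ?b \<simeq> ?A @ ?B'"
    using rows_cols[OF M, of 0 k 0 ?b] CWd_split[of 0 k ?b M 0 k] B(2) by simp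
  have A: "col_reading M 0 ?b 0 k = ?A"
    unfolding col_reading_def
  proof (intro arg_cong[where f = concat] map_cong refl)
    fix c assume "c \<in> set [0..<k]"
    then have "min ?b (Suc c) = min k (Suc c)" using B(2) by auto
    then show "rev (line M c [0..<min ?b (Suc c)]) = rev (line M c [0..<min k (Suc c)])" by (simp only:)
  qed
  have "RWs ?b k M (enat a) = ?W @ a # row_reading M 0 k 0 ?b" using R1 by (simp add: RWs_def)
  also have "\<dots> \<simeq> ?W @ a # ?A @ ?B'" by (intro kk_append_left kk_Cons R2)
  also have "\<dots> = ?W @ [a] @ ?A @ ?B'" by simp
  also have "kequiv \<dots> ([a] @ ?W @ ?A @ ?B')"
    using V0_gt by (intro shifted_past_decr[OF M]) auto
  also have "[a] @ ?W @ ?A @ ?B' = (a # ?W) @ ?A @ ?B'" by simp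
  also have "\<dots> \<simeq> ?V @ ?A @ ?B'" by (rule kk_append_right[OF V])
  also have "kequiv (?V @ ?A @ ?B') (?A @ ?V @ ?B')"
    by (rule shifted_past_stair[OF M F fin AV])
  also have "?A @ ?V @ ?B' \<simeq> ?A @ (a # ?W) @ ?B'" by (rule kk_ctx[OF kk_sym[OF V]])
  also have "\<dots> \<simeq> ?A @ (a # ?W) @ row_reading M 0 k k ?b"
    by (intro kk_append_left kk_sym[OF rows_cols[OF M]])
  also have "\<dots> = (?A @ [a]) @ row_reading M 0 ?b k ?b" using RWd_split[of 0 k ?b M k ?b] B(2) by simp
  also have "\<dots> \<simeq> (?A @ [a]) @ col_reading M 0 ?b k ?b" by (intro kk_append_left rows_cols[OF M])
  also have "\<dots> = CWs ?b k M (enat a)" using A by (simp add: CWs_def)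
  finally show ?thesis .
qed

text \<open>Row steps are used as long as the path is right of the diagonal,
  \<open>diag_switch\<close> at the first row \<open>k\<close> where it is not, and column steps
  from there.\<close>

theorem ins_kequiv:
  assumes D: "valid D 0 (enat a)" and B: "bnd B D"
  shows "kequiv (row_reading D 0 (Suc B) 0 (Suc B) @ [a]) (row_reading (ins D (enat a)) 0 (Suc B) 0 (Suc B))"
proof -
  let ?b = "Suc B" and ?x = "enat a"
  let ?W = "row_reading D 0 ?b 0 ?b @ [a]" and ?N = "end_row D ?x"
  let ?M = "\<lambda>n. run_mat n D ?x" and ?X = "\<lambda>n. run_letter n D ?x"
  let ?p = "\<lambda>n. pos (?M n) n (?X n)"
  have N: "?N \<le> B" by (rule tn_bnd[OF D B])
  have E: "?M (Suc ?N) = ins D ?x" "?X (Suc ?N) = \<infinity>" using tn_inf[OF D] by (simp_all add: ins_def)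
  have rows: "kequiv ?W (RWs ?b n (?M n) (?X n))" if "n \<le> Suc ?N" "\<forall>i<n. i < ?p i" for n
    using that
  proof (induction n)
    case (Suc n)
    have fin: "?X n \<noteq> \<infinity>" using rx_fin_iff[OF D, of n] Suc.prems by simp
    then obtain y where y: "?X n = enat y" by (cases "?X n") auto
    have pn: "n < pos (?M n) n (enat y)" using Suc.prems(2)[rule_format, of n] y by simp
    have "kequiv ?W (RWs ?b n (?M n) (?X n))" using Suc by simp
    also have "RWs ?b n (?M n) (?X n) \<simeq> RWs ?b (Suc n) (?M (Suc n)) (?X (Suc n))"
      using row_phase_step[of "?M n" n y B] run_valid[OF D fin] run_bnd[OF D B, of n] N Suc.prems(1) pn
      unfolding rm_Suc[OF fin] rx_Suc[OF fin] y by simp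
    finally show ?case .
  qed (simp add: RWs_def)
  show ?thesis
  proof (cases "\<forall>i<Suc ?N. i < ?p i")
    case True
    then show ?thesis using rows[of "Suc ?N"] E N by simp
  next
    case False
    define k where "k = (LEAST i. \<not> i < ?p i)"
    have k: "?p k \<le> k" "k \<le> ?N" and least: "\<forall>i<k. i < ?p i"
    proof -
      obtain i where i: "i < Suc ?N" "\<not> i < ?p i" using False by blast
      have "\<not> k < ?p k" unfolding k_def by (rule LeastI[of _ i]) (rule i(2))
      then show "?p k \<le> k" by simp
      have "k \<le> i" unfolding k_def by (rule Least_le) (rule i(2))
      then show "k \<le> ?N" using i(1) by simp
      show "\<forall>i<k. i < ?p i" unfolding k_def using not_less_Least by blast
    qed
    have fin: "?X k \<noteq> \<infinity>" using rx_fin_iff[OF D, of k] k by simp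
    then obtain y where y: "?X k = enat y" by (cases "?X k") auto
    have v: "valid (?M k) k (?X k)" by (rule run_valid[OF D fin])
    note Mk = validD(1)[OF v]
    have hi: "enat y < ?M k k k"
      using pos_gt[OF Mk fin, of k] sm_le[OF Mk k(1), of k] y by simp
    \<comment> \<open>The letter was bumped to the right of the diagonal in row
      \<open>k - 1\<close>, hence it is larger than the diagonal entry of that row.\<close>
    have lo: "?M k (k - 1) (k - 1) < enat y" if k0: "0 < k"
    proof -
      obtain k' where k': "k = Suc k'" using k0 by (cases k) auto
      have fin': "?X k' \<noteq> \<infinity>" using rx_Suc_inf[of k' D ?x] fin k' by metis
      have "vpos (?M k) k' (?X k) (?p k')"
        using valid_step(1)[OF run_valid[OF D fin']] fin k' by (simp add: rm_Suc[OF fin'] rx_Suc[OF fin'])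
      then have le: "?M k k' (?p k') \<le> enat y" using y by (simp add: vpos_def)
      have lt: "k' < ?p k'" using least k' by simp
      have "?M k k' k' \<noteq> \<infinity>"
        using enat_le_fin[OF le] sm_inf[OF Mk, of k' k' k' "?p k'"] lt by auto
      then have "?M k k' k' < ?M k k' (?p k')" by (intro sm_less[OF Mk] lt)
      then show ?thesis using le k' by simp
    qed
    have "kequiv ?W (RWs ?b k (?M k) (enat y))" using rows[of k] k(2) least y by simp
    also have "kequiv (RWs ?b k (?M k) (enat y)) (CWs ?b k (?M k) (enat y))"
      using validD(2)[OF v] y k(2) N
      by (intro diag_switch[OF Mk run_bnd[OF D B k(2)] _ _ lo hi]) (auto simp: zero_enat_def)
    also have "CWs ?b k (?M k) (enat y) \<simeq> CWs ?b (Suc ?N) (?M (Suc ?N)) (?X (Suc ?N))"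
      using col_phase[OF D B k(1), of "Suc ?N"] k(2) y by simp
    also have "\<dots> = col_reading (ins D ?x) 0 ?b 0 ?b" using E N by simp
    also have "\<dots> \<simeq> row_reading (ins D ?x) 0 ?b 0 ?b" by (rule kk_sym[OF rows_cols[OF ins_sm[OF D]]])
    finally show ?thesis .
  qed
qed

subsection \<open>Shifted tableaux as symmetric matrices\<close>

definition toD :: "tab \<Rightarrow> mat" where
  "toD T i j = (case T (min i j, max i j) of None \<Rightarrow> \<infinity> | Some a \<Rightarrow> enat a)"

definition fromD :: "mat \<Rightarrow> tab" where
  "fromD D = (\<lambda>(i, j). if i \<le> j \<and> D i j \<noteq> \<infinity> then Some (the_enat (D i j)) else None)"

definition tri :: "tab \<Rightarrow> bool" where
  "tri T \<longleftrightarrow> dom T \<subseteq> {(i, j). i \<le> j}"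

lemma toD_upper: "i \<le> j \<Longrightarrow> toD T i j = (case T (i, j) of None \<Rightarrow> \<infinity> | Some a \<Rightarrow> enat a)"
  by (simp add: toD_def min_def max_def)

lemma toD_sym: "toD T i j = toD T j i"
  by (simp add: toD_def min.commute max.commute)

lemma toD_enat_iff: "i \<le> j \<Longrightarrow> toD T i j = enat a \<longleftrightarrow> T (i, j) = Some a"
  and toD_inf_iff: "i \<le> j \<Longrightarrow> toD T i j = \<infinity> \<longleftrightarrow> T (i, j) = None"
  by (auto simp: toD_upper split: option.splits)

lemma triD: "tri T \<Longrightarrow> T (i, j) = Some a \<Longrightarrow> i \<le> j"
  by (auto simp: tri_def)

lemma tri_eqI:
  assumes "tri T" "tri T'" "toD T = toD T'"
  shows "T = T'"
proof
  fix p :: "nat \<times> nat"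
  obtain i j where p: "p = (i, j)" by force
  show "T p = T' p"
  proof (cases "i \<le> j")
    case True
    then show ?thesis using toD_upper[OF True, of T] toD_upper[OF True, of T'] assms(3) p
      by (auto split: option.splits)
  next
    case False
    then have "T (i, j) = None" "T' (i, j) = None" using assms triD[of T i j] triD[of T' i j] by fastforce+
    then show ?thesis using p by simp
  qed
qed

lemma tri_fromD: "tri (fromD D)"
  by (auto simp: tri_def fromD_def split: if_splits)

lemma toD_fromD: "sym_incr D \<Longrightarrow> toD (fromD D) = D"
proof (intro ext)
  fix i j assume D: "sym_incr D"
  show "toD (fromD D) i j = D i j"
    using sm_sym[OF D, of j i]
    by (cases "D i j") (auto simp: toD_def fromD_def min_def max_def split: if_splits)
qed

lemma dom_upset: "tri T \<Longrightarrow> dom T = upset (toD T)"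
  by (auto simp: upset_def tri_def toD_inf_iff)

lemma shifted_shape_iff: "(i, j) \<in> shifted_shape lam \<longleftrightarrow> i < length lam \<and> i \<le> j \<and> j < i + lam ! i"
  by (simp add: shifted_shape_def)

lemma finite_shifted_shape: "finite (shifted_shape lam)"
proof (rule finite_subset)
  show "shifted_shape lam \<subseteq> (SIGMA i:{..<length lam}. {..<i + lam ! i})"
    by (auto simp: shifted_shape_def)
qed auto

lemma strict_partition_nth:
  "strict_partition lam \<Longrightarrow> i < k \<Longrightarrow> k < length lam \<Longrightarrow> lam ! k < lam ! i"
  using sorted_wrt_nth_less[of "(>)" lam i k] by (simp add: strict_partition_def)

lemma strict_partition_pos: "strict_partition lam \<Longrightarrow> i < length lam \<Longrightarrow> 0 < lam ! i"
  by (metis gr0I nth_mem strict_partition_def)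

lemma shifted_shape_up:
  assumes "strict_partition lam" "(Suc i, j) \<in> shifted_shape lam"
  shows "(i, j) \<in> shifted_shape lam"
  using assms(2) strict_partition_nth[OF assms(1), of i "Suc i"] by (auto simp: shifted_shape_iff)

lemma shifted_shape_left:
  "(i, Suc j) \<in> shifted_shape lam \<Longrightarrow> i \<le> j \<Longrightarrow> (i, j) \<in> shifted_shape lam"
  by (auto simp: shifted_shape_iff)

lemma sm_of_shape:
  assumes lam: "strict_partition lam"
    and fin: "\<And>i j. i \<le> j \<Longrightarrow> D i j \<noteq> \<infinity> \<longleftrightarrow> (i, j) \<in> shifted_shape lam"
    and sym: "\<And>i j. D i j = D j i" and pos: "\<And>i j. 0 < D i j"
    and row: "\<And>i j. (i, j) \<in> shifted_shape lam \<Longrightarrow> (i, Suc j) \<in> shifted_shape lam \<Longrightarrow> D i j < D i (Suc j)"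
    and col: "\<And>i j. (i, j) \<in> shifted_shape lam \<Longrightarrow> (Suc i, j) \<in> shifted_shape lam \<Longrightarrow> D i j < D (Suc i) j"
  shows "sym_incr D"
proof -
  have "D i j < D i (Suc j)" if "D i (Suc j) \<noteq> \<infinity>" for i j
  proof (cases "i \<le> j")
    case True
    then have "(i, Suc j) \<in> shifted_shape lam" using that fin[of i "Suc j"] by simp
    then show ?thesis using row shifted_shape_left True by blast
  next
    case False
    then have "(Suc j, i) \<in> shifted_shape lam" using that fin[of "Suc j" i] sym[of i "Suc j"] by simp
    then show ?thesis using col[of j i] shifted_shape_up[OF lam] sym[of i] by simp
  qed
  moreover obtain B where B: "\<And>p. p \<in> shifted_shape lam \<Longrightarrow> snd p < B"
    using finite_shifted_shape[of lam] finite_nat_set_iff_bounded[of "snd ` shifted_shape lam"] by auto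
  have "D i j = \<infinity>" if "B \<le> j" for i j
  proof (rule ccontr)
    assume "D i j \<noteq> \<infinity>"
    then have "(min i j, max i j) \<in> shifted_shape lam"
      using fin[of "min i j" "max i j"] sym[of i j] by (auto simp: min_def max_def)
    then show False using B that by fastforce
  qed
  ultimately show ?thesis using sym pos unfolding sym_incr_def by blast
qed

lemma ex_shape:
  assumes E: "sym_incr E"
  shows "\<exists>lam. strict_partition lam \<and> shifted_shape lam = upset E"
proof -
  define n where "n = (LEAST i. E i i = \<infinity>)"
  obtain B where "E B B = \<infinity>" using sm_bound[OF E] by blast
  then have n: "E n n = \<infinity>" unfolding n_def by (rule LeastI)
  have nlt: "E i i \<noteq> \<infinity>" if "i < n" for i using that not_less_Least[of i "\<lambda>i. E i i = \<infinity>"] by (simp add: n_def)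
  have h: "E i j = \<infinity> \<longleftrightarrow> height E i \<le> j" for i j using height_iff[OF E, of j i] sm_sym[OF E, of i j] by simp
  \<comment> \<open>By symmetry row \<open>i\<close> of the matrix has \<open>height E i\<close>
    finite entries, and those left of the diagonal do not belong to the shifted row.\<close>
  define lam where "lam = map (\<lambda>i. height E i - i) [0..<n]"
  have hi: "i < height E i" if "i < n" for i using nlt[OF that] h[of i i] by simp
  have "sorted_wrt (>) lam"
    unfolding lam_def sorted_wrt_map
  proof (rule sorted_wrt_mono_rel[OF _ sorted_wrt_upt])
    fix i k assume "i \<in> set [0..<n]" "k \<in> set [0..<n]" "i < k"
    then show "height E k - k < height E i - i"
      using hi[of k] hi[of i] height_antimono[OF E, of i k] by simp
  qed
  moreover have "0 \<notin> set lam"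
  proof
    assume "0 \<in> set lam"
    then obtain i where "i < n" "height E i - i = 0" by (auto simp: lam_def)
    then show False using hi[of i] by simp
  qed
  moreover have "shifted_shape lam = upset E"
  proof (intro set_eqI)
    fix p :: "nat \<times> nat"
    obtain i j where p: "p = (i, j)" by force
    have "i < n" if "i \<le> j" "E i j \<noteq> \<infinity>"
    proof (rule ccontr)
      assume "\<not> i < n"
      then have "E i j = \<infinity>" using sm_inf[OF E n, of i j] that(1) by simp
      with that(2) show False ..
    qed
    then show "p \<in> shifted_shape lam \<longleftrightarrow> p \<in> upset E"
      using h[of i j] hi[of i] p by (auto simp: shifted_shape_iff lam_def upset_def)
  qed
  ultimately show ?thesis by (auto simp: strict_partition_def)
qed

text \<open>The test in the insertion rules, including the test for a shifted shape, is thereby a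
  test for \<open>sym_incr\<close>.\<close>

lemma inc_tab_iff: "inc_tab T \<longleftrightarrow> tri T \<and> sym_incr (toD T)"
proof
  assume T: "inc_tab T"
  then obtain lam where lam: "strict_partition lam" "dom T = shifted_shape lam" and inc: "increasing T"
    by (auto simp: inc_tab_def)
  have tri: "tri T" using lam(2) by (auto simp: tri_def shifted_shape_iff)
  moreover have "sym_incr (toD T)"
  proof (rule sm_of_shape[OF lam(1)])
    fix i j
    show "toD T i j \<noteq> \<infinity> \<longleftrightarrow> (i, j) \<in> shifted_shape lam" if "i \<le> j"
      using that lam(2) by (auto simp: toD_inf_iff)
    show "toD T i j = toD T j i" by (rule toD_sym)
    show "0 < toD T i j"
    proof (cases "T (min i j, max i j)")
      case (Some a)
      then have "0 < a" using inc ranI[of T _ a] unfolding increasing_def by blast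
      then show ?thesis using Some by (simp add: toD_def zero_enat_def)
    qed (simp add: toD_def)
    show "toD T i j < toD T i (Suc j)"
      if h: "(i, j) \<in> shifted_shape lam" "(i, Suc j) \<in> shifted_shape lam"
    proof -
      obtain a b where ab: "T (i, j) = Some a" "T (i, Suc j) = Some b" using h lam(2) by blast
      then have "a < b" using inc lessI[of j] unfolding increasing_def by blast
      moreover have "i \<le> j" using h by (simp add: shifted_shape_iff)
      ultimately show ?thesis using ab by (simp add: toD_upper)
    qed
    show "toD T i j < toD T (Suc i) j"
      if h: "(i, j) \<in> shifted_shape lam" "(Suc i, j) \<in> shifted_shape lam"
    proof -
      obtain a b where ab: "T (i, j) = Some a" "T (Suc i, j) = Some b" using h lam(2) by blast
      then have "a < b" using inc lessI[of i] unfolding increasing_def by blast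
      moreover have "Suc i \<le> j" using h by (simp add: shifted_shape_iff)
      ultimately show ?thesis using ab by (simp add: toD_upper)
    qed
  qed
  ultimately show "tri T \<and> sym_incr (toD T)" ..
next
  assume a: "tri T \<and> sym_incr (toD T)"
  then have tri: "tri T" and sym_incr: "sym_incr (toD T)" by auto
  have "\<exists>lam. strict_partition lam \<and> dom T = shifted_shape lam"
    using ex_shape[OF sym_incr] dom_upset[OF tri] by metis
  moreover have "increasing T"
    unfolding increasing_def
  proof (intro conjI ballI allI impI)
    fix a assume "a \<in> ran T"
    then obtain i j where "T (i, j) = Some a" by (auto simp: ran_def)
    then show "0 < a" using sm_pos[OF sym_incr, of i j] triD[OF tri] by (auto simp: toD_upper zero_enat_def)
  next
    fix i j j' a b assume "T (i, j) = Some a \<and> T (i, j') = Some b \<and> j < j'"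
    then show "a < b" using sm_less[OF sym_incr, of j j' i] triD[OF tri] by (auto simp: toD_upper)
  next
    fix i i' j a b assume "T (i, j) = Some a \<and> T (i', j) = Some b \<and> i < i'"
    then show "a < b" using sm_less'[OF sym_incr, of i i' j] triD[OF tri] by (auto simp: toD_upper)
  qed
  ultimately show "inc_tab T" by (simp add: inc_tab_def)
qed

subsection \<open>Shifted Hecke insertion as row insertion into a symmetric matrix\<close>

text \<open>Unlike \<open>run\<close>, this unfolds an insertion from its first step, as the rules
  of \<open>hk_row\<close> and \<open>hk_col\<close> do.\<close>

inductive fin :: "mat \<Rightarrow> nat \<Rightarrow> enat \<Rightarrow> mat \<Rightarrow> bool" where
  fin_inf: "fin D k \<infinity> D"
| fin_step: "x \<noteq> \<infinity> \<Longrightarrow> fin (bump_mat D k x) (Suc k) (out D k x) E \<Longrightarrow> fin D k x E"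

lemma fin_ins:
  assumes "valid D 0 x"
  shows "fin D 0 x (ins D x)"
proof -
  have "fin (run_mat k D x) k (run_letter k D x) (ins D x)" if "k \<le> Suc (end_row D x)" for k
    using that
  proof (induction rule: inc_induct)
    case base
    then show ?case using tn_inf[OF assms] by (simp add: ins_def fin_inf)
  next
    case (step k)
    then have fin: "run_letter k D x \<noteq> \<infinity>" using rx_fin_iff[OF assms, of k] by simp
    show ?case
      using step.IH by (intro fin_step[OF fin]) (simp add: rm_Suc[OF fin] rx_Suc[OF fin])
  qed
  from this[of 0] show ?thesis by simp
qed

definition stepT :: "tab \<Rightarrow> nat \<times> nat \<Rightarrow> nat \<Rightarrow> tab" where
  "stepT T b x = (if inc_tab (T(b \<mapsto> x)) then T(b \<mapsto> x) else T)"

lemma toD_update: "i \<le> j \<Longrightarrow> toD (T((i, j) \<mapsto> x)) = upd (toD T) i j (enat x)"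
proof (intro ext)
  fix r c assume "i \<le> j"
  then have "(min r c, max r c) = (i, j) \<longleftrightarrow> r = i \<and> c = j \<or> r = j \<and> c = i"
    by (cases "r \<le> c") auto
  then show "toD (T((i, j) \<mapsto> x)) r c = upd (toD T) i j (enat x) r c"
    by (simp add: toD_def upd_def)
qed

lemma upd_swap: "upd D k j x = upd D j k x"
  by (auto simp: upd_def fun_eq_iff)

text \<open>At a bumping position the global test of the insertion rules reduces to the local test
  \<open>fits\<close>.\<close>

lemma sm_upd_iff:
  assumes v: "valid D k x"
  shows "sym_incr (upd D k (pos D k x) x) \<longleftrightarrow> fits D k (pos D k x) x"
proof
  assume "fits D k (pos D k x) x"
  then show "sym_incr (upd D k (pos D k x) x)" using sm_stepm[OF v] by (simp add: bump_mat_def)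
next
  let ?j = "pos D k x"
  let ?U = "upd D k ?j x"
  assume U: "sym_incr ?U"
  have fin: "?U k ?j \<noteq> \<infinity>" using validD(3)[OF v] by simp
  show "fits D k ?j x"
    unfolding fits_def
  proof (intro conjI allI impI)
    fix j' assume j: "?j = Suc j'"
    have "?U k j' < ?U k ?j" using sm_Suc[OF U, of k j'] fin j by simp
    then show "D k j' < x" using j by (metis upd_at(1) upd_left)
  next
    fix k' assume k: "k = Suc k'"
    have "?U k' ?j \<noteq> \<infinity>" using sm_inf[OF U, of k' ?j k ?j] fin k by auto
    then have "?U k' ?j < ?U k ?j" using k by (intro sm_less'[OF U]) auto
    then show "D k' ?j < x" using k by (metis upd_at(1) upd_above)
  qed
qed

lemma stepT_toD:
  assumes T: "tri T" and v: "valid (toD T) k (enat x)" and b: "b = tab_box (k, pos (toD T) k (enat x))"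
  shows "toD (stepT T b x) = bump_mat (toD T) k (enat x)" "tri (stepT T b x)"
proof -
  let ?j = "pos (toD T) k (enat x)"
  have b': "b = (min k ?j, max k ?j)" using b by (simp add: tab_box_def)
  have "toD (T(b \<mapsto> x)) = upd (toD T) (min k ?j) (max k ?j) (enat x)"
    unfolding b' by (intro toD_update) simp
  then have up: "toD (T(b \<mapsto> x)) = upd (toD T) k ?j (enat x)"
    using upd_swap[of "toD T" k ?j] by (auto simp: min_def max_def)
  have tri: "tri (T(b \<mapsto> x))" using T b' by (auto simp: tri_def)
  show "toD (stepT T b x) = bump_mat (toD T) k (enat x)"
    using tri up sm_upd_iff[OF v] by (simp add: stepT_def bump_mat_def inc_tab_iff)
  show "tri (stepT T b x)" using tri T by (simp add: stepT_def)
qed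

lemma in_rowE: "tri T \<Longrightarrow> a \<in> rowE T k \<longleftrightarrow> (\<exists>c\<ge>k. toD T k c = enat a)"
  using triD by (force simp: rowE_def toD_enat_iff)

lemma in_colE: "tri T \<Longrightarrow> a \<in> colE T k \<longleftrightarrow> (\<exists>r\<le>k. toD T k r = enat a)"
  using triD toD_sym[of T k] by (force simp: colE_def toD_enat_iff)

lemma finite_dom: "tri T \<Longrightarrow> sym_incr (toD T) \<Longrightarrow> finite (dom T)"
  using dom_upset finite_upset by metis

lemma finite_rowE: "finite (dom T) \<Longrightarrow> finite (rowE T k)" and finite_colE: "finite (dom T) \<Longrightarrow> finite (colE T k)"
proof -
  assume "finite (dom T)"
  then have "finite (ran T)" by (rule finite_ran)
  moreover have "rowE T k \<subseteq> ran T" "colE T k \<subseteq> ran T" by (auto simp: rowE_def colE_def ran_def)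
  ultimately show "finite (rowE T k)" "finite (colE T k)" by (auto intro: finite_subset)
qed

context
  fixes T :: tab and k x j :: nat
  assumes T: "tri T" and v: "valid (toD T) k (enat x)" and j: "j = pos (toD T) k (enat x)"
begin

lemma entry_gt_iff: "enat x < toD T k c \<longleftrightarrow> j \<le> c"
proof
  show "j \<le> c" if "enat x < toD T k c" using pos_le[of "enat x" "toD T" k c] that j by simp
  have "enat x < toD T k j" unfolding j by (rule pos_gt[OF validD(1)[OF v]]) simp
  then show "enat x < toD T k c" if "j \<le> c" using sm_le[OF validD(1)[OF v] that, of k] by simp
qed

lemma out_j: "out (toD T) k (enat x) = toD T k j"
  by (simp add: out_def j)

lemma finite_before: "c < j \<Longrightarrow> toD T k c \<noteq> \<infinity>"
  using entry_gt_iff[of c] by auto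

lemma Min_bumped:
  assumes "\<And>a. a \<in> A \<longleftrightarrow> (\<exists>c. P c \<and> toD T k c = enat a)" "finite A" "P j" "toD T k j = enat y"
  shows "Min {a \<in> A. x < a} = y" "y \<in> A" "x < y"
proof -
  show xy: "x < y" using entry_gt_iff[of j] assms(4) by simp
  show yA: "y \<in> A" using assms(1,3,4) by blast
  show "Min {a \<in> A. x < a} = y"
  proof (rule Min_eqI)
    fix a assume "a \<in> {a \<in> A. x < a}"
    then obtain c where c: "toD T k c = enat a" "x < a" using assms(1) by blast
    then have "j \<le> c" using entry_gt_iff[of c] by simp
    then show "y \<le> a" using sm_le[OF validD(1)[OF v], of j c k] c assms(4) by simp
  qed (use assms(2) xy yA in auto)
qed

lemma rowlen_eq:
  assumes "k \<le> j" "toD T k j = \<infinity>"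
  shows "k + rowlen T k = j"
proof -
  have "{c. (k, c) \<in> dom T} = {k..<j}"
  proof (intro set_eqI)
    fix c
    have "(k, c) \<in> dom T \<longleftrightarrow> k \<le> c \<and> toD T k c \<noteq> \<infinity>"
      using triD[OF T, of k c] by (auto simp: toD_inf_iff)
    also have "\<dots> \<longleftrightarrow> c \<in> {k..<j}"
      using finite_before[of c] sm_inf[OF validD(1)[OF v] assms(2), of k c] by (auto simp: not_le[symmetric])
    finally show "c \<in> {c. (k, c) \<in> dom T} \<longleftrightarrow> c \<in> {k..<j}" by simp
  qed
  then show ?thesis using assms(1) by (simp add: rowlen_def)
qed

lemma collen_eq:
  assumes "j < k" "toD T k j = \<infinity>"
  shows "collen T k = j"
proof -
  have "{r. (r, k) \<in> dom T} = {..<j}"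
  proof (intro set_eqI)
    fix r
    have "(r, k) \<in> dom T \<longleftrightarrow> r \<le> k \<and> toD T k r \<noteq> \<infinity>"
      using triD[OF T, of r k] toD_sym[of T k r] by (auto simp: toD_inf_iff)
    also have "\<dots> \<longleftrightarrow> r \<in> {..<j}"
      using finite_before[of r] sm_inf[OF validD(1)[OF v] assms(2), of k r] assms(1)
      by (auto simp: not_le[symmetric])
    finally show "r \<in> {r. (r, k) \<in> dom T} \<longleftrightarrow> r \<in> {..<j}" by simp
  qed
  then show ?thesis by (simp add: collen_def)
qed

lemma fin_dom: "finite (dom T)"
  by (rule finite_dom[OF T validD(1)[OF v]])

lemma hk_row_end:
  assumes kj: "k \<le> j" and inf: "toD T k j = \<infinity>"
  shows "hk_row k x T T' \<longleftrightarrow> T' = stepT T (k, j) x"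
proof -
  have all: "\<forall>a\<in>rowE T k. a \<le> x"
  proof
    fix a assume "a \<in> rowE T k"
    then obtain c where c: "toD T k c = enat a" using in_rowE[OF T] by blast
    then have "c < j" using sm_inf[OF validD(1)[OF v] inf, of k c] by (cases "j \<le> c") auto
    then show "a \<le> x" using entry_gt_iff[of c] c by simp
  qed
  note len = rowlen_eq[OF kj inf]
  show ?thesis
  proof
    assume "hk_row k x T T'"
    then show "T' = stepT T (k, j) x"
      by cases (use all len in \<open>auto simp: stepT_def\<close>)
  next
    assume "T' = stepT T (k, j) x"
    then show "hk_row k x T T'"
      using row_add[OF all] row_stop[OF all] len by (auto simp: stepT_def)
  qed
qed

lemma hk_row_next:
  assumes kj: "k \<le> j" and y: "toD T k j = enat y"
  shows "hk_row k x T T' \<longleftrightarrow>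
    (if j = k then hk_col (Suc k) y (stepT T (k, j) x) T' else hk_row (Suc k) y (stepT T (k, j) x) T')"
proof -
  note b = Min_bumped[where P = "\<lambda>c. k \<le> c", OF in_rowE[OF T] finite_rowE[OF fin_dom] kj y]
  have Ty: "T (k, j) = Some y" using y kj by (simp add: toD_enat_iff)
  have uniq: "c = j" if "T (k, c) = Some y" for c
  proof -
    have "toD T k c = toD T k j" using triD[OF T that] that y by (simp add: toD_upper)
    then show ?thesis
      using sm_less_iff[OF validD(1)[OF v], of k c j] sm_less_iff[OF validD(1)[OF v], of k j c] y
      by (metis enat.distinct(1) less_irrefl linorder_neqE_nat)
  qed
  have nall: "\<not> (\<forall>a\<in>rowE T k. a \<le> x)" using b(2,3) by (auto simp: not_le)
  show ?thesis
  proof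
    assume "hk_row k x T T'"
    then show "if j = k then hk_col (Suc k) y (stepT T (k, j) x) T' else hk_row (Suc k) y (stepT T (k, j) x) T'"
    proof cases
      case (row_bump_diag a y' T1)
      then have "y' = y" using b by simp
      then have kj: "k = j" using uniq row_bump_diag by blast
      have "T1 = stepT T (k, k) x" using row_bump_diag unfolding stepT_def by blast
      then show ?thesis using row_bump_diag \<open>y' = y\<close> kj by metis
    next
      case (row_bump a y' j' T1)
      then have "y' = y" using b by simp
      then have "j' = j" using uniq row_bump by blast
      moreover have "T1 = stepT T (k, j') x" using row_bump unfolding stepT_def by blast
      ultimately show ?thesis using row_bump \<open>y' = y\<close> by metis
    qed (use nall in blast)+
  next
    assume "if j = k then hk_col (Suc k) y (stepT T (k, j) x) T' else hk_row (Suc k) y (stepT T (k, j) x) T'"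
    then show "hk_row k x T T'"
      using row_bump_diag[OF b(2,3) b(1)[symmetric], of "stepT T (k, k) x"]
        row_bump[OF b(2,3) b(1)[symmetric] Ty, of "stepT T (k, j) x"] Ty
      by (auto simp: stepT_def split: if_splits)
  qed
qed

lemma hk_col_end:
  assumes kj: "j < k" and inf: "toD T k j = \<infinity>"
  shows "hk_col k x T T' \<longleftrightarrow> T' = stepT T (j, k) x"
proof -
  have all: "\<forall>a\<in>colE T k. a \<le> x"
  proof
    fix a assume "a \<in> colE T k"
    then obtain c where c: "toD T k c = enat a" using in_colE[OF T] by blast
    then have "c < j" using sm_inf[OF validD(1)[OF v] inf, of k c] by (cases "j \<le> c") auto
    then show "a \<le> x" using entry_gt_iff[of c] c by simp
  qed
  note len = collen_eq[OF kj inf]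
  show ?thesis
  proof
    assume "hk_col k x T T'"
    then show "T' = stepT T (j, k) x"
      by cases (use all len in \<open>auto simp: stepT_def\<close>)
  next
    assume "T' = stepT T (j, k) x"
    then show "hk_col k x T T'"
      using col_add[OF all] col_stop[OF all] len by (auto simp: stepT_def)
  qed
qed

lemma hk_col_next:
  assumes kj: "j < k" and y: "toD T k j = enat y"
  shows "hk_col k x T T' \<longleftrightarrow> hk_col (Suc k) y (stepT T (j, k) x) T'"
proof -
  note b = Min_bumped[where P = "\<lambda>c. c \<le> k", OF in_colE[OF T] finite_colE[OF fin_dom] less_imp_le[OF kj] y]
  have Ty: "T (j, k) = Some y" using y kj toD_sym[of T k j] by (simp add: toD_enat_iff)
  have uniq: "c = j" if "T (c, k) = Some y" for c
  proof -
    have "toD T k c = toD T k j" using triD[OF T that] that y toD_sym[of T k c] by (simp add: toD_upper)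
    then show ?thesis
      using sm_less_iff[OF validD(1)[OF v], of k c j] sm_less_iff[OF validD(1)[OF v], of k j c] y
      by (metis enat.distinct(1) less_irrefl linorder_neqE_nat)
  qed
  have nall: "\<not> (\<forall>a\<in>colE T k. a \<le> x)" using b(2,3) by (auto simp: not_le)
  show ?thesis
  proof
    assume "hk_col k x T T'"
    then show "hk_col (Suc k) y (stepT T (j, k) x) T'"
    proof cases
      case (col_bump a y' i T1)
      then have "y' = y" using b by simp
      then have ij: "i = j" using uniq col_bump by blast
      then have "T1 = stepT T (j, k) x" using col_bump unfolding stepT_def by blast
      then show ?thesis using col_bump \<open>y' = y\<close> by blast
    qed (use nall in blast)+
  next
    assume "hk_col (Suc k) y (stepT T (j, k) x) T'"
    then show "hk_col k x T T'"
      using col_bump[OF b(2,3) b(1)[symmetric] Ty, of "stepT T (j, k) x"] by (auto simp: stepT_def)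
  qed
qed

end


text \<open>A bumping position on or right of the diagonal means row insertion, one left of it
  column insertion. So the next position has to be shown to lie left of the diagonal exactly when
  rows give way to columns. Adding a box and stopping are the two outcomes of \<open>stepT\<close>
  at an infinite entry.\<close>

lemma hk_run:
  assumes "fin D k X E"
  shows "X = enat x \<Longrightarrow> valid (toD T) k X \<Longrightarrow> tri T \<Longrightarrow> D = toD T \<Longrightarrow>
    (if k \<le> pos D k X then hk_row k x T T' else hk_col k x T T') \<longleftrightarrow> tri T' \<and> toD T' = E"
  using assms
proof (induction arbitrary: T x rule: fin.induct)
  case (fin_step X D k E)
  note T = fin_step.prems(3) and D = fin_step.prems(4)
  have v: "valid (toD T) k (enat x)" using fin_step.prems by simp
  define j where "j = pos (toD T) k (enat x)"
  let ?b = "(min k j, max k j)"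
  let ?T1 = "stepT T ?b x"
  have T1: "toD ?T1 = bump_mat (toD T) k (enat x)" "tri ?T1"
    using stepT_toD[OF T v, of ?b] by (simp_all add: tab_box_def j_def)
  have out: "out (toD T) k (enat x) = toD T k j" by (rule out_j[OF T v j_def])
  show ?case
  proof (cases "toD T k j")
    case infinity
    then have "E = toD ?T1"
      using fin_step.hyps(2) fin_step.prems(1) D out T1(1) by (auto elim: fin.cases)
    then have "tri T' \<and> toD T' = E \<longleftrightarrow> T' = ?T1" using T1(2) tri_eqI by metis
    then show ?thesis
      using hk_row_end[OF T v j_def _ infinity] hk_col_end[OF T v j_def _ infinity] D fin_step.prems(1)
      by (auto simp: j_def[symmetric] min_def max_def)
  next
    case (enat y)
    have o: "out (toD T) k (enat x) = enat y" using out enat by simp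
    have ofin: "out (toD T) k (enat x) \<noteq> \<infinity>" using o by simp
    have v1: "valid (toD ?T1) (Suc k) (enat y)" and vp: "vpos (toD ?T1) k (enat y) j"
      using valid_step[OF v ofin] T1(1) o by (simp_all add: j_def)
    let ?j1 = "pos (toD ?T1) (Suc k) (enat y)"
    have IH: "(if Suc k \<le> ?j1 then hk_row (Suc k) y ?T1 T' else hk_col (Suc k) y ?T1 T')
        \<longleftrightarrow> tri T' \<and> toD T' = E"
      using fin_step.IH[of y ?T1] v1 T1 o D fin_step.prems(1) by simp
    have j1: "?j1 \<le> j" by (rule vpos_pos_le[OF vp])
    show ?thesis
    proof (cases "k < j")
      case True
      \<comment> \<open>Otherwise the entry at \<open>(Suc k, k)\<close> would exceed
        \<open>y\<close>. It mirrors \<open>(k, Suc k)\<close>, which is weakly left of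
        \<open>j\<close> in row \<open>k\<close> and hence at most \<open>y\<close>.\<close>
      have "Suc k \<le> ?j1"
      proof (rule ccontr)
        assume "\<not> Suc k \<le> ?j1"
        note sm1 = validD(1)[OF v1]
        have "enat y < toD ?T1 (Suc k) ?j1" by (rule pos_gt[OF sm1]) simp
        also have "\<dots> \<le> toD ?T1 (Suc k) k" using \<open>\<not> Suc k \<le> ?j1\<close> by (intro sm_le[OF sm1]) simp
        also have "\<dots> = toD ?T1 k (Suc k)" by (rule toD_sym)
        also have "\<dots> \<le> toD ?T1 k j" using True by (intro sm_le[OF sm1]) simp
        also have "\<dots> \<le> enat y" using vp by (simp add: vpos_def)
        finally show False by simp
      qed
      then show ?thesis
        using IH hk_row_next[OF T v j_def _ enat] True D fin_step.prems(1)
        by (simp add: j_def[symmetric] min_def max_def)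
    next
      case False
      then have "\<not> Suc k \<le> ?j1" using j1 by simp
      then show ?thesis
        using IH hk_row_next[OF T v j_def _ enat] hk_col_next[OF T v j_def _ enat] False D fin_step.prems(1)
        by (cases "j = k") (simp_all add: j_def[symmetric] min_def max_def)
    qed
  qed
qed simp

theorem hk_row_iff:
  assumes "tri T" "valid (toD T) 0 (enat x)"
  shows "hk_row 0 x T T' \<longleftrightarrow> tri T' \<and> toD T' = ins (toD T) (enat x)"
  using hk_run[OF fin_ins[OF assms(2)] refl assms(2,1) refl] by simp

lemma toD_empty: "toD Map.empty = (\<lambda>_ _. \<infinity>)" "tri Map.empty"
  by (auto simp: toD_def tri_def fun_eq_iff)

theorem hk_P_iff:
  "(\<And>x. x \<in> set w \<Longrightarrow> 1 \<le> x) \<Longrightarrow> hk_P w T \<longleftrightarrow> tri T \<and> toD T = ins_word w"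
proof (induction w arbitrary: T rule: rev_induct)
  case Nil
  have "hk_P [] T \<longleftrightarrow> T = Map.empty" by (subst hk_P.simps) auto
  then show ?case using tri_eqI[of T Map.empty] toD_empty by auto
next
  case (snoc x w)
  have IH: "hk_P w U \<longleftrightarrow> tri U \<and> toD U = ins_word w" for U using snoc by simp
  have v: "valid (ins_word w) 0 (enat x)" using snoc.prems by (intro valid_insw) auto
  have "hk_P (w @ [x]) T \<longleftrightarrow> (\<exists>U. hk_P w U \<and> hk_row 0 x U T)" by (subst hk_P.simps) auto
  also have "\<dots> \<longleftrightarrow> (\<exists>U. tri U \<and> toD U = ins_word w \<and> tri T \<and> toD T = ins_word (w @ [x]))"
    using IH hk_row_iff[of _ x T] v by auto
  also have "\<dots> \<longleftrightarrow> tri T \<and> toD T = ins_word (w @ [x])"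
    using tri_fromD toD_fromD[OF validD(1)[OF v]] by blast
  finally show ?case .
qed

text \<open>The definite description is discharged here: existence comes from \<open>fromD\<close>,
  uniqueness from \<open>tri_eqI\<close>.\<close>

theorem P_ins_eq:
  assumes "\<And>x. x \<in> set w \<Longrightarrow> 1 \<le> x"
  shows "tri (P_ins w)" "toD (P_ins w) = ins_word w"
proof -
  have iff: "hk_P w T \<longleftrightarrow> tri T \<and> toD T = ins_word w" for T using hk_P_iff assms by blast
  have "sym_incr (ins_word w)" using sm_insw assms by blast
  then have "hk_P w (fromD (ins_word w))" unfolding iff using tri_fromD toD_fromD by blast
  then have "\<exists>!T. hk_P w T" using tri_eqI unfolding iff by (intro ex1I) auto
  then have "hk_P w (P_ins w)" unfolding P_ins_def by (rule theI')
  then show "tri (P_ins w)" "toD (P_ins w) = ins_word w" unfolding iff by auto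
qed

subsection \<open>Row words of tableaux\<close>

definition rw :: "nat \<Rightarrow> tab \<Rightarrow> nat list" where
  "rw b R = concat (map (\<lambda>i. map (\<lambda>j. the (R (i, j))) (filter (\<lambda>j. (i, j) \<in> dom R) [0..<b])) (rev [0..<b]))"

lemma sorted_list_filter: "A \<subseteq> {..<b} \<Longrightarrow> sorted_list_of_set A = filter (\<lambda>j. j \<in> A) [0..<b]"
  by (intro sorted_distinct_set_unique) (auto simp: sorted_wrt_filter finite_subset[of A "{..<b}"])

lemma concat_filter: "(\<And>x. \<not> P x \<Longrightarrow> f x = []) \<Longrightarrow> concat (map f (filter P xs)) = concat (map f xs)"
  by (induction xs) auto

lemma row_word_rw:
  assumes "dom R \<subseteq> {..<b} \<times> {..<b}"
  shows "row_word R = rw b R"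
proof -
  let ?f = "\<lambda>i. map (\<lambda>j. the (R (i, j))) (sorted_list_of_set {j. (i, j) \<in> dom R})"
  have f: "?f i = map (\<lambda>j. the (R (i, j))) (filter (\<lambda>j. (i, j) \<in> dom R) [0..<b])" for i
    using assms by (subst sorted_list_filter[of _ b]) auto
  have "row_word R = concat (map ?f (rev (filter (\<lambda>i. i \<in> fst ` dom R) [0..<b])))"
    using assms unfolding row_word_def by (subst sorted_list_filter[of "fst ` dom R" b]) auto
  also have "\<dots> = concat (map ?f (rev [0..<b]))"
    unfolding rev_filter
  proof (rule concat_filter)
    fix i assume "i \<notin> fst ` dom R"
    then have "{j. (i, j) \<in> dom R} = {}" by force
    then show "?f i = []" by simp
  qed
  finally show ?thesis unfolding f rw_def .
qed

lemma rw_RWd: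
  assumes "tri T"
  shows "rw b T = row_reading (toD T) 0 b 0 b"
  unfolding rw_def row_reading_def
proof (intro arg_cong[where f = concat] map_cong refl)
  fix i assume "i \<in> set (rev [0..<b])"
  then have b: "i \<le> b" by simp
  have "filter (\<lambda>j. (i, j) \<in> dom T) [0..<i] = []"
    using triD[OF assms, of i] by (force simp: filter_empty_conv)
  moreover have "filter (\<lambda>j. (i, j) \<in> dom T) ([0..<i] @ [i..<b]) =
      filter (\<lambda>j. (i, j) \<in> dom T) [0..<i] @ filter (\<lambda>j. (i, j) \<in> dom T) [i..<b]" by simp
  ultimately have "filter (\<lambda>j. (i, j) \<in> dom T) [0..<b] = filter (\<lambda>j. (i, j) \<in> dom T) [i..<b]"
    using b by (simp add: upt_append)
  also have "\<dots> = filter (\<lambda>j. toD T i j \<noteq> \<infinity>) [i..<b]"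
    by (intro filter_cong) (auto simp: toD_inf_iff)
  finally show "map (\<lambda>j. the (T (i, j))) (filter (\<lambda>j. (i, j) \<in> dom T) [0..<b]) = line (toD T) i [max i 0..<b]"
    unfolding line_def by (auto simp: toD_upper split: option.splits)
qed

lemma bnd_mono: "bnd B D \<Longrightarrow> B \<le> B' \<Longrightarrow> bnd B' D"
  by (auto simp: bnd_def)

lemma ex_bnd: "sym_incr D \<Longrightarrow> \<exists>B. bnd B D"
  using sm_bound[of D] by (auto simp: bnd_def)

lemma row_word_RWd:
  assumes "tri T" "bnd b (toD T)"
  shows "row_word T = row_reading (toD T) 0 b 0 b"
proof -
  have "dom T \<subseteq> {..<b} \<times> {..<b}"
  proof (intro subrelI)
    fix i j assume "(i, j) \<in> dom T"
    then have "i \<le> j" "toD T i j \<noteq> \<infinity>" using triD[OF assms(1)] by (auto simp: toD_inf_iff)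
    then show "(i, j) \<in> {..<b} \<times> {..<b}" using assms(2) by (auto simp: bnd_def not_le[symmetric])
  qed
  then show ?thesis using row_word_rw rw_RWd[OF assms(1)] by metis
qed

lemma bnd_ins: "valid D 0 x \<Longrightarrow> bnd B D \<Longrightarrow> bnd (Suc B) (ins D x)"
proof -
  assume D: "valid D 0 x" and B: "bnd B D"
  have c: "corner (ins D x) (box D x)" by (rule final_corner[OF final_ins[OF D]])
  obtain i j where b: "box D x = (i, j)" by force
  have "i \<le> B \<and> j \<le> B" if g: "grew D x"
  proof
    have t: "end_row D x = i" using tn_grew(2)[OF D g] b by simp
    then show "i \<le> B" using tn_bnd[OF D B] by simp
    have M: "bnd B (run_mat i D x)" using run_bnd[OF D B, of i] t by simp
    have "pos (run_mat i D x) i (run_letter i D x) \<le> B"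
      using pos_le[of "run_letter i D x" "run_mat i D x" i B] M tn_fin[OF D] t by (simp add: bnd_def)
    moreover have "box D x = (i, pos (run_mat i D x) i (run_letter i D x))"
      using final_grew(1)[of "run_mat i D x" i "run_letter i D x" "ins D x" "box D x"] final_ins[OF D] t g by simp
    ultimately show "j \<le> B" using b by simp
  qed
  then show "bnd (Suc B) (ins D x)" using ins_inf_iff[OF D] B b unfolding bnd_def by auto
qed

theorem word_kequiv:
  assumes "\<And>x. x \<in> set w \<Longrightarrow> 1 \<le> x" "tri T" "toD T = ins_word w"
  shows "kequiv w (row_word T)"
proof -
  have len: "bnd (length w) (ins_word w)" using assms(1)
  proof (induction w rule: rev_induct)
    case (snoc x w)
    then show ?case using bnd_ins[OF valid_insw] by simp
  qed (simp add: bnd_def)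
  \<comment> \<open>The range \<open>b\<close> stays general because an insertion may enlarge the
    shape, while \<open>ins_kequiv\<close> reads before and after with the same range.\<close>
  have "kequiv w (row_reading (ins_word w) 0 b 0 b)" if "length w \<le> b" for b
    using assms(1) that
  proof (induction w arbitrary: b rule: rev_induct)
    case Nil
    have "row_reading (\<lambda>_ _. \<infinity>) 0 b 0 b = []" by (rule RWd_inf[OF sm_empty]) simp
    then show ?case by simp
  next
    case (snoc x w)
    obtain B where B: "b = Suc B" "length w \<le> B" using snoc.prems(2) by (cases b) auto
    have v: "valid (ins_word w) 0 (enat x)" using snoc.prems by (intro valid_insw) auto
    have "bnd (length w) (ins_word w)" using snoc.prems(1)
    proof (induction w rule: rev_induct)
      case (snoc y w)
      then show ?case using bnd_ins[OF valid_insw] by simp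
    qed (simp add: bnd_def)
    then have bB: "bnd B (ins_word w)" using bnd_mono B(2) by blast
    have "kequiv (w @ [x]) (row_reading (ins_word w) 0 b 0 b @ [x])"
      using snoc B by (intro kequiv_append_right) auto
    also have "kequiv (row_reading (ins_word w) 0 b 0 b @ [x]) (row_reading (ins_word (w @ [x])) 0 b 0 b)"
      using ins_kequiv[OF v bB] B(1) by simp
    finally show ?case .
  qed
  from this[OF order_refl] show ?thesis
    using row_word_RWd[OF assms(2), of "length w"] len assms(3) by simp
qed

lemma kstep_set: "kstep u v \<Longrightarrow> set u = set v"
  by (induction rule: kstep.induct) auto

lemma kequiv_set: "kequiv u v \<Longrightarrow> set u = set v"
  unfolding kequiv_def by (induction rule: rtranclp_induct) (auto dest: kstep_set)

subsection \<open>Restriction to letters up to a bound and above it\<close>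

definition restrict_le :: "nat \<Rightarrow> mat \<Rightarrow> mat" where
  "restrict_le n D = (\<lambda>i j. if D i j \<le> enat n then D i j else \<infinity>)"

definition cap :: "nat \<Rightarrow> enat \<Rightarrow> enat" where
  "cap n x = (if x \<le> enat n then x else \<infinity>)"

lemma cut_cap: "restrict_le n D i j = cap n (D i j)"
  by (simp add: restrict_le_def cap_def)

lemma sm_cut:
  assumes D: "sym_incr D"
  shows "sym_incr (restrict_le n D)"
  unfolding sym_incr_def
proof (intro conjI allI impI)
  fix i j
  show "restrict_le n D i j = restrict_le n D j i" using sm_sym[OF D, of i j] by (simp add: restrict_le_def)
  show "0 < restrict_le n D i j" using sm_pos[OF D] by (simp add: restrict_le_def)
  show "restrict_le n D i j < restrict_le n D i (Suc j)" if "restrict_le n D i (Suc j) \<noteq> \<infinity>"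
  proof -
    have "D i (Suc j) \<le> enat n" using that by (simp add: restrict_le_def split: if_splits)
    then have "D i (Suc j) \<noteq> \<infinity>" by auto
    then have "D i j < D i (Suc j)" by (rule sm_Suc[OF D])
    then show ?thesis using \<open>D i (Suc j) \<le> enat n\<close> by (simp add: restrict_le_def)
  qed
next
  obtain B where "\<And>i j. B \<le> i \<or> B \<le> j \<Longrightarrow> D i j = \<infinity>" using sm_bound[OF D] by blast
  then show "\<exists>B. \<forall>i j. B \<le> j \<longrightarrow> restrict_le n D i j = \<infinity>" by (auto simp: restrict_le_def)
qed

lemma cap_less_iff: "x \<le> enat n \<Longrightarrow> x < cap n y \<longleftrightarrow> x < y" "x \<le> enat n \<Longrightarrow> cap n y < x \<longleftrightarrow> y < x"
  by (cases x; cases y; force simp: cap_def)+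

text \<open>A comparison with a letter at most \<open>n\<close> cannot tell an entry above
  \<open>n\<close> from \<infinity>. Once the letter exceeds \<open>n\<close>, the remaining steps
  change entries above \<open>n\<close> only, and the restricted insertion is over.\<close>

lemma run_cut:
  assumes D: "valid D 0 x"
  shows "restrict_le n (run_mat k D x) = run_mat k (restrict_le n D) (cap n x) \<and> cap n (run_letter k D x) = run_letter k (restrict_le n D) (cap n x)"
proof (induction k)
  case (Suc k)
  let ?M = "run_mat k D x" and ?X = "run_letter k D x"
  let ?M' = "run_mat k (restrict_le n D) (cap n x)" and ?X' = "run_letter k (restrict_le n D) (cap n x)"
  show ?case
  proof (cases "?X = \<infinity>")
    case True
    then have "?X' = \<infinity>" using Suc by (simp add: cap_def)
    then show ?thesis using Suc True by (simp add: rm_Suc_inf rx_Suc_inf cap_def)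
  next
    case fin: False
    show ?thesis
    proof (cases "?X \<le> enat n")
      case True
      then have X': "?X' = ?X" "?X' \<noteq> \<infinity>" using Suc fin by (auto simp: cap_def)
      have M': "?M' = restrict_le n ?M" using Suc by simp
      have p: "pos (restrict_le n ?M) k ?X = pos ?M k ?X"
        unfolding pos_def cut_cap cap_less_iff(1)[OF True] ..
      have f: "fits (restrict_le n ?M) k j ?X \<longleftrightarrow> fits ?M k j ?X" for j
        unfolding fits_def cut_cap cap_less_iff(2)[OF True] ..
      have "restrict_le n (upd ?M k j ?X) = upd (restrict_le n ?M) k j ?X" for j
        using True by (auto simp: restrict_le_def upd_def fun_eq_iff)
      then have "restrict_le n (bump_mat ?M k ?X) = bump_mat (restrict_le n ?M) k ?X"
        by (simp add: bump_mat_def p f)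
      moreover have "cap n (out ?M k ?X) = out (restrict_le n ?M) k ?X" by (simp add: out_def p cut_cap)
      ultimately show ?thesis
        by (simp add: rm_Suc[OF fin] rx_Suc[OF fin] rm_Suc[OF X'(2)] rx_Suc[OF X'(2)] M' X'(1))
    next
      case False
      then have X': "?X' = \<infinity>" using Suc by (simp add: cap_def)
      have gt: "?X < ?M k (pos ?M k ?X)" by (rule pos_gt[OF run_sm[OF D] fin])
      then have big: "\<not> ?M k (pos ?M k ?X) \<le> enat n"
        using False by (meson order.strict_trans1 less_imp_le not_le)
      then have "\<not> ?M (pos ?M k ?X) k \<le> enat n" using sm_sym[OF run_sm[OF D]] by metis
      then have "restrict_le n (bump_mat ?M k ?X) = restrict_le n ?M"
        using False big by (auto simp: bump_mat_def restrict_le_def upd_def fun_eq_iff)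
      moreover have "cap n (out ?M k ?X) = \<infinity>" using big by (simp add: out_def cap_def)
      ultimately show ?thesis
        using Suc by (simp add: rm_Suc[OF fin] rx_Suc[OF fin] rm_Suc_inf[OF X'] rx_Suc_inf[OF X'])
    qed
  qed
qed (simp add: cap_def)

lemma rm_stable:
  assumes "valid D 0 x"
  shows "run_mat (Suc (end_row D x) + d) D x = ins D x"
proof (induction d)
  case (Suc d)
  have "run_letter (Suc (end_row D x) + d) D x = \<infinity>" using rx_fin_iff[OF assms, of "Suc (end_row D x) + d"] by auto
  then show ?case using Suc rm_Suc_inf by simp
qed (simp add: ins_def)

lemma rm_infinity: "run_mat k D \<infinity> = D \<and> run_letter k D \<infinity> = \<infinity>"
  by (induction k) (auto simp: rm_Suc_inf rx_Suc_inf)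

lemma cut_ins:
  assumes D: "valid D 0 (enat x)"
  shows "restrict_le n (ins D (enat x)) = (if x \<le> n then ins (restrict_le n D) (enat x) else restrict_le n D)"
proof (cases "x \<le> n")
  case True
  have v': "valid (restrict_le n D) 0 (enat x)" using D sm_cut by (auto simp: valid_def)
  let ?N = "end_row D (enat x)" and ?N' = "end_row (restrict_le n D) (enat x)"
  \<comment> \<open>The two insertions may end in different rows, so both are run on to a common
    one.\<close>
  have "restrict_le n (run_mat (Suc ?N + Suc ?N') D (enat x)) = run_mat (Suc ?N' + Suc ?N) (restrict_le n D) (enat x)"
    using run_cut[OF D, of n "Suc ?N + Suc ?N'"] True by (simp add: cap_def add.commute)
  then show ?thesis using rm_stable[OF D, of "Suc ?N'"] rm_stable[OF v', of "Suc ?N"] True by simp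
next
  case False
  then show ?thesis using run_cut[OF D, of n "Suc (end_row D (enat x))"] rm_infinity by (simp add: cap_def ins_def)
qed

lemma cut_insw:
  "(\<And>x. x \<in> set w \<Longrightarrow> 1 \<le> x) \<Longrightarrow> restrict_le n (ins_word w) = ins_word (filter (\<lambda>x. x \<le> n) w)"
proof (induction w rule: rev_induct)
  case (snoc x w)
  have "valid (ins_word w) 0 (enat x)" using snoc.prems by (intro valid_insw) auto
  then show ?case using cut_ins[of "ins_word w" x n] snoc by simp
qed (simp add: restrict_le_def)

definition above :: "nat \<Rightarrow> nat list \<Rightarrow> nat list" where
  "above n w = map (\<lambda>a. a - n) (filter (\<lambda>a. n < a) w)"

lemma above_append [simp]: "above n (u @ v) = above n u @ above n v"
  and above_Nil [simp]: "above n [] = []"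
  and above_Cons: "above n (a # u) = (if n < a then [a - n] else []) @ above n u"
  by (simp_all add: above_def)

text \<open>Discarding the small letters turns every rule into a rule or an equality; the braid rule
  may become \<open>b\<close> against \<open>b b\<close>. An exchange at the front remains at the
  front.\<close>

lemma kstep_above: "kstep u v \<Longrightarrow> kequiv (above n u) (above n v)"
proof (induction rule: kstep.induct)
  case (1 u a v)
  show ?case using kk_kequiv_ctx[OF kk_idem, of "above n u" "a - n" "above n v"] by (simp add: above_Cons)
next
  case (2 a b u v)
  then show ?case
    using kk_kequiv_ctx[OF kk_braid[of "a - n" "b - n"], of "above n u" "above n v"]
      kk_kequiv_ctx[OF kk_sym[OF kk_idem[of "b - n"]], of "above n u" "above n v"]
    by (auto simp: above_Cons)
next
  case (3 a b c u v)
  then show ?case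
    using kk_kequiv_ctx[OF kk_bac[of "a - n" "b - n" "c - n"], of "above n u" "above n v"]
    by (auto simp: above_Cons)
next
  case (4 a b c u v)
  then show ?case
    using kk_kequiv_ctx[OF kk_acb[of "a - n" "b - n" "c - n"], of "above n u" "above n v"]
    by (auto simp: above_Cons)
next
  case (5 a b u)
  then show ?case using kequiv_swap[of "a - n" "b - n" "above n u"] by (auto simp: above_Cons)
qed

lemma kequiv_above: "kequiv u v \<Longrightarrow> kequiv (above n u) (above n v)"
proof -
  assume "kequiv u v"
  then have "sym_kstep\<^sup>*\<^sup>* u v" by (simp add: kequiv_def)
  then show ?thesis
  proof (induction rule: rtranclp_induct)
    case (step y z)
    then have "kequiv (above n y) (above n z)" using kstep_above kequiv_sym by blast
    with step.IH show ?case by (rule kequiv_trans)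
  qed simp
qed

subsection \<open>Separating small and large letters\<close>

lemma slex_le: "slex = (\<le>)"
  by (auto simp: slex_def less_eq_prod_def fun_eq_iff)

lemma Kcoeff_BW:
  assumes "sym_incr E" "upset E = shifted_shape nu" "finite {i. m i \<noteq> 0}"
  shows "Kcoeff nu m = card (BW E m)"
proof -
  have "{T. wsvt nu T \<and> wt nu T = m} = WT E m"
    unfolding WT_def wsvt_iff_wsv[OF finite_shifted_shape] assms(2) by (simp add: wt_def wts_def fun_eq_iff)
  then show ?thesis using balanced_all[OF assms(1,3)] by (simp add: Kcoeff_def balanced_def)
qed

lemma finite_BW: "sym_incr E \<Longrightarrow> finite {i. m i \<noteq> 0} \<Longrightarrow> finite (BW E m)"
  using balanced_all by (simp add: balanced_def)

lemma word_kequiv_P: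
  "(\<And>x. x \<in> set w \<Longrightarrow> 1 \<le> x) \<Longrightarrow> kequiv w (row_word (P_ins w))"
  using word_kequiv P_ins_eq by blast

lemma word_kequiv_toD:
  "(\<And>x. x \<in> set w \<Longrightarrow> 1 \<le> x) \<Longrightarrow> tri T \<Longrightarrow> ins_word w = toD T \<longleftrightarrow> P_ins w = T"
  using P_ins_eq tri_eqI by metis

text \<open>The weak relation preserves the set of letters, so a word uses exactly the entries of
  its insertion tableau.\<close>

lemma BW_letters_le:
  assumes "sym_incr E" "\<And>i j. E i j \<noteq> \<infinity> \<Longrightarrow> E i j \<le> enat n" "xs \<in> BW E m" "p \<in> set xs"
  shows "snd p \<le> n"
proof -
  have E: "toD (fromD E) = ins_word (map snd xs)" using toD_fromD[OF assms(1)] assms(3) by (simp add: BW_def)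
  obtain B where B: "bnd B E" using ex_bnd[OF assms(1)] by blast
  have "kequiv (map snd xs) (row_word (fromD E))"
    using BW_letters[OF assms(3)] by (intro word_kequiv tri_fromD E)
  then have "snd p \<in> set (row_word (fromD E))" using kequiv_set assms(4) by fastforce
  then have "snd p \<in> set (row_reading E 0 B 0 B)"
    using row_word_RWd[OF tri_fromD, of B E] B toD_fromD[OF assms(1)] by simp
  then obtain r c where "E r c = enat (snd p)" by (auto simp: in_RWd)
  then show ?thesis using assms(2)[of r c] by simp
qed

text \<open>These biwords are counted twice: by splitting them into small and large letters
  (\<open>lo_hi_bij\<close>) and by their insertion tableau
  (\<open>Omega_partition\<close>).\<close>

definition Omega :: "nat \<Rightarrow> mat \<Rightarrow> mat \<Rightarrow> (nat \<Rightarrow> nat) \<Rightarrow> (nat \<times> nat) list set" where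
  "Omega n E F m = {xs \<in> biwords m. restrict_le n (ins_word (map snd xs)) = E \<and> ins_word (above n (map snd xs)) = F}"

definition lo :: "nat \<Rightarrow> (nat \<times> nat) list \<Rightarrow> (nat \<times> nat) list" where
  "lo n xs = filter (\<lambda>p. snd p \<le> n) xs"
definition hi :: "nat \<Rightarrow> (nat \<times> nat) list \<Rightarrow> (nat \<times> nat) list" where
  "hi n xs = map (\<lambda>p. (fst p, snd p - n)) (filter (\<lambda>p. n < snd p) xs)"
definition content :: "(nat \<times> nat) list \<Rightarrow> nat \<Rightarrow> nat" where
  "content xs i = length (filter (\<lambda>p. fst p = i) xs)"

lemma biwords_iff: "xs \<in> biwords m \<longleftrightarrow> sorted xs \<and> (\<forall>p\<in>set xs. 1 \<le> fst p \<and> 1 \<le> snd p) \<and> content xs = m"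
  by (auto simp: biwords_def slex_le content_def fun_eq_iff)

lemma map_snd_lo: "map snd (lo n xs) = filter (\<lambda>x. x \<le> n) (map snd xs)"
  by (simp add: lo_def filter_map comp_def)

lemma map_snd_hi: "map snd (hi n xs) = above n (map snd xs)"
  by (simp add: hi_def above_def filter_map comp_def)

lemma content_lo_hi: "content (lo n xs) i + content (hi n xs) i = content xs i"
  by (induction xs) (auto simp: lo_def hi_def content_def)

lemma sorted_hi:
  assumes "sorted xs"
  shows "sorted (hi n xs)"
proof -
  have "sorted_wrt (\<le>) (filter (\<lambda>p. n < snd p) xs)" using assms by (rule sorted_wrt_filter)
  then have "sorted_wrt (\<lambda>p q. (fst p, snd p - n) \<le> (fst q, snd q - n)) (filter (\<lambda>p. n < snd p) xs)"
    by (rule sorted_wrt_mono_rel[rotated]) (auto simp: less_eq_prod_def)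
  then show ?thesis by (simp add: hi_def sorted_wrt_map)
qed

text \<open>A sorted list is determined by its multiset, and shifting by \<open>n\<close> is
  injective on the letters above \<open>n\<close>.\<close>

lemma lo_hi_inj:
  assumes "sorted xs" "sorted ys" "lo n xs = lo n ys" "hi n xs = hi n ys"
  shows "xs = ys"
proof -
  let ?P = "\<lambda>p :: nat \<times> nat. n < snd p"
  have inj: "inj_on (\<lambda>p. (fst p, snd p - n)) {p :: nat \<times> nat. n < snd p}"
    by (auto simp: inj_on_def prod_eq_iff)
  have hi: "filter ?P xs = filter ?P ys"
  proof (rule map_inj_on)
    show "map (\<lambda>p. (fst p, snd p - n)) (filter ?P xs) = map (\<lambda>p. (fst p, snd p - n)) (filter ?P ys)"
      using assms(4) by (simp add: hi_def)
    show "inj_on (\<lambda>p. (fst p, snd p - n)) (set (filter ?P xs) \<union> set (filter ?P ys))"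
      by (rule inj_on_subset[OF inj]) auto
  qed
  have "mset zs = mset (lo n zs) + mset (filter ?P zs)" for zs
    using multiset_partition[of "mset zs" ?P] by (simp add: lo_def not_less add.commute)
  then have "mset xs = mset ys" using assms(3) hi by metis
  then show ?thesis using properties_for_sort[of xs ys] properties_for_sort[of ys ys] assms by metis
qed

lemma lo_hi_bij:
  assumes E: "sym_incr E" "\<And>i j. E i j \<noteq> \<infinity> \<Longrightarrow> E i j \<le> enat n"
  shows "bij_betw (\<lambda>xs. (lo n xs, hi n xs)) (Omega n E F m)
    (\<Union>(m1, m2)\<in>{(m1, m2). \<forall>i. m1 i + m2 i = m i}. BW E m1 \<times> BW F m2)"
proof (rule bij_betw_imageI)
  let ?M = "{(m1, m2). \<forall>i. m1 i + m2 i = m i}"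
  show "inj_on (\<lambda>xs. (lo n xs, hi n xs)) (Omega n E F m)"
    by (rule inj_onI) (auto simp: Omega_def biwords_iff intro: lo_hi_inj)
  show "(\<lambda>xs. (lo n xs, hi n xs)) ` Omega n E F m = (\<Union>(m1, m2)\<in>?M. BW E m1 \<times> BW F m2)"
  proof (intro equalityI subsetI)
    fix q assume "q \<in> (\<lambda>xs. (lo n xs, hi n xs)) ` Omega n E F m"
    then obtain xs where xs: "xs \<in> Omega n E F m" "q = (lo n xs, hi n xs)" by blast
    then have b: "sorted xs" "\<forall>p\<in>set xs. 1 \<le> fst p \<and> 1 \<le> snd p" "content xs = m"
      and c: "restrict_le n (ins_word (map snd xs)) = E" "ins_word (above n (map snd xs)) = F"
      by (auto simp: Omega_def biwords_iff)
    have "lo n xs \<in> BW E (content (lo n xs))"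
    proof -
      have "ins_word (filter (\<lambda>x. x \<le> n) (map snd xs)) = E"
        using cut_insw[of "map snd xs" n] b(2) c(1) by fastforce
      moreover have "sorted (lo n xs)" "set (lo n xs) \<subseteq> set xs"
        using b(1) by (auto simp: lo_def sorted_wrt_filter)
      ultimately show ?thesis using b(2) unfolding BW_def biwords_iff map_snd_lo[symmetric] by auto
    qed
    moreover have "hi n xs \<in> BW F (content (hi n xs))"
    proof -
      have "\<forall>p\<in>set (hi n xs). 1 \<le> fst p \<and> 1 \<le> snd p" using b(2) by (auto simp: hi_def)
      then show ?thesis
        using sorted_hi[OF b(1)] c(2) unfolding BW_def biwords_iff map_snd_hi[symmetric] by auto
    qed
    moreover have "(content (lo n xs), content (hi n xs)) \<in> ?M" using content_lo_hi b(3) by auto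
    ultimately show "q \<in> (\<Union>(m1, m2)\<in>?M. BW E m1 \<times> BW F m2)" using xs(2) by blast
  next
    fix q assume "q \<in> (\<Union>(m1, m2)\<in>?M. BW E m1 \<times> BW F m2)"
    then obtain m1 m2 ys zs where q: "q = (ys, zs)" "ys \<in> BW E m1" "zs \<in> BW F m2"
      and m: "\<forall>i. m1 i + m2 i = m i" by blast
    let ?up = "\<lambda>p :: nat \<times> nat. (fst p, snd p + n)"
    \<comment> \<open>Merging is sorting. Filtering commutes with it, so both parts come back
      unchanged.\<close>
    define xs where "xs = sort (ys @ map ?up zs)"
    have y: "sorted ys" "\<forall>p\<in>set ys. 1 \<le> fst p \<and> 1 \<le> snd p" "content ys = m1" "ins_word (map snd ys) = E"
      and z: "sorted zs" "\<forall>p\<in>set zs. 1 \<le> fst p \<and> 1 \<le> snd p" "content zs = m2" "ins_word (map snd zs) = F"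
      using q by (auto simp: BW_def biwords_iff)
    have yn: "\<forall>p\<in>set ys. snd p \<le> n" using BW_letters_le[OF E q(2)] by blast
    have zn: "\<forall>p\<in>set (map ?up zs). n < snd p" using z(2) by auto
    have "filter (\<lambda>p. snd p \<le> n) (map ?up zs) = []" using zn by (auto simp: filter_empty_conv)
    moreover have "filter (\<lambda>p. snd p \<le> n) ys = ys" using yn by (simp add: filter_id_conv)
    ultimately have lo: "lo n xs = ys"
      using y(1) by (simp add: lo_def xs_def filter_sort sorted_sort_id)
    have "filter (\<lambda>p. n < snd p) ys = []" using yn by (auto simp: filter_empty_conv not_less)
    moreover have "filter (\<lambda>p. n < snd p) (map ?up zs) = map ?up zs" using zn by (simp add: filter_id_conv)
    moreover have "sorted (map ?up zs)"
      using z(1) by (auto simp: sorted_wrt_map less_eq_prod_def elim!: sorted_wrt_mono_rel[rotated])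
    ultimately have hi: "hi n xs = zs"
      by (simp add: hi_def xs_def filter_sort sorted_sort_id comp_def)
    have "content xs = m" using content_lo_hi[of n xs] lo hi y(3) z(3) m by (auto simp: fun_eq_iff)
    then have "xs \<in> biwords m" using y(2) z(2) by (auto simp: biwords_iff xs_def)
    moreover have "restrict_le n (ins_word (map snd xs)) = E"
      using cut_insw[of "map snd xs" n] map_snd_lo[of n xs] lo y(4) \<open>xs \<in> biwords m\<close>
      by (auto simp: biwords_iff)
    moreover have "ins_word (above n (map snd xs)) = F" using map_snd_hi[of n xs] hi z(4) by simp
    ultimately show "q \<in> (\<lambda>xs. (lo n xs, hi n xs)) ` Omega n E F m"
      using lo hi q(1) by (auto simp: Omega_def image_iff)
  qed
qed

lemma finite_splittings:
  assumes "finite {i. m i \<noteq> (0 :: nat)}"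
  shows "finite {(m1, m2). \<forall>i. m1 i + m2 i = m i}"
proof (rule finite_subset)
  let ?A = "{i. m i \<noteq> 0}"
  let ?F = "{f. \<forall>i. (i \<in> ?A \<longrightarrow> f i \<in> (\<Union>i\<in>?A. {..m i})) \<and> (i \<notin> ?A \<longrightarrow> f i = 0)}"
  show "finite (?F \<times> ?F)"
    using assms by (intro finite_cartesian_product finite_set_of_finite_funs finite_UN_I) auto
  show "{(m1, m2). \<forall>i. m1 i + m2 i = m i} \<subseteq> ?F \<times> ?F"
  proof clarsimp
    fix m1 m2 :: "'a \<Rightarrow> nat" assume a: "\<forall>i. m1 i + m2 i = m i"
    then have le: "m1 i \<le> m i" "m2 i \<le> m i" for i by (metis le_add1, metis le_add2)
    show "(\<forall>i. (0 < m i \<longrightarrow> (\<exists>x. 0 < m x \<and> m1 i \<le> m x)) \<and> (m i = 0 \<longrightarrow> m1 i = 0)) \<and>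
        (\<forall>i. (0 < m i \<longrightarrow> (\<exists>x. 0 < m x \<and> m2 i \<le> m x)) \<and> (m i = 0 \<longrightarrow> m2 i = 0))"
      using le by (metis le_zero_eq)
  qed
qed

lemma card_Omega_product:
  assumes E: "sym_incr E" "\<And>i j. E i j \<noteq> \<infinity> \<Longrightarrow> E i j \<le> enat n" and F: "sym_incr F"
    and m: "finite {i. m i \<noteq> 0}"
  shows "card (Omega n E F m) =
    (\<Sum>(m1, m2) \<in> {(m1, m2). \<forall>i. m1 i + m2 i = m i}. card (BW E m1) * card (BW F m2))"
proof -
  let ?M = "{(m1, m2). \<forall>i. m1 i + m2 i = m i}"
  let ?B = "\<lambda>q. BW E (fst q) \<times> BW F (snd q)"
  have fin: "finite {i. m1 i \<noteq> 0}" "finite {i. m2 i \<noteq> 0}" if "(m1, m2) \<in> ?M" for m1 m2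
  proof -
    have s: "m1 i + m2 i = m i" for i using that by simp
    have "m1 i \<noteq> 0 \<Longrightarrow> m i \<noteq> 0" "m2 i \<noteq> 0 \<Longrightarrow> m i \<noteq> 0" for i using s[of i] by simp_all
    then have "{i. m1 i \<noteq> 0} \<subseteq> {i. m i \<noteq> 0}" "{i. m2 i \<noteq> 0} \<subseteq> {i. m i \<noteq> 0}" by blast+
    then show "finite {i. m1 i \<noteq> 0}" "finite {i. m2 i \<noteq> 0}" using m finite_subset by blast+
  qed
  have "card (Omega n E F m) = card (\<Union>q\<in>?M. ?B q)"
    using bij_betw_same_card[OF lo_hi_bij[OF E, of F m]] by (simp add: case_prod_unfold)
  also have "\<dots> = (\<Sum>q\<in>?M. card (?B q))"
  proof (rule card_UN_disjoint)
    show "finite ?M" by (rule finite_splittings[OF m])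
    show "\<forall>q\<in>?M. finite (?B q)" using fin finite_BW E(1) F by auto
    have "q = q'" if "(xs, ys) \<in> ?B q" "(xs, ys) \<in> ?B q'" for q q' xs ys
      using that by (auto simp: BW_def biwords_iff prod_eq_iff)
    then show "\<forall>q\<in>?M. \<forall>q'\<in>?M. q \<noteq> q' \<longrightarrow> ?B q \<inter> ?B q' = {}" by fast
  qed
  finally show ?thesis by (simp add: card_cartesian_product case_prod_unfold)
qed

subsection \<open>Skew parts\<close>

definition skew :: "nat \<Rightarrow> mat \<Rightarrow> tab" where
  "skew n E = (\<lambda>(i, j). if i \<le> j \<and> E i j \<noteq> \<infinity> \<and> enat n < E i j then Some (the_enat (E i j) - n) else None)"

text \<open>The inverse of \<open>skew\<close> on matrices whose part with entries up to
  \<open>n\<close> is \<open>E\<close>.\<close>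

definition glue :: "nat \<Rightarrow> mat \<Rightarrow> tab \<Rightarrow> mat" where
  "glue n E R i j = (if E i j \<noteq> \<infinity> then E i j else
     case R (min i j, max i j) of None \<Rightarrow> \<infinity> | Some v \<Rightarrow> enat (v + n))"

lemma above_concat: "above n (concat xss) = concat (map (above n) xss)"
  by (induction xss) auto

lemma row_word_skew:
  assumes E: "sym_incr E"
  shows "row_word (skew n E) = above n (row_word (fromD E))"
proof -
  obtain B where B: "bnd B E" using ex_bnd[OF E] by blast
  have sub: "dom (fromD E) \<subseteq> {..<B} \<times> {..<B}" "dom (skew n E) \<subseteq> {..<B} \<times> {..<B}"
    using B by (auto simp: bnd_def fromD_def skew_def not_le[symmetric] split: if_splits)
  have row: "above n (map (\<lambda>j. the (fromD E (i, j))) (filter (\<lambda>j. (i, j) \<in> dom (fromD E)) js)) =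
      map (\<lambda>j. the (skew n E (i, j))) (filter (\<lambda>j. (i, j) \<in> dom (skew n E)) js)" for i js
  proof (induction js)
    case (Cons j js)
    then show ?case
      by (cases "E i j") (auto simp: above_Cons fromD_def skew_def)
  qed simp
  show ?thesis
    unfolding row_word_rw[OF sub(1)] row_word_rw[OF sub(2)] rw_def above_concat
    by (simp add: comp_def row)
qed

text \<open>The word of large letters and the row word of the skew part are weakly equivalent, and
  URT makes inserting to \<open>T\<close> a property of the equivalence class.\<close>

lemma skew_iff:
  assumes w: "\<And>x. x \<in> set w \<Longrightarrow> 1 \<le> x" and T: "URT T"
  shows "ins_word (above n w) = toD T \<longleftrightarrow> P_ins (row_word (skew n (ins_word w))) = T"
proof -
  let ?E = "ins_word w"
  let ?r = "row_word (skew n ?E)"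
  have E: "sym_incr ?E" using sm_insw w by blast
  have tri: "tri T" using T by (simp add: URT_def inc_tab_iff)
  have aw: "1 \<le> x" if "x \<in> set (above n w)" for x using that by (auto simp: above_def)
  have ar: "1 \<le> x" if "x \<in> set ?r" for x using that by (auto simp: above_def row_word_skew[OF E])
  have "kequiv w (row_word (fromD ?E))" using word_kequiv[OF w tri_fromD toD_fromD[OF E]] .
  then have eq: "kequiv (above n w) ?r" unfolding row_word_skew[OF E] by (rule kequiv_above)
  have urt: "P_ins v = T" if "kequiv v u" "P_ins u = T" "\<And>x. x \<in> set u \<Longrightarrow> 1 \<le> x" for u v
  proof -
    have "kequiv v (row_word T)" using that word_kequiv_P[of u] kequiv_trans by blast
    then show ?thesis using T by (simp add: URT_def)
  qed
  have "ins_word (above n w) = toD T \<longleftrightarrow> P_ins (above n w) = T" by (rule word_kequiv_toD[OF aw tri])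
  also have "\<dots> \<longleftrightarrow> P_ins ?r = T" using urt[OF eq _ ar] urt[OF kequiv_sym[OF eq] _ aw] by blast
  finally show ?thesis .
qed

lemma set_row_word:
  assumes "finite (dom R)"
  shows "set (row_word R) = ran R"
proof -
  obtain b where b: "\<forall>x\<in>fst ` dom R \<union> snd ` dom R. x < b"
    using assms finite_nat_set_iff_bounded[of "fst ` dom R \<union> snd ` dom R"] by auto
  then have sub: "dom R \<subseteq> {..<b} \<times> {..<b}" by force
  show ?thesis
    unfolding row_word_rw[OF sub] rw_def
  proof (intro equalityI subsetI)
    fix v assume "v \<in> ran R"
    then obtain i j where ij: "R (i, j) = Some v" by (auto simp: ran_def)
    then have "i < b" "j < b" using sub by auto
    then show "v \<in> set (concat (map (\<lambda>i. map (\<lambda>j. the (R (i, j))) (filter (\<lambda>j. (i, j) \<in> dom R) [0..<b])) (rev [0..<b])))"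
      using ij by (force intro!: bexI[of _ i] image_eqI[of _ _ j])
  qed (auto intro: ranI)
qed

definition skews :: "nat list \<Rightarrow> nat list \<Rightarrow> tab \<Rightarrow> tab set" where
  "skews lam nu T = {R. dom R = skew_shape nu lam \<and> increasing R \<and> P_ins (row_word R) = T}"

definition glued :: "nat \<Rightarrow> mat \<Rightarrow> nat list \<Rightarrow> tab \<Rightarrow> mat set" where
  "glued n E0 nu T =
     {E. sym_incr E \<and> upset E = shifted_shape nu \<and> restrict_le n E = E0 \<and> P_ins (row_word (skew n E)) = T}"

lemma skew_bij:
  assumes lam: "strict_partition nu" "shifted_shape lam \<subseteq> shifted_shape nu"
    and E0: "sym_incr E0" "upset E0 = shifted_shape lam" "\<And>i j. E0 i j \<noteq> \<infinity> \<Longrightarrow> E0 i j \<le> enat n"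
  shows "bij_betw (skew n) (glued n E0 nu T) (skews lam nu T)"
proof (rule bij_betw_byWitness[where f' = "glue n E0"])
  have in_lam: "E0 i j \<noteq> \<infinity> \<longleftrightarrow> (min i j, max i j) \<in> shifted_shape lam" for i j
    using sm_sym[OF E0(1), of i j] unfolding E0(2)[symmetric] by (auto simp: upset_def min_def max_def)
  have skew: "skew n E \<in> skews lam nu T \<and> glue n E0 (skew n E) = E" if G: "E \<in> glued n E0 nu T" for E
  proof -
    have E: "sym_incr E" "upset E = shifted_shape nu" "restrict_le n E = E0" "P_ins (row_word (skew n E)) = T"
      using G by (auto simp: glued_def)
    have E0E: "E0 i j = (if E i j \<le> enat n then E i j else \<infinity>)" for i j using E(3) by (auto simp: restrict_le_def)
    have "dom (skew n E) = upset E - upset E0"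
      unfolding upset_def E0E by (auto simp: skew_def not_le split: if_splits)
    then have dom: "dom (skew n E) = skew_shape nu lam" using E(2) E0(2) by (simp add: skew_shape_def)
    have val: "E i j = enat (a + n) \<and> 0 < a" if "skew n E (i, j) = Some a" for i j a
      using that by (cases "E i j") (auto simp: skew_def split: if_splits)
    have "increasing (skew n E)"
      unfolding increasing_def
    proof (intro conjI ballI allI impI)
      fix a assume "a \<in> ran (skew n E)"
      then show "0 < a" using val by (auto simp: ran_def)
    next
      fix i j j' a b assume "skew n E (i, j) = Some a \<and> skew n E (i, j') = Some b \<and> j < j'"
      then show "a < b" using sm_less[OF E(1), of j j' i] val[of i j a] val[of i j' b] by simp
    next
      fix i i' j a b assume "skew n E (i, j) = Some a \<and> skew n E (i', j) = Some b \<and> i < i'"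
      then show "a < b" using sm_less'[OF E(1), of i i' j] val[of i j a] val[of i' j b] by simp
    qed
    moreover have "glue n E0 (skew n E) i j = E i j" for i j
      using sm_sym[OF E(1), of j i] E0E[of i j]
      by (cases "E i j") (auto simp: glue_def skew_def min_def max_def split: if_splits)
    ultimately show ?thesis using dom E(4) by (auto simp: skews_def)
  qed
  then show "\<forall>E\<in>glued n E0 nu T. glue n E0 (skew n E) = E"
    and "skew n ` glued n E0 nu T \<subseteq> skews lam nu T" by blast+
  have glue: "glue n E0 R \<in> glued n E0 nu T \<and> skew n (glue n E0 R) = R" if S: "R \<in> skews lam nu T" for R
  proof -
    let ?E = "glue n E0 R"
    have R: "dom R = skew_shape nu lam" "increasing R" "P_ins (row_word R) = T"
      using S by (auto simp: skews_def)
    have Rpos: "0 < v" if "R p = Some v" for p v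
      using R(2) ranI[of R p v, OF that] unfolding increasing_def by blast
    have lamE: "?E i j = E0 i j \<and> ?E i j \<le> enat n" if "(i, j) \<in> shifted_shape lam" "i \<le> j" for i j
      using in_lam[of i j] that E0(3)[of i j] by (simp add: glue_def)
    have R_E: "?E i j = enat (v + n)" if "R (i, j) = Some v" for i j v
    proof -
      have "(i, j) \<in> skew_shape nu lam" using that R(1) by blast
      then have "i \<le> j" "(i, j) \<notin> shifted_shape lam" by (auto simp: skew_shape_def shifted_shape_iff)
      then show ?thesis using in_lam[of i j] that by (simp add: glue_def)
    qed
    have dich: "(i, j) \<in> shifted_shape lam \<or> (\<exists>v. R (i, j) = Some v)" if "(i, j) \<in> shifted_shape nu" for i j
      using that R(1) by (auto simp: skew_shape_def)
    have sym: "?E i j = ?E j i" for i j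
      using sm_sym[OF E0(1), of i j] by (simp add: glue_def min.commute max.commute)
    have dom: "?E i j \<noteq> \<infinity> \<longleftrightarrow> (i, j) \<in> shifted_shape nu" if "i \<le> j" for i j
    proof
      assume "?E i j \<noteq> \<infinity>"
      then have "(i, j) \<in> shifted_shape lam \<or> (i, j) \<in> dom R"
        using that in_lam[of i j] by (auto simp: glue_def split: if_splits option.splits)
      then show "(i, j) \<in> shifted_shape nu" using lam(2) R(1) by (auto simp: skew_shape_def)
    next
      assume "(i, j) \<in> shifted_shape nu"
      then show "?E i j \<noteq> \<infinity>" using dich lamE[OF _ that] R_E enat_le_fin by fastforce
    qed
    have tri: "i \<le> j" if "(i, j) \<in> shifted_shape mu" for i j mu using that by (simp add: shifted_shape_iff)
    \<comment> \<open>Rows and columns are treated alike. Across the border between \<lambda> and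
      the skew part the inequality is automatic, as \<open>n\<close> separates the two.\<close>
    have step: "?E i j < ?E i' j'"
      if nu: "(i, j) \<in> shifted_shape nu" "(i', j') \<in> shifted_shape nu"
        and close: "(i', j') \<in> shifted_shape lam \<Longrightarrow> (i, j) \<in> shifted_shape lam"
        and lt: "E0 i' j' \<noteq> \<infinity> \<Longrightarrow> E0 i j < E0 i' j'"
        and inc: "\<And>a b. R (i, j) = Some a \<Longrightarrow> R (i', j') = Some b \<Longrightarrow> a < b"
      for i j i' j'
    proof (cases "(i', j') \<in> shifted_shape lam")
      case True
      then have "E0 i' j' \<noteq> \<infinity>" using in_lam[of i' j'] tri[OF True] by simp
      then show ?thesis using lamE[OF True tri[OF True]] lamE[OF close[OF True] tri[OF close[OF True]]] lt by simp
    next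
      case False
      then obtain b where b: "R (i', j') = Some b" using dich[OF nu(2)] by blast
      then have Eb: "?E i' j' = enat (b + n)" "0 < b" using R_E Rpos by auto
      show ?thesis
      proof (cases "(i, j) \<in> shifted_shape lam")
        case True
        then have "?E i j \<le> enat n" using lamE[OF True tri[OF True]] by blast
        also have "enat n < ?E i' j'" using Eb by simp
        finally show ?thesis .
      next
        case False
        then obtain a where a: "R (i, j) = Some a" using dich[OF nu(1)] by blast
        then show ?thesis using R_E[OF a] Eb inc[OF a b] by simp
      qed
    qed
    have smE: "sym_incr ?E"
    proof (rule sm_of_shape[OF lam(1)])
      fix i j
      show "?E i j \<noteq> \<infinity> \<longleftrightarrow> (i, j) \<in> shifted_shape nu" if "i \<le> j" by (rule dom[OF that])
      show "?E i j = ?E j i" by (rule sym)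
      show "0 < ?E i j"
        using sm_pos[OF E0(1), of i j] Rpos by (auto simp: glue_def zero_enat_def split: option.splits)
      show "?E i j < ?E i (Suc j)"
        if "(i, j) \<in> shifted_shape nu" "(i, Suc j) \<in> shifted_shape nu"
      proof (rule step[OF that])
        show "(i, j) \<in> shifted_shape lam" if "(i, Suc j) \<in> shifted_shape lam"
          using shifted_shape_left[OF that] tri \<open>(i, j) \<in> shifted_shape nu\<close> by blast
        show "E0 i j < E0 i (Suc j)" if "E0 i (Suc j) \<noteq> \<infinity>" by (rule sm_Suc[OF E0(1) that])
        show "a < b" if "R (i, j) = Some a" "R (i, Suc j) = Some b" for a b
          using R(2) that lessI[of j] unfolding increasing_def by blast
      qed
      show "?E i j < ?E (Suc i) j"
        if "(i, j) \<in> shifted_shape nu" "(Suc i, j) \<in> shifted_shape nu"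
      proof (rule step[OF that])
        show lt: "E0 i j < E0 (Suc i) j" if "E0 (Suc i) j \<noteq> \<infinity>"
          using sm_Suc[OF E0(1), of j i] that sm_sym[OF E0(1)] by metis
        show "(i, j) \<in> shifted_shape lam" if "(Suc i, j) \<in> shifted_shape lam"
        proof -
          have "E0 (Suc i) j \<noteq> \<infinity>" using in_lam[of "Suc i" j] tri[OF that] that by simp
          then have "E0 i j \<noteq> \<infinity>" using lt enat_less_fin by blast
          then show ?thesis using in_lam[of i j] tri[OF that] by simp
        qed
        show "a < b" if "R (i, j) = Some a" "R (Suc i, j) = Some b" for a b
          using R(2) that lessI[of i] unfolding increasing_def by blast
      qed
    qed
    have "upset ?E = shifted_shape nu"
    proof (rule set_eqI)
      fix p :: "nat \<times> nat"
      obtain i j where "p = (i, j)" by force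
      then show "p \<in> upset ?E \<longleftrightarrow> p \<in> shifted_shape nu"
        using dom[of i j] tri[of i j nu] by (auto simp: upset_def)
    qed
    moreover have "restrict_le n ?E = E0"
    proof (intro ext)
      fix i j
      show "restrict_le n ?E i j = E0 i j"
      using E0(3)[of i j] Rpos by (auto simp: restrict_le_def glue_def split: option.splits)
    qed
    moreover have sk: "skew n ?E = R"
    proof
      fix p :: "nat \<times> nat"
      obtain i j where p: "p = (i, j)" by force
      show "skew n ?E p = R p"
      proof (cases "R (i, j)")
        case None
        have "\<not> (i \<le> j \<and> ?E i j \<noteq> \<infinity> \<and> enat n < ?E i j)"
          using dom[of i j] dich[of i j] lamE[of i j] None by auto
        then show ?thesis using None p by (simp add: skew_def)
      next
        case (Some v)
        then have "(i, j) \<in> skew_shape nu lam" using R(1) by blast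
        then have "i \<le> j" by (auto simp: skew_shape_def shifted_shape_iff)
        then show ?thesis using R_E[OF Some] Rpos[OF Some] Some p by (simp add: skew_def)
      qed
    qed
    ultimately show ?thesis using smE R(3) by (simp add: glued_def)
  qed
  then show "\<forall>R\<in>skews lam nu T. skew n (glue n E0 R) = R"
    and "glue n E0 ` skews lam nu T \<subseteq> glued n E0 nu T" by blast+
qed

text \<open>The entries are not bounded by definition, but inserting to \<open>T\<close> forces them
  to be letters of the row word of \<open>T\<close>.\<close>

lemma finite_skews: "finite (skews lam nu T)"
proof (rule finite_subset)
  show "skews lam nu T \<subseteq> {R. dom R = skew_shape nu lam \<and> ran R \<subseteq> set (row_word T)}"
  proof
    fix R assume "R \<in> skews lam nu T"
    then have R: "dom R = skew_shape nu lam" "increasing R" "P_ins (row_word R) = T"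
      by (auto simp: skews_def)
    have fin: "finite (dom R)" unfolding R(1) skew_shape_def using finite_shifted_shape by blast
    have "\<forall>a\<in>ran R. 0 < a" using R(2) unfolding increasing_def by (elim conjE)
    then have "1 \<le> x" if "x \<in> set (row_word R)" for x
      using that unfolding set_row_word[OF fin] by (simp add: Suc_le_eq)
    then have "kequiv (row_word R) (row_word T)" using word_kequiv_P[of "row_word R"] R(3) by simp
    then show "R \<in> {R. dom R = skew_shape nu lam \<and> ran R \<subseteq> set (row_word T)}"
      using kequiv_set set_row_word[OF fin] R(1) by blast
  qed
  show "finite {R. dom R = skew_shape nu lam \<and> ran R \<subseteq> set (row_word T)}"
    by (intro finite_set_of_finite_maps) (auto simp: skew_shape_def finite_shifted_shape)
qed


subsection \<open>The product formula\<close>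

lemma shifted_shape_Sigma: "shifted_shape nu = (SIGMA i:{..<length nu}. {i..<i + nu ! i})"
  by (auto simp: shifted_shape_def)

lemma card_shifted_shape: "card (shifted_shape nu) = sum_list nu"
  by (simp add: shifted_shape_Sigma sum_list_sum_nth atLeast0LessThan)

lemma shifted_shape_inj:
  assumes "strict_partition nu" "strict_partition nu'" "shifted_shape nu = shifted_shape nu'"
  shows "nu = nu'"
proof -
  have iff: "i < length nu \<longleftrightarrow> i < length nu'" for i
  proof -
    have "i < length nu \<longleftrightarrow> (i, i) \<in> shifted_shape nu"
      using strict_partition_pos[OF assms(1), of i] by (auto simp: shifted_shape_iff)
    also have "\<dots> \<longleftrightarrow> i < length nu'"
      using strict_partition_pos[OF assms(2), of i] by (auto simp: assms(3) shifted_shape_iff)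
    finally show ?thesis .
  qed
  show ?thesis
  proof (rule nth_equalityI)
    show len: "length nu = length nu'" using iff by (metis linorder_neqE_nat less_irrefl)
    fix i assume i: "i < length nu"
    have "j < i + nu ! i \<longleftrightarrow> j < i + nu' ! i" if "i \<le> j" for j
      using assms(3) i len that shifted_shape_iff[of i j nu] shifted_shape_iff[of i j nu'] by simp
    from this[of "i + nu ! i"] this[of "i + nu' ! i"] show "nu ! i = nu' ! i" by simp
  qed
qed

lemma finite_partitions: "finite {nu. strict_partition nu \<and> P nu \<and> sum_list nu \<le> d}"
proof (rule finite_subset)
  show "finite {xs. set xs \<subseteq> {..d} \<and> length xs \<le> d}" by (intro finite_lists_length_le) simp
  have "length xs \<le> sum_list xs" if "0 \<notin> set xs" for xs :: "nat list"
    using that by (induction xs) (auto simp: Suc_le_eq)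
  moreover have "x \<le> sum_list xs" if "x \<in> set xs" for x and xs :: "nat list"
    using that by (auto intro: member_le_sum_list)
  ultimately show "{nu. strict_partition nu \<and> P nu \<and> sum_list nu \<le> d} \<subseteq> {xs. set xs \<subseteq> {..d} \<and> length xs \<le> d}"
    by (fastforce simp: strict_partition_def)
qed

text \<open>An insertion adds at most one box. This bounds the size of \<nu> by the degree of the
  monomial.\<close>

lemma card_upset_insw: "(\<And>x. x \<in> set w \<Longrightarrow> 1 \<le> x) \<Longrightarrow> card (upset (ins_word w)) \<le> length w"
proof (induction w rule: rev_induct)
  case (snoc x w)
  let ?D = "ins_word w"
  have v: "valid ?D 0 (enat x)" using snoc.prems by (intro valid_insw) auto
  let ?E = "ins ?D (enat x)"
  have "upset ?E \<subseteq> insert (tab_box (box ?D (enat x))) (upset ?D)"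
    using ins_record_upset[OF v] by (auto split: if_splits)
  then have "card (upset ?E) \<le> card (insert (tab_box (box ?D (enat x))) (upset ?D))"
    using finite_upset[OF validD(1)[OF v]] by (intro card_mono) auto
  also have "\<dots> \<le> Suc (card (upset ?D))" 
    by (simp add: card_insert_if finite_upset[OF validD(1)[OF v]])
  finally show ?case using snoc by simp
qed (simp add: upset_def)

lemma length_biword:
  assumes "xs \<in> biwords m" "finite {i. m i \<noteq> 0}"
  shows "length xs = mdeg m"
proof -
  have "length ys = (\<Sum>i\<in>A. content ys i)" if "finite A" "fst ` set ys \<subseteq> A" for A ys
    using that
  proof (induction ys)
    case (Cons y ys)
    have "(\<Sum>i\<in>A. content (y # ys) i) = (\<Sum>i\<in>A. (if i = fst y then 1 else 0) + content ys i)"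
      by (intro sum.cong) (auto simp: content_def)
    also have "\<dots> = 1 + length ys" using Cons by (simp add: sum.distrib)
    finally show ?case by simp
  qed (simp add: content_def)
  moreover have "fst ` set xs \<subseteq> {i. m i \<noteq> 0}" using biwords_content[OF assms(1)] by auto
  ultimately show ?thesis using assms by (auto simp: mdeg_def biwords_iff)
qed

text \<open>Any increasing tableau of shape \<lambda> would do, since only its shape enters the
  count; \<open>Suc (i + j)\<close> is a simple symmetric choice with positive values.\<close>

definition hook :: "nat list \<Rightarrow> mat" where
  "hook lam i j = (if (min i j, max i j) \<in> shifted_shape lam then enat (Suc (i + j)) else \<infinity>)"

lemma sm_hook: "strict_partition lam \<Longrightarrow> sym_incr (hook lam)"
  by (rule sm_of_shape) (auto simp: hook_def shifted_shape_iff min_def max_def zero_enat_def)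

lemma upset_hook: "upset (hook lam) = shifted_shape lam"
  by (auto simp: hook_def upset_def shifted_shape_iff min_def max_def split: if_splits)

lemma hook_le: "\<exists>n. \<forall>i j. hook lam i j \<noteq> \<infinity> \<longrightarrow> hook lam i j \<le> enat n"
proof -
  obtain n where "\<forall>x\<in>(\<lambda>p. Suc (fst p + snd p)) ` shifted_shape lam. x < n"
    using finite_nat_set_iff_bounded finite_shifted_shape by (metis finite_imageI)
  then have "hook lam i j \<le> enat n" if "hook lam i j \<noteq> \<infinity>" for i j
    using that by (fastforce simp: hook_def min_def max_def split: if_splits)
  then show ?thesis by blast
qed

text \<open>By definition the condition on the small letters is one on the insertion matrix, and
  \<open>skew_iff\<close> turns the condition on the large letters into one as well.\<close>

lemma Omega_partition:
  assumes lam: "strict_partition lam" and T: "URT T" and m: "finite {i. m i \<noteq> 0}"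
    and E0: "sym_incr E0" "upset E0 = shifted_shape lam"
  defines "N \<equiv> {nu. strict_partition nu \<and> shifted_shape lam \<subseteq> shifted_shape nu \<and> sum_list nu \<le> mdeg m}"
  shows "Omega n E0 (toD T) m = (\<Union>E\<in>(\<Union>nu\<in>N. glued n E0 nu T). BW E m)"
proof (intro equalityI subsetI)
  fix xs assume xs: "xs \<in> Omega n E0 (toD T) m"
  let ?E = "ins_word (map snd xs)"
  have b: "xs \<in> biwords m" and c: "restrict_le n ?E = E0" "ins_word (above n (map snd xs)) = toD T"
    using xs by (auto simp: Omega_def)
  have pos: "1 \<le> x" if "x \<in> set (map snd xs)" for x using b that by (auto simp: biwords_iff)
  have E: "sym_incr ?E" using sm_insw pos by blast
  obtain nu where nu: "strict_partition nu" "shifted_shape nu = upset ?E" using ex_shape[OF E] by blast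
  have "sum_list nu = card (upset ?E)" using card_shifted_shape[of nu] nu(2) by simp
  also have "\<dots> \<le> mdeg m"
  proof -
    have "card (upset ?E) \<le> length (map snd xs)" using card_upset_insw pos by blast
    then show ?thesis using length_biword[OF b m] by simp
  qed
  finally have "sum_list nu \<le> mdeg m" .
  moreover have "shifted_shape lam \<subseteq> shifted_shape nu"
    unfolding nu(2) E0(2)[symmetric] c(1)[symmetric] by (auto simp: upset_def restrict_le_def split: if_splits)
  ultimately have "nu \<in> N" using nu(1) by (simp add: N_def)
  moreover have "?E \<in> glued n E0 nu T"
    using E nu(2) c skew_iff[where w = "map snd xs" and n = n, OF pos T] by (simp add: glued_def)
  moreover have "xs \<in> BW ?E m" using b by (simp add: BW_def)
  ultimately show "xs \<in> (\<Union>E\<in>(\<Union>nu\<in>N. glued n E0 nu T). BW E m)" by blast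
next
  fix xs assume "xs \<in> (\<Union>E\<in>(\<Union>nu\<in>N. glued n E0 nu T). BW E m)"
  then obtain nu E where E: "E \<in> glued n E0 nu T" and xs: "xs \<in> BW E m" by blast
  have b: "xs \<in> biwords m" and i: "ins_word (map snd xs) = E" using xs by (auto simp: BW_def)
  have pos: "1 \<le> x" if "x \<in> set (map snd xs)" for x using BW_letters[OF xs that] .
  show "xs \<in> Omega n E0 (toD T) m"
    using b i E skew_iff[where w = "map snd xs" and n = n, OF pos T] by (auto simp: Omega_def glued_def)
qed

text \<open>The identity is stated for the coefficient of one monomial. A shape with more boxes than
  the degree has coefficient 0, since every box holds a letter.\<close>

theorem theorem4:
  fixes lam mu :: "nat list" and T :: tab and m :: "nat \<Rightarrow> nat"
  assumes "strict_partition lam" and "strict_partition mu"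
    and "URT T" and "dom T = shifted_shape mu"
    and "finite {i. m i \<noteq> 0}"
  shows "Kprod_coeff lam mu m =
    (\<Sum>nu \<in> {nu. strict_partition nu \<and> shifted_shape lam \<subseteq> shifted_shape nu \<and> sum_list nu \<le> mdeg m}.
        cnum lam nu T * Kcoeff nu m)"
proof -
  let ?N = "{nu. strict_partition nu \<and> shifted_shape lam \<subseteq> shifted_shape nu \<and> sum_list nu \<le> mdeg m}"
  let ?M = "{(m1, m2). \<forall>i. m1 i + m2 i = m i}"
  define E0 where "E0 = hook lam"
  have E0: "sym_incr E0" "upset E0 = shifted_shape lam"
    using sm_hook[OF assms(1)] upset_hook by (auto simp: E0_def)
  obtain n where n: "\<And>i j. E0 i j \<noteq> \<infinity> \<Longrightarrow> E0 i j \<le> enat n" using hook_le[of lam] by (auto simp: E0_def)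
  have T: "tri T" "sym_incr (toD T)" using assms(3) by (auto simp: URT_def inc_tab_iff)
  have mu: "upset (toD T) = shifted_shape mu" using dom_upset[OF T(1)] assms(4) by simp
  have fin: "finite {i. m1 i \<noteq> 0}" "finite {i. m2 i \<noteq> 0}" if "(m1, m2) \<in> ?M" for m1 m2
  proof -
    have s: "m1 i + m2 i = m i" for i using that by simp
    have "m1 i \<noteq> 0 \<Longrightarrow> m i \<noteq> 0" "m2 i \<noteq> 0 \<Longrightarrow> m i \<noteq> 0" for i using s[of i] by simp_all
    then have "{i. m1 i \<noteq> 0} \<subseteq> {i. m i \<noteq> 0}" "{i. m2 i \<noteq> 0} \<subseteq> {i. m i \<noteq> 0}" by blast+
    then show "finite {i. m1 i \<noteq> 0}" "finite {i. m2 i \<noteq> 0}" using assms(5) finite_subset by blast+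
  qed
  have "Kprod_coeff lam mu m = (\<Sum>(m1, m2)\<in>?M. card (BW E0 m1) * card (BW (toD T) m2))"
    unfolding Kprod_coeff_def
  proof (rule sum.cong[OF refl])
    fix q assume q: "q \<in> ?M"
    obtain m1 m2 where "q = (m1, m2)" by force
    then show "(case q of (m1, m2) \<Rightarrow> Kcoeff lam m1 * Kcoeff mu m2) =
        (case q of (m1, m2) \<Rightarrow> card (BW E0 m1) * card (BW (toD T) m2))"
      using q fin Kcoeff_BW[OF E0] Kcoeff_BW[OF T(2) mu] by simp
  qed
  also have "\<dots> = card (Omega n E0 (toD T) m)"
    by (rule card_Omega_product[OF E0(1) n T(2) assms(5), symmetric])
  also have "\<dots> = card (\<Union>E\<in>(\<Union>nu\<in>?N. glued n E0 nu T). BW E m)"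
    using Omega_partition[OF assms(1,3,5) E0] by simp
  also have "\<dots> = (\<Sum>E\<in>(\<Union>nu\<in>?N. glued n E0 nu T). card (BW E m))"
  proof (rule card_UN_disjoint)
    have "finite (glued n E0 nu T)" if "nu \<in> ?N" for nu
      using bij_betw_finite[OF skew_bij[OF _ _ E0 n]] finite_skews that by blast
    then show "finite (\<Union>nu\<in>?N. glued n E0 nu T)"
      using finite_partitions[of "\<lambda>nu. shifted_shape lam \<subseteq> shifted_shape nu" "mdeg m"] by blast
    show "\<forall>E\<in>(\<Union>nu\<in>?N. glued n E0 nu T). finite (BW E m)"
      using finite_BW assms(5) by (auto simp: glued_def)
  qed (auto simp: BW_def)
  also have "\<dots> = (\<Sum>nu\<in>?N. \<Sum>E\<in>glued n E0 nu T. card (BW E m))"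
  proof (rule sum.UNION_disjoint)
    show "finite ?N" by (rule finite_partitions)
    show "\<forall>nu\<in>?N. finite (glued n E0 nu T)"
      using bij_betw_finite[OF skew_bij[OF _ _ E0 n]] finite_skews by blast
    show "\<forall>nu\<in>?N. \<forall>nu'\<in>?N. nu \<noteq> nu' \<longrightarrow> glued n E0 nu T \<inter> glued n E0 nu' T = {}"
      using shifted_shape_inj by (auto simp: glued_def)
  qed
  also have "\<dots> = (\<Sum>nu\<in>?N. cnum lam nu T * Kcoeff nu m)"
  proof (rule sum.cong[OF refl])
    fix nu assume nu: "nu \<in> ?N"
    \<comment> \<open>The count is the same for all matrices of shape \<nu>, which turns the inner
      sum into a multiple.\<close>
    have "card (BW E m) = Kcoeff nu m" if "E \<in> glued n E0 nu T" for E
      using that Kcoeff_BW[of E nu m] assms(5) by (simp add: glued_def)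
    then have "(\<Sum>E\<in>glued n E0 nu T. card (BW E m)) = card (glued n E0 nu T) * Kcoeff nu m" by simp
    also have "card (glued n E0 nu T) = cnum lam nu T"
      using bij_betw_same_card[OF skew_bij[OF _ _ E0 n]] nu by (simp add: cnum_def skews_def)
    finally show "(\<Sum>E\<in>glued n E0 nu T. card (BW E m)) = cnum lam nu T * Kcoeff nu m" .
  qed
  finally show ?thesis .
qed

end
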